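(* Suppose that the stock process $S$ is continuous and that the insurance process $Y$ a.s. jumps only at finitely many predictable stopping times $0\le\tau_1\le\tau_2\le\dots$ with no additional randomness added between jumps, i.e. $\bar{\mathcal F}^Y_{\tau_{i+1}-}=\bar{\mathcal F}^Y_{\tau_i}$ for all $i$. Let $(\Pi_\sigma)_{0\le\sigma\le T}$ be a time-consistent and market-consistent dynamic evaluation such that $\Pi_\sigma$ is continuous for every stopping time $\sigma$. Then for every stopping time $\sigma$, $\Pi_{\sigma,\tau_\sigma}:=\Pi_\sigma|_{L^\infty(\mathcal F_{\tau_\sigma})}$ satisfies the market local property: for all $A\in\mathcal F^S_{\tau_\sigma}$ and $H\in L^\infty_+(\mathcal F_{\tau_\sigma})$, $$\Pi_\sigma(H)=\Pi_\sigma(I_AH)+\Pi_\sigma(I_{A^c}H).$$ In particular, if $(\Pi_\sigma)$ is additionally assumed to be either monotone, $p$-norm bounded, or positively homogeneous, then for every stopping time $\sigma$ there exists an $\mathcal F^S_{\tau_\sigma}$-conditional evaluation $\Pi_{\mathcal F^S_{\tau_\sigma}}:L^\infty(\mathcal F_{\tau_\sigma})\to L^\infty(\mathcal F^S_{\tau_\sigma})$ such that $$\Pi_{\sigma,\tau_\sigma}(H)=\mathbb E^{\mathbb Q}\big[\Pi_{\mathcal F^S_{\tau_\sigma}}(H)\mid\mathcal F_\sigma\big]\quad\text{for all }H\in L^\infty(\mathcal F_{\tau_\sigma}).$$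
   Context: Setting. $T>0$ is fixed; on a probability space there are stock processes $S=(S^1_t,\dots,S^n_t)_{0\le t\le T}$ and a one-dimensional untraded insurance process $(Y_t)_{0\le t\le T}$. $\bar{\mathcal F}^S,\bar{\mathcal F}^Y$ are the filtrations generated by $S$ and $Y$, and $\mathcal F=(\mathcal F_t)$, $\mathcal F_t=\bar{\mathcal F}^S_t\vee\bar{\mathcal F}^Y_t$. The financial market given by $S$ is arbitrage free and complete, with unique equivalent martingale measure $\mathbb Q$ on $\bar{\mathcal F}^S_T$ with density $d\mathbb Q/d\mathbb P$; $\mathbb Q$ is extended to $\mathcal F_T$ by $\mathbb Q(A)=\mathbb E[\frac{d\mathbb Q}{d\mathbb P}I_A]$. Stopping times take values in $[0,T]$. $L^\infty(\mathcal A)$ denotes bounded $\mathcal A$-measurable random variables, $L^\infty_+(\mathcal A)$ the nonnegative ones; (in)equalities are a.s. A stopping time $\tau$ is predictable if there are stopping times $\tau^n<\tau$ with $\tau^n\uparrow\tau$. On the set where $Y$ does not jump at all one sets $\tau_1=T$ (similarly $\tau_i(\omega)=T$ if a path has fewer than $i$ jumps). For a stopping time $\sigma$, $\tau_\sigma:=\inf\{t>\sigma:\Delta Y_t\neq0\}\wedge T$ is the next jump time of $Y$ after $\sigma$, and $\mathcal F^S_{\tau_\sigma}:=\bar{\mathcal F}^S_{\tau_\sigma}\vee\mathcal F_\sigma$. Evaluations. For $\sigma$-algebras $\mathcal A\subset\mathcal B$, an $\mathcal A$-conditional evaluation is a map $\Pi:L^\infty(\mathcal B)\to L^\infty(\mathcal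 A)$ with: $\Pi(0)=0$; $\Pi(H+m)=\Pi(H)+m$ for $m\in L^\infty(\mathcal A)$; $\Pi(\lambda H_1+(1-\lambda)H_2)\le\lambda\Pi(H_1)+(1-\lambda)\Pi(H_2)$ for $\lambda\in L^\infty(\mathcal A)$, $0\le\lambda\le1$; $\Pi(I_AH_1+I_{A^c}H_2)=I_A\Pi(H_1)+I_{A^c}\Pi(H_2)$ for $A\in\mathcal A$; and $\Pi(H)\le\liminf_n\Pi(H_n)$ for bounded sequences $H_n\to H$ a.s. It is monotone if $H_1\le H_2$ implies $\Pi(H_1)\le\Pi(H_2)$; continuous if $\Pi(H)=\lim_n\Pi(H_n)$ a.s. for bounded sequences $H_n\to H$ a.s.; positively homogeneous if $\Pi(\lambda H)=\lambda\Pi(H)$ for $\lambda\in L^\infty_+(\mathcal A)$; $p$-norm bounded if there are $p\in(1,\infty)$, $\lambda\in L^\infty_+(\mathcal A)$ and a probability measure $\bar{\mathbb P}$ with the same null sets as $\mathbb P$ with $\Pi(H)\le\lambda\,\bar{\mathbb E}[|H|+|H|^p\mid\mathcal A]$ for all $H$. A dynamic evaluation is a family $(\Pi_\sigma)_{0\le\sigma\le T}$ indexed by stopping times, where $\Pi_\sigma:L^\infty(\mathcal F_T)\to L^\infty(\mathcal F_\sigma)$ is an $\mathcal F_\sigma$-conditional evaluation and which is time-consistent: $\Pi_\sigma(H)=\Pi_\sigma(\Pi_\tau(H))$ for all stopping times $\sigma\le\tau$ and $H\in L^\infty(\mathcal F_T)$. It is market-consistent if for every stopping time $\sigma$, $H^S\in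 L^\infty(\bar{\mathcal F}^S_T\vee\mathcal F_\sigma)$ and $H\in L^\infty(\mathcal F_T)$: $\Pi_\sigma(H^S+H)=\mathbb E^{\mathbb Q}[H^S\mid\mathcal F_\sigma]+\Pi_\sigma(H)$. It is called monotone, $p$-norm bounded or positively homogeneous if each $\Pi_\sigma$ is.
   Formalization: The condition on no additional randomness is also imposed before the first jump (i=0, with τ_0=0), without which the claim fails; the probability space is complete, filtrations include null sets, and the stock σ-algebra at τ_σ is the one generated by S stopped at τ_σ. *)

theory Defs
  imports "HOL-Probability.Probability"
begin

section \<open>Sigma-algebras, filtrations and stopping times\<close>

text \<open>
  Time is \<^typ>\<open>real\<close>, and every process is used on \<open>[0, T]\<close> only.  Sigma-algebras are represented by
  measures of which only the underlying sigma-algebra matters.  The probability space \<open>M\<close> will be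
  complete, and generated filtrations are augmented by the \<open>M\<close>-null sets; they are not made
  right-continuous.
\<close>

definition gen_filtration ::
  "'a measure \<Rightarrow> real \<Rightarrow> (real \<Rightarrow> 'a \<Rightarrow> 'b::topological_space) \<Rightarrow> real \<Rightarrow> 'a measure" where
  "gen_filtration M T X t = sigma (space M)
     ({X u -` B \<inter> space M | u B. 0 \<le> u \<and> u \<le> T \<and> u \<le> t \<and> B \<in> sets borel} \<union> null_sets M)"

definition join_sigma :: "'a measure \<Rightarrow> 'a measure \<Rightarrow> 'a measure \<Rightarrow> 'a measure" where
  "join_sigma M A B = sigma (space M) (sets A \<union> sets B)"

definition full_filtration ::
  "'a measure \<Rightarrow> real \<Rightarrow> (real \<Rightarrow> 'a \<Rightarrow> real ^ 'n) \<Rightarrow> (real \<Rightarrow> 'a \<Rightarrow> real) \<Rightarrow> real \<Rightarrow> 'a measure" where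
  "full_filtration M T S Y t = join_sigma M (gen_filtration M T S t) (gen_filtration M T Y t)"

definition stopping_times :: "'a measure \<Rightarrow> real \<Rightarrow> (real \<Rightarrow> 'a measure) \<Rightarrow> ('a \<Rightarrow> real) set" where
  "stopping_times M T F =
     {\<sigma>. stopping_time F \<sigma> \<and> (\<forall>\<omega>\<in>space M. 0 \<le> \<sigma> \<omega> \<and> \<sigma> \<omega> \<le> T)}"

abbreviation sigma_at :: "'a measure \<Rightarrow> (real \<Rightarrow> 'a measure) \<Rightarrow> ('a \<Rightarrow> real) \<Rightarrow> 'a measure" where
  "sigma_at M F \<sigma> \<equiv> filtration.pre_sigma (space M) F \<sigma>"

definition sigma_before :: "'a measure \<Rightarrow> (real \<Rightarrow> 'a measure) \<Rightarrow> ('a \<Rightarrow> real) \<Rightarrow> 'a measure" where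
  "sigma_before M F \<sigma> = sigma (space M)
     (sets (F 0) \<union> {A \<inter> {\<omega>\<in>space M. t < \<sigma> \<omega>} | A t. 0 \<le> t \<and> A \<in> sets (F t)})"

definition predictable_time ::
  "'a measure \<Rightarrow> real \<Rightarrow> (real \<Rightarrow> 'a measure) \<Rightarrow> ('a \<Rightarrow> real) \<Rightarrow> bool" where
  "predictable_time M T F \<tau> \<longleftrightarrow> \<tau> \<in> stopping_times M T F \<and>
     (\<exists>\<rho>::nat \<Rightarrow> 'a \<Rightarrow> real. (\<forall>n. \<rho> n \<in> stopping_times M T F) \<and>
        (AE \<omega> in M. (\<forall>n. \<rho> n \<omega> < \<tau> \<omega>) \<and> incseq (\<lambda>n. \<rho> n \<omega>) \<and> (\<lambda>n. \<rho> n \<omega>) \<longlonglongrightarrow> \<tau> \<omega>))"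

text \<open>
  The sigma-algebra generated by \<open>X\<close> up to a random time \<open>\<rho>\<close>.  It is used for the stock filtration
  at a jump time of the insurance process.  Such a time is in general not a stopping time of the
  stock filtration, so that the sets \<open>A\<close> with \<open>A \<inter> {\<rho> \<le> t} \<in> F\<^sup>S t\<close> for all \<open>t\<close> need not form a
  sigma-algebra; for a constant time \<open>\<rho> = t\<close> one gets \<open>gen_filtration M T X t\<close>.
\<close>

definition gen_sigma_upto ::
  "'a measure \<Rightarrow> real \<Rightarrow> (real \<Rightarrow> 'a \<Rightarrow> 'b::topological_space) \<Rightarrow> ('a \<Rightarrow> real) \<Rightarrow> 'a measure" where
  "gen_sigma_upto M T X \<rho> = sigma (space M)
     ({(\<lambda>\<omega>. X (min u (\<rho> \<omega>)) \<omega>) -` B \<inter> space M | u B. 0 \<le> u \<and> u \<le> T \<and> B \<in> sets borel}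
        \<union> null_sets M)"


section \<open>Jumps of the insurance process\<close>

definition cadlag_on :: "real \<Rightarrow> (real \<Rightarrow> real) \<Rightarrow> bool" where
  "cadlag_on T y \<longleftrightarrow>
     (\<forall>t\<in>{0..<T}. (y \<longlongrightarrow> y t) (at_right t)) \<and> (\<forall>t\<in>{0<..T}. \<exists>l. (y \<longlongrightarrow> l) (at_left t))"

definition jump :: "(real \<Rightarrow> 'a \<Rightarrow> real) \<Rightarrow> real \<Rightarrow> 'a \<Rightarrow> real" where
  "jump Y t \<omega> = Y t \<omega> - Lim (at_left t) (\<lambda>s. Y s \<omega>)"

text \<open>Inserting \<open>T\<close> turns the infimum into \<open>inf {\<dots>} \<and> T\<close> with the convention \<open>inf \<emptyset> = \<infinity>\<close>.\<close>

definition next_jump ::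
  "real \<Rightarrow> (real \<Rightarrow> 'a \<Rightarrow> real) \<Rightarrow> ('a \<Rightarrow> real) \<Rightarrow> 'a \<Rightarrow> real" where
  "next_jump T Y \<sigma> \<omega> = Inf (insert T {t. \<sigma> \<omega> < t \<and> t \<le> T \<and> jump Y t \<omega> \<noteq> 0})"

text \<open>
  \<open>jump_time T Y i\<close> is, for \<open>i \<ge> 1\<close>, the time of the \<open>i\<close>-th jump on paths with finitely many jumps,
  and it equals \<open>T\<close> if there are fewer than \<open>i\<close> jumps.  The starting value is \<open>0\<close>.
\<close>

fun jump_time :: "real \<Rightarrow> (real \<Rightarrow> 'a \<Rightarrow> real) \<Rightarrow> nat \<Rightarrow> 'a \<Rightarrow> real" where
  "jump_time T Y 0 = (\<lambda>\<omega>. 0)"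
| "jump_time T Y (Suc i) = next_jump T Y (jump_time T Y i)"

definition finitely_many_predictable_jumps ::
  "'a measure \<Rightarrow> real \<Rightarrow> (real \<Rightarrow> 'a measure) \<Rightarrow> (real \<Rightarrow> 'a \<Rightarrow> real) \<Rightarrow> bool" where
  "finitely_many_predictable_jumps M T F Y \<longleftrightarrow>
     (AE \<omega> in M. finite {t. 0 < t \<and> t \<le> T \<and> jump Y t \<omega> \<noteq> 0}) \<and>
     (\<forall>i\<ge>1. predictable_time M T F (jump_time T Y i))"

text \<open>The case \<open>i = 0\<close> excludes additional randomness before the first jump.\<close>

definition no_randomness_between_jumps ::
  "'a measure \<Rightarrow> real \<Rightarrow> (real \<Rightarrow> 'a \<Rightarrow> real) \<Rightarrow> bool" where
  "no_randomness_between_jumps M T Y \<longleftrightarrow>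
     (\<forall>i. sets (sigma_before M (gen_filtration M T Y) (jump_time T Y (Suc i)))
        = sets (sigma_at M (gen_filtration M T Y) (jump_time T Y i)))"

text \<open>The stock sigma-algebra at the next jump after \<open>\<sigma>\<close>, enlarged by the full information at \<open>\<sigma>\<close>.\<close>

definition stock_sigma_next_jump ::
  "'a measure \<Rightarrow> real \<Rightarrow> (real \<Rightarrow> 'a \<Rightarrow> real ^ 'n) \<Rightarrow> (real \<Rightarrow> 'a \<Rightarrow> real) \<Rightarrow> ('a \<Rightarrow> real) \<Rightarrow> 'a measure" where
  "stock_sigma_next_jump M T S Y \<sigma> =
     join_sigma M (gen_sigma_upto M T S (next_jump T Y \<sigma>)) (sigma_at M (full_filtration M T S Y) \<sigma>)"


section \<open>The pricing measure\<close>

definition equivalent_martingale_measure ::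
  "'a measure \<Rightarrow> real \<Rightarrow> (real \<Rightarrow> 'a \<Rightarrow> real ^ 'n) \<Rightarrow> 'a measure \<Rightarrow> bool" where
  "equivalent_martingale_measure M T S Q \<longleftrightarrow>
     (let G = gen_filtration M T S in
      prob_space Q \<and> space Q = space M \<and> sets Q = sets (G T) \<and>
      null_sets Q = null_sets M \<inter> sets (G T) \<and>
      (\<forall>i. \<forall>t\<in>{0..T}. integrable Q (\<lambda>\<omega>. S t \<omega> $ i)) \<and>
      (\<forall>i s t. 0 \<le> s \<and> s \<le> t \<and> t \<le> T \<longrightarrow>
         (AE \<omega> in Q. real_cond_exp Q (G s) (\<lambda>\<omega>. S t \<omega> $ i) \<omega> = S s \<omega> $ i)))"

text \<open>
  Absence of arbitrage and completeness of the market are expressed by the existence and the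
  uniqueness, respectively, of an equivalent martingale measure for the (discounted) stock prices.
\<close>

definition unique_martingale_measure ::
  "'a measure \<Rightarrow> real \<Rightarrow> (real \<Rightarrow> 'a \<Rightarrow> real ^ 'n) \<Rightarrow> 'a measure \<Rightarrow> bool" where
  "unique_martingale_measure M T S Q \<longleftrightarrow> equivalent_martingale_measure M T S Q \<and>
     (\<forall>Q'. equivalent_martingale_measure M T S Q' \<longrightarrow> Q' = Q)"

text \<open>
  \<open>RN_deriv (restr_to_subalg M (gen_filtration M T S T)) Q\<close> is the density of \<open>Q\<close> with respect to \<open>M\<close>
  on the stock sigma-algebra at time \<open>T\<close>; the same density is used to extend \<open>Q\<close>.
\<close>

definition extended_measure ::
  "'a measure \<Rightarrow> real \<Rightarrow> (real \<Rightarrow> 'a \<Rightarrow> real ^ 'n) \<Rightarrow> 'a measure \<Rightarrow> 'a measure" where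
  "extended_measure M T S Q =
     density M (RN_deriv (restr_to_subalg M (gen_filtration M T S T)) Q)"


section \<open>Conditional evaluations\<close>

definition Linf :: "'a measure \<Rightarrow> 'a measure \<Rightarrow> ('a \<Rightarrow> real) set" where
  "Linf M A = {f \<in> borel_measurable A. \<exists>C. AE \<omega> in M. \<bar>f \<omega>\<bar> \<le> C}"

definition Linf_nonneg :: "'a measure \<Rightarrow> 'a measure \<Rightarrow> ('a \<Rightarrow> real) set" where
  "Linf_nonneg M A = {f \<in> Linf M A. AE \<omega> in M. 0 \<le> f \<omega>}"

definition bounded_ae_conv ::
  "'a measure \<Rightarrow> 'a measure \<Rightarrow> (nat \<Rightarrow> 'a \<Rightarrow> real) \<Rightarrow> ('a \<Rightarrow> real) \<Rightarrow> bool" where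
  "bounded_ae_conv M B Hs H \<longleftrightarrow> (\<forall>n. Hs n \<in> Linf M B) \<and> H \<in> Linf M B \<and>
     (\<exists>C. \<forall>n. AE \<omega> in M. \<bar>Hs n \<omega>\<bar> \<le> C) \<and> (AE \<omega> in M. (\<lambda>n. Hs n \<omega>) \<longlonglongrightarrow> H \<omega>)"

text \<open>
  The evaluations act on representatives, all properties being required almost surely.  The lower
  limit is taken in \<^typ>\<open>ereal\<close>, since the values along the sequence need not be bounded.
\<close>

definition cond_evaluation ::
  "'a measure \<Rightarrow> 'a measure \<Rightarrow> 'a measure \<Rightarrow> (('a \<Rightarrow> real) \<Rightarrow> 'a \<Rightarrow> real) \<Rightarrow> bool" where
  "cond_evaluation M A B \<Phi> \<longleftrightarrow>
     subalgebra M B \<and> subalgebra B A \<and>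
     (\<forall>H\<in>Linf M B. \<Phi> H \<in> Linf M A) \<and>
     (AE \<omega> in M. \<Phi> (\<lambda>_. 0) \<omega> = 0) \<and>
     (\<forall>H\<in>Linf M B. \<forall>m\<in>Linf M A. AE \<omega> in M. \<Phi> (\<lambda>x. H x + m x) \<omega> = \<Phi> H \<omega> + m \<omega>) \<and>
     (\<forall>H\<^sub>1\<in>Linf M B. \<forall>H\<^sub>2\<in>Linf M B. \<forall>l\<in>Linf M A. (AE \<omega> in M. 0 \<le> l \<omega> \<and> l \<omega> \<le> 1) \<longrightarrow>
        (AE \<omega> in M. \<Phi> (\<lambda>x. l x * H\<^sub>1 x + (1 - l x) * H\<^sub>2 x) \<omega>
                      \<le> l \<omega> * \<Phi> H\<^sub>1 \<omega> + (1 - l \<omega>) * \<Phi> H\<^sub>2 \<omega>)) \<and>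
     (\<forall>H\<^sub>1\<in>Linf M B. \<forall>H\<^sub>2\<in>Linf M B. \<forall>E\<in>sets A.
        (AE \<omega> in M. \<Phi> (\<lambda>x. indicator E x * H\<^sub>1 x + indicator (space M - E) x * H\<^sub>2 x) \<omega>
                      = indicator E \<omega> * \<Phi> H\<^sub>1 \<omega> + indicator (space M - E) \<omega> * \<Phi> H\<^sub>2 \<omega>)) \<and>
     (\<forall>Hs H. bounded_ae_conv M B Hs H \<longrightarrow>
        (AE \<omega> in M. ereal (\<Phi> H \<omega>) \<le> liminf (\<lambda>n. ereal (\<Phi> (Hs n) \<omega>))))"

definition monotone_eval ::
  "'a measure \<Rightarrow> 'a measure \<Rightarrow> (('a \<Rightarrow> real) \<Rightarrow> 'a \<Rightarrow> real) \<Rightarrow> bool" where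
  "monotone_eval M B \<Phi> \<longleftrightarrow>
     (\<forall>H\<^sub>1\<in>Linf M B. \<forall>H\<^sub>2\<in>Linf M B. (AE \<omega> in M. H\<^sub>1 \<omega> \<le> H\<^sub>2 \<omega>) \<longrightarrow> (AE \<omega> in M. \<Phi> H\<^sub>1 \<omega> \<le> \<Phi> H\<^sub>2 \<omega>))"

definition continuous_eval ::
  "'a measure \<Rightarrow> 'a measure \<Rightarrow> (('a \<Rightarrow> real) \<Rightarrow> 'a \<Rightarrow> real) \<Rightarrow> bool" where
  "continuous_eval M B \<Phi> \<longleftrightarrow>
     (\<forall>Hs H. bounded_ae_conv M B Hs H \<longrightarrow> (AE \<omega> in M. (\<lambda>n. \<Phi> (Hs n) \<omega>) \<longlonglongrightarrow> \<Phi> H \<omega>))"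

definition pos_homogeneous_eval ::
  "'a measure \<Rightarrow> 'a measure \<Rightarrow> 'a measure \<Rightarrow> (('a \<Rightarrow> real) \<Rightarrow> 'a \<Rightarrow> real) \<Rightarrow> bool" where
  "pos_homogeneous_eval M A B \<Phi> \<longleftrightarrow>
     (\<forall>H\<in>Linf M B. \<forall>l\<in>Linf_nonneg M A. AE \<omega> in M. \<Phi> (\<lambda>x. l x * H x) \<omega> = l \<omega> * \<Phi> H \<omega>)"

definition p_norm_bounded_eval ::
  "'a measure \<Rightarrow> 'a measure \<Rightarrow> 'a measure \<Rightarrow> (('a \<Rightarrow> real) \<Rightarrow> 'a \<Rightarrow> real) \<Rightarrow> bool" where
  "p_norm_bounded_eval M A B \<Phi> \<longleftrightarrow>
     (\<exists>p::real. \<exists>l\<in>Linf_nonneg M A. \<exists>P'.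
        1 < p \<and> prob_space P' \<and> sets P' = sets M \<and> null_sets P' = null_sets M \<and>
        (\<forall>H\<in>Linf M B. AE \<omega> in M.
           \<Phi> H \<omega> \<le> l \<omega> * real_cond_exp P' A (\<lambda>x. \<bar>H x\<bar> + \<bar>H x\<bar> powr p) \<omega>))"


section \<open>Dynamic evaluations\<close>

definition dynamic_evaluation ::
  "'a measure \<Rightarrow> real \<Rightarrow> (real \<Rightarrow> 'a measure) \<Rightarrow> (('a \<Rightarrow> real) \<Rightarrow> ('a \<Rightarrow> real) \<Rightarrow> 'a \<Rightarrow> real) \<Rightarrow> bool" where
  "dynamic_evaluation M T F \<Phi> \<longleftrightarrow>
     (\<forall>\<sigma>\<in>stopping_times M T F. cond_evaluation M (sigma_at M F \<sigma>) (F T) (\<Phi> \<sigma>)) \<and>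
     (\<forall>\<sigma>\<in>stopping_times M T F. \<forall>\<tau>\<in>stopping_times M T F. (AE \<omega> in M. \<sigma> \<omega> \<le> \<tau> \<omega>) \<longrightarrow>
        (\<forall>H\<in>Linf M (F T). AE \<omega> in M. \<Phi> \<sigma> H \<omega> = \<Phi> \<sigma> (\<Phi> \<tau> H) \<omega>))"

text \<open>\<open>G\<close> is the stock sigma-algebra at time \<open>T\<close> and \<open>Q\<close> the extended pricing measure.\<close>

definition market_consistent ::
  "'a measure \<Rightarrow> real \<Rightarrow> (real \<Rightarrow> 'a measure) \<Rightarrow> 'a measure \<Rightarrow> 'a measure \<Rightarrow>
     (('a \<Rightarrow> real) \<Rightarrow> ('a \<Rightarrow> real) \<Rightarrow> 'a \<Rightarrow> real) \<Rightarrow> bool" where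
  "market_consistent M T F G Q \<Phi> \<longleftrightarrow>
     (\<forall>\<sigma>\<in>stopping_times M T F. \<forall>HS\<in>Linf M (join_sigma M G (sigma_at M F \<sigma>)). \<forall>H\<in>Linf M (F T).
        AE \<omega> in M. \<Phi> \<sigma> (\<lambda>x. HS x + H x) \<omega> = real_cond_exp Q (sigma_at M F \<sigma>) HS \<omega> + \<Phi> \<sigma> H \<omega>)"

definition market_local ::
  "'a measure \<Rightarrow> 'a measure \<Rightarrow> 'a measure \<Rightarrow> (('a \<Rightarrow> real) \<Rightarrow> 'a \<Rightarrow> real) \<Rightarrow> bool" where
  "market_local M G B \<Phi> \<longleftrightarrow>
     (\<forall>E\<in>sets G. \<forall>H\<in>Linf_nonneg M B. AE \<omega> in M.
        \<Phi> H \<omega> = \<Phi> (\<lambda>x. indicator E x * H x) \<omega> + \<Phi> (\<lambda>x. indicator (space M - E) x * H x) \<omega>)"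

end

theory Submission
  imports Defs
begin

text \<open>
  Let \<open>\<rho> n \<up> \<tau>\<close> announce the next jump \<open>\<tau>\<close> after \<open>\<sigma>\<close>, and write \<open>K\<close> for the sigma-algebra generated by
  all stock information and \<open>F \<sigma>\<close>.  No randomness between jumps gives \<open>F (\<rho> n) \<subseteq> K\<close>, and continuity of
  \<open>S\<close> gives that the stock sigma-algebra at \<open>\<tau>\<close> is contained in the sigma-algebra \<open>G\<close> generated by all
  \<open>F (\<rho> n)\<close>.  By time consistency and market consistency,
  \<open>\<Phi> \<sigma> (1\<^sub>E H) = \<Phi> \<sigma> (\<Phi> (\<rho> n) (1\<^sub>E H)) = E\<^sup>Q[1\<^sub>E \<Phi> (\<rho> n) H | F \<sigma>]\<close> for \<open>E \<in> F (\<rho> n)\<close>, which is additive in \<open>E\<close>;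
  continuity of \<open>\<Phi> \<sigma>\<close> extends additivity to \<open>E \<in> G\<close>.  Hence \<open>E \<mapsto> E\<^sup>Q[\<Phi> \<sigma> (1\<^sub>E H)]\<close> is a signed measure on
  \<open>G\<close>, once \<open>\<Phi> \<sigma> (1\<^sub>E H)\<close> is bounded uniformly in \<open>E\<close>, and its density, projected to the
  stock sigma-algebra, is the desired conditional evaluation of \<open>H\<close>.  The density is bounded, since otherwise one could paste the \<open>\<rho> n\<close> together to a
  stopping time \<open>\<theta>\<close> with \<open>\<Phi> \<theta> H\<close> unbounded.
\<close>

section \<open>Densities of set functions\<close>

text \<open>Evaluations are convex but in general not linear, and their values are fixed only almost
  surely, so additivity in \<open>E\<close> does not directly yield a random measure. Integrating
  against \<open>Q\<close> turns it into a real set function, and locality of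
  \<open>\<Phi> \<sigma>\<close> with respect to \<open>pre_sigma \<sigma>\<close> recovers the
  conditional statement from the integrated one. The uniform bound in \<open>E\<close> is the only
  place where monotonicity, the p-norm bound or positive homogeneity enters. It controls the values
  \<open>\<Phi> \<sigma> (cut E H)\<close> and supplies domination, but says nothing about the size
  of the density, whose boundedness therefore needs its own argument. The density depends on the
  claim in a nonlinear way; its lower semicontinuity and its convexity with random weights are not
  inherited from integration theory and both rest on gluing claims along sets of the conditioning
  sigma-algebra. Since the filtration need not be right continuous, sets and stopping times are
  corrected on null sets by completeness, and processes are approximated from the left.\<close>

lemma (in finite_measure) nonneg_set_function_density:
  fixes \<nu> :: "'a set \<Rightarrow> real"
  assumes add: "\<And>A B. A \<in> sets M \<Longrightarrow> B \<in> sets M \<Longrightarrow> A \<inter> B = {} \<Longrightarrow> \<nu> (A \<union> B) = \<nu> A + \<nu> B"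
    and cont: "\<And>A. range A \<subseteq> sets M \<Longrightarrow> decseq A \<Longrightarrow> (\<Inter>i. A i) = {} \<Longrightarrow> (\<lambda>i. \<nu> (A i)) \<longlonglongrightarrow> 0"
    and ac: "\<And>A. A \<in> null_sets M \<Longrightarrow> \<nu> A = 0"
    and nonneg: "\<And>A. A \<in> sets M \<Longrightarrow> 0 \<le> \<nu> A"
  shows "\<exists>c. integrable M c \<and> (\<forall>A\<in>sets M. \<nu> A = (\<integral>x. indicator A x * c x \<partial>M))"
proof -
  have nu0: "\<nu> {} = 0" using ac[of "{}"] by auto
  define N where "N = measure_of (space M) (sets M) (\<lambda>A. ennreal (\<nu> A))"
  \<comment> \<open>For a nonnegative finite additive set function, continuity at the empty set is
    equivalent to countable additivity, so \<open>N\<close> is a genuine measure.\<close>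
  have ca: "countably_additive (sets M) (\<lambda>A. ennreal (\<nu> A))"
  proof (rule sets.empty_continuous_imp_countably_additive)
    show "positive (sets M) (\<lambda>A. ennreal (\<nu> A))" by (simp add: positive_def nu0)
    show "additive (sets M) (\<lambda>A. ennreal (\<nu> A))"
      by (auto simp: additive_def add nonneg ennreal_plus[symmetric] simp del: ennreal_plus)
    fix A :: "nat \<Rightarrow> 'a set"
    assume "range A \<subseteq> sets M" "decseq A" "(\<Inter>i. A i) = {}"
    from tendsto_ennrealI[OF cont[OF this]] show "(\<lambda>i. ennreal (\<nu> (A i))) \<longlonglongrightarrow> 0" by simp
  qed auto
  have sets_N: "sets N = sets M" and space_N: "space N = space M" by (auto simp: N_def)
  have em: "emeasure N A = ennreal (\<nu> A)" if "A \<in> sets M" for A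
    unfolding N_def
    by (rule emeasure_measure_of_sigma[OF sets.sigma_algebra_axioms _ ca that]) (simp add: positive_def nu0)
  have "absolutely_continuous M N"
    by (auto simp: absolutely_continuous_def null_sets_def sets_N em) (use ac in \<open>auto simp: null_sets_def\<close>)
  from Radon_Nikodym[OF this sets_N] obtain f where f [measurable]: "f \<in> borel_measurable M" and d: "density M f = N"
    by auto
  have int: "(\<integral>\<^sup>+x. f x * indicator A x \<partial>M) = ennreal (\<nu> A)" if "A \<in> sets M" for A
    using em[OF that] emeasure_density[OF f that] d by simp
  have "(\<integral>\<^sup>+x. f x \<partial>M) = ennreal (\<nu> (space M))"
    using int[OF sets.top] by (subst (asm) nn_integral_cong[of M _ f]) auto
  \<comment> \<open>The total mass is a real number, so the density is infinite at most on a null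
    set and \<open>enn2real\<close> loses nothing.\<close>
  then have fin: "AE x in M. f x \<noteq> \<infinity>"
    by (intro nn_integral_PInf_AE) auto
  define c where "c = (\<lambda>x. enn2real (f x))"
  have cm [measurable]: "c \<in> borel_measurable M" by (simp add: c_def)
  have nn: "(\<integral>\<^sup>+x. ennreal (indicator A x * c x) \<partial>M) = ennreal (\<nu> A)" if "A \<in> sets M" for A
    unfolding int[OF that, symmetric] c_def
    using fin by (intro nn_integral_cong_AE) (auto split: split_indicator simp: top.not_eq_extremum ennreal_enn2real_if)
  have "integrable M (\<lambda>x. indicator (space M) x * c x)"
    using nn[OF sets.top] by (intro integrableI_nonneg) (auto simp: c_def)
  then have "integrable M c"
    by (rule Bochner_Integration.integrable_cong[THEN iffD1, rotated 2]) auto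
  moreover have "\<nu> A = (\<integral>x. indicator A x * c x \<partial>M)" if "A \<in> sets M" for A
    using that nn[OF that] nonneg[OF that] by (subst integral_eq_nn_integral) (auto simp: c_def)
  ultimately show ?thesis by auto
qed

text \<open>The positive part of a Hahn decomposition is a maximiser of \<open>\<nu>\<close>, obtained as the lower limit of
  a maximising sequence.\<close>

lemma (in finite_measure) hahn_decomposition_set_function:
  fixes \<nu> :: "'a set \<Rightarrow> real"
  assumes add: "\<And>A B. A \<in> sets M \<Longrightarrow> B \<in> sets M \<Longrightarrow> A \<inter> B = {} \<Longrightarrow> \<nu> (A \<union> B) = \<nu> A + \<nu> B"
    and cont: "\<And>A. range A \<subseteq> sets M \<Longrightarrow> decseq A \<Longrightarrow> (\<Inter>i. A i) = {} \<Longrightarrow> (\<lambda>i. \<nu> (A i)) \<longlonglongrightarrow> 0"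
    and bdd: "\<And>A. A \<in> sets M \<Longrightarrow> \<nu> A \<le> R"
  shows "\<exists>C\<in>sets M. \<forall>A\<in>sets M. (A \<subseteq> C \<longrightarrow> 0 \<le> \<nu> A) \<and> (A \<inter> C = {} \<longrightarrow> \<nu> A \<le> 0)"
proof -
  have diff: "\<nu> (A - B) = \<nu> A - \<nu> B" if "A \<in> sets M" "B \<in> sets M" "B \<subseteq> A" for A B
    using add[of B "A - B"] that by (auto simp: Un_absorb1)
  have modular: "\<nu> (A \<inter> B) = \<nu> A + \<nu> B - \<nu> (A \<union> B)" if [measurable]: "A \<in> sets M" "B \<in> sets M" for A B
  proof -
    have "\<nu> (A \<union> B) = \<nu> A + \<nu> (B - A \<inter> B)"
      by (subst add[symmetric]) (auto intro: arg_cong[where f = \<nu>])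
    then show ?thesis by (simp add: diff)
  qed
  define s where "s = (SUP A\<in>sets M. \<nu> A)"
  have bdds: "bdd_above (\<nu> ` sets M)" using bdd by (auto intro!: bdd_aboveI[of _ R])
  have le_s: "\<nu> A \<le> s" if "A \<in> sets M" for A
    unfolding s_def using that bdds by (rule cSUP_upper)
  have "\<exists>A\<in>sets M. s - (1/2)^n < \<nu> A" for n :: nat
    using less_cSUP_iff[of "sets M" \<nu> "s - (1/2)^n"] bdds unfolding s_def by auto
  then obtain A where A [measurable]: "\<And>n::nat. A n \<in> sets M" and A_gt: "\<And>n. s - (1/2)^n < \<nu> (A n)"
    by metis
  define I where "I m k = (\<Inter>n\<in>{m..m+k}. A n)" for m k
  have I [measurable]: "I m k \<in> sets M" for m k unfolding I_def by auto
  \<comment> \<open>By modularity, intersecting with \<open>A n\<close> costs less than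
    \<open>(1/2)^n\<close>, because the union has value at most \<open>s\<close>. The term
    \<open>(1/2)^(m+k)\<close> is the part of the geometric budget not yet spent.\<close>
  have I_gt: "s - 2 * (1/2)^m + (1/2)^(m+k) \<le> \<nu> (I m k)" for m k
  proof (induction k)
    case 0
    then show ?case using A_gt[of m] by (simp add: I_def)
  next
    case (Suc k)
    have "I m (Suc k) = I m k \<inter> A (m + Suc k)" by (auto simp: I_def le_Suc_eq)
    then have "\<nu> (I m (Suc k)) = \<nu> (I m k) + \<nu> (A (m + Suc k)) - \<nu> (I m k \<union> A (m + Suc k))"
      by (simp add: modular)
    then show ?case
      using Suc A_gt[of "m + Suc k"] le_s[of "I m k \<union> A (m + Suc k)"] by simp
  qed
  have cont_dec: "(\<lambda>i. \<nu> (B i)) \<longlonglongrightarrow> \<nu> (\<Inter>i. B i)" if B: "range B \<subseteq> sets M" "decseq B" for B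
  proof -
    have [measurable]: "B i \<in> sets M" for i using B by auto
    have "(\<lambda>i. \<nu> (B i - (\<Inter>i. B i))) \<longlonglongrightarrow> 0"
      using B by (intro cont) (auto simp: decseq_def)
    also have "(\<lambda>i. \<nu> (B i - (\<Inter>i. B i))) = (\<lambda>i. \<nu> (B i) - \<nu> (\<Inter>i. B i))"
      by (intro ext diff) auto
    finally show ?thesis by (subst (asm) LIM_zero_iff)
  qed
  define J where "J m = (\<Inter>k. I m k)" for m
  have J [measurable]: "J m \<in> sets M" for m unfolding J_def by auto
  have J_ge: "s - 2 * (1/2)^m \<le> \<nu> (J m)" for m
  proof (rule LIMSEQ_le_const[OF cont_dec[of "I m", folded J_def]])
    show "decseq (I m)" by (auto simp: decseq_def I_def)
    show "\<exists>N. \<forall>n\<ge>N. s - 2 * (1 / 2) ^ m \<le> \<nu> (I m n)"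
    proof (intro exI[of _ 0] allI impI)
      fix n
      have "0 \<le> (1/2::real)^(m+n)" by simp
      then show "s - 2 * (1 / 2) ^ m \<le> \<nu> (I m n)" using I_gt[of m n] by linarith
    qed
  qed (use I in blast)
  define C where "C = (\<Union>m. J m)"
  have C [measurable]: "C \<in> sets M" unfolding C_def by auto
  have "incseq J" unfolding incseq_Suc_iff J_def I_def
    apply (auto)
    subgoal for m x k n by (drule spec[of _ "Suc k"]) auto
    done
  have "(\<lambda>m. \<nu> (C - J m)) \<longlonglongrightarrow> 0"
    using \<open>incseq J\<close> by (intro cont) (auto simp: decseq_def incseq_def C_def)
  then have "(\<lambda>m. \<nu> C - \<nu> (J m)) \<longlonglongrightarrow> 0"
    by (subst (asm) diff) (auto simp: C_def)
  then have "(\<lambda>m. \<nu> C - (\<nu> C - \<nu> (J m))) \<longlonglongrightarrow> \<nu> C - 0" by (intro tendsto_intros)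
  then have "(\<lambda>m. \<nu> (J m)) \<longlonglongrightarrow> \<nu> C" by simp
  moreover have "(\<lambda>m. s - 2 * (1/2)^m) \<longlonglongrightarrow> s - 2 * 0"
    by (intro tendsto_intros LIMSEQ_power_zero) auto
  ultimately have "s \<le> \<nu> C"
    using J_ge by (intro LIMSEQ_le[of "\<lambda>m. s - 2 * (1/2)^m" s "\<lambda>m. \<nu> (J m)"]) auto
  then have Cs: "\<nu> C = s" using le_s[OF C] by simp
  \<comment> \<open>Since \<open>C\<close> attains the maximum \<open>s\<close>, removing a set of
    negative value from \<open>C\<close>, or adding a disjoint one of positive value, would exceed
    \<open>s\<close>.\<close>
  show ?thesis
  proof (intro bexI[OF _ C] ballI conjI impI)
    fix B assume B: "B \<in> sets M" "B \<subseteq> C"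
    then show "0 \<le> \<nu> B" using diff[of C B] le_s[of "C - B"] Cs by auto
  next
    fix B assume B: "B \<in> sets M" "B \<inter> C = {}"
    then show "\<nu> B \<le> 0" using add[of B C] le_s[of "B \<union> C"] Cs by auto
  qed
qed

text \<open>Jordan decomposition: on \<open>C\<close> the set function \<open>\<nu>\<close> is
  nonnegative and off \<open>C\<close> its negative is, so each half has a density by the
  nonnegative case. The difference of the two densities represents \<open>\<nu>\<close>.\<close>

lemma (in finite_measure) set_function_density:
  fixes \<nu> :: "'a set \<Rightarrow> real"
  assumes add: "\<And>A B. A \<in> sets M \<Longrightarrow> B \<in> sets M \<Longrightarrow> A \<inter> B = {} \<Longrightarrow> \<nu> (A \<union> B) = \<nu> A + \<nu> B"
    and cont: "\<And>A. range A \<subseteq> sets M \<Longrightarrow> decseq A \<Longrightarrow> (\<Inter>i. A i) = {} \<Longrightarrow> (\<lambda>i. \<nu> (A i)) \<longlonglongrightarrow> 0"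
    and ac: "\<And>A. A \<in> null_sets M \<Longrightarrow> \<nu> A = 0"
    and bdd: "\<And>A. A \<in> sets M \<Longrightarrow> \<nu> A \<le> R"
  shows "\<exists>c. integrable M c \<and> (\<forall>A\<in>sets M. \<nu> A = (\<integral>x. indicator A x * c x \<partial>M))"
proof -
  have "\<exists>C\<in>sets M. \<forall>A\<in>sets M. (A \<subseteq> C \<longrightarrow> 0 \<le> \<nu> A) \<and> (A \<inter> C = {} \<longrightarrow> \<nu> A \<le> 0)"
    by (rule hahn_decomposition_set_function[of \<nu> R]) (fact add, fact cont, fact bdd)
  then obtain C where C: "C \<in> sets M"
    and "\<forall>A\<in>sets M. (A \<subseteq> C \<longrightarrow> 0 \<le> \<nu> A) \<and> (A \<inter> C = {} \<longrightarrow> \<nu> A \<le> 0)" ..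
  then have pos: "A \<subseteq> C \<Longrightarrow> 0 \<le> \<nu> A" and neg: "A \<inter> C = {} \<Longrightarrow> \<nu> A \<le> 0" if "A \<in> sets M" for A
    using that by simp_all
  have split: "\<nu> A = \<nu> (A \<inter> C) + \<nu> (A - C)" if "A \<in> sets M" for A
    using add[of "A \<inter> C" "A - C"] that C by (simp add: Int_Diff_Un Int_Diff_disjoint)
  have c0: "\<exists>c. integrable M c \<and> (\<forall>A\<in>sets M. \<nu> (A \<inter> C) = (\<integral>x. indicator A x * c x \<partial>M))"
  proof (rule nonneg_set_function_density)
    fix A B assume "A \<in> sets M" "B \<in> sets M" "A \<inter> B = {}"
    moreover from this have "(A \<inter> C) \<inter> (B \<inter> C) = {}" by blast
    ultimately have "\<nu> ((A \<inter> C) \<union> (B \<inter> C)) = \<nu> (A \<inter> C) + \<nu> (B \<inter> C)"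
      using C by (metis add sets.Int)
    then show "\<nu> ((A \<union> B) \<inter> C) = \<nu> (A \<inter> C) + \<nu> (B \<inter> C)"
      by (simp add: Int_Un_distrib2)
  next
    fix A :: "nat \<Rightarrow> 'a set" assume "range A \<subseteq> sets M" "decseq A" "(\<Inter>i. A i) = {}"
    then show "(\<lambda>i. \<nu> (A i \<inter> C)) \<longlonglongrightarrow> 0"
      using C by (intro cont) (simp_all add: image_subset_iff monotone_def le_infI1)
  next
    fix A assume "A \<in> null_sets M"
    then show "\<nu> (A \<inter> C) = 0" using C by (intro ac null_set_Int2)
  next
    fix A assume "A \<in> sets M" then show "0 \<le> \<nu> (A \<inter> C)" using C by (intro pos) auto
  qed
  have d0: "\<exists>c. integrable M c \<and> (\<forall>A\<in>sets M. - \<nu> (A - C) = (\<integral>x. indicator A x * c x \<partial>M))"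
  proof (rule nonneg_set_function_density)
    fix A B assume "A \<in> sets M" "B \<in> sets M" "A \<inter> B = {}"
    moreover from this have "(A - C) \<inter> (B - C) = {}" by blast
    ultimately have "\<nu> ((A - C) \<union> (B - C)) = \<nu> (A - C) + \<nu> (B - C)"
      using C by (metis add sets.Diff)
    then show "- \<nu> ((A \<union> B) - C) = - \<nu> (A - C) + - \<nu> (B - C)"
      by (simp add: Un_Diff)
  next
    fix A :: "nat \<Rightarrow> 'a set" assume "range A \<subseteq> sets M" "decseq A" "(\<Inter>i. A i) = {}"
    then have "(\<lambda>i. \<nu> (A i - C)) \<longlonglongrightarrow> 0"
      using C by (intro cont) (simp_all add: image_subset_iff monotone_def Diff_mono)
    from tendsto_minus[OF this] show "(\<lambda>i. - \<nu> (A i - C)) \<longlonglongrightarrow> 0" by simp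
  next
    fix A assume "A \<in> sets M" then show "0 \<le> - \<nu> (A - C)" using neg[of "A - C"] C by auto
  next
    fix A assume "A \<in> null_sets M"
    then show "- \<nu> (A - C) = 0" using C by (subst ac) (auto intro: null_set_Diff)
  qed
  obtain c where "integrable M c \<and> (\<forall>A\<in>sets M. \<nu> (A \<inter> C) = (\<integral>x. indicator A x * c x \<partial>M))"
    using c0 ..
  note c = conjunct1[OF this] conjunct2[OF this]
  obtain d where "integrable M d \<and> (\<forall>A\<in>sets M. - \<nu> (A - C) = (\<integral>x. indicator A x * d x \<partial>M))"
    using d0 ..
  note d = conjunct1[OF this] conjunct2[OF this]
  show ?thesis
  proof (intro exI[of _ "\<lambda>x. c x - d x"] conjI ballI)
    show "integrable M (\<lambda>x. c x - d x)" using c(1) d(1) by simp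
    fix A assume A: "A \<in> sets M"
    have "integrable M (\<lambda>x. indicator A x * c x)" "integrable M (\<lambda>x. indicator A x * d x)"
      using c(1) d(1) integrable_mult_indicator[OF A, of c] integrable_mult_indicator[OF A, of d] by simp_all
    then have "(\<integral>x. indicator A x * (c x - d x) \<partial>M) = \<nu> (A \<inter> C) - - \<nu> (A - C)"
      unfolding right_diff_distrib bspec[OF c(2) A] bspec[OF d(2) A] by (rule Bochner_Integration.integral_diff)
    then show "\<nu> A = (\<integral>x. indicator A x * (c x - d x) \<partial>M)"
      unfolding split[OF A] by simp
  qed
qed

section \<open>Approximation and boundedness along an increasing sequence of sigma-algebras\<close>

text \<open>The sets that can be approximated in measure by members of the \<open>G n\<close> are
  closed under complements and countable unions. A countable union is first cut to finitely many
  terms, whose approximants lie in a common \<open>G m\<close> by monotonicity.\<close>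

lemma (in finite_measure) approx_by_increasing_union:
  fixes G :: "nat \<Rightarrow> 'a measure"
  assumes sub: "\<And>n. subalgebra M (G n)"
    and mono: "\<And>m n. m \<le> n \<Longrightarrow> sets (G m) \<subseteq> sets (G n)"
    and A: "A \<in> sigma_sets (space M) (\<Union>n. sets (G n))" and "0 < \<epsilon>"
  shows "\<exists>n. \<exists>D\<in>sets (G n). measure M ((A - D) \<union> (D - A)) < \<epsilon>"
  using A \<open>0 < \<epsilon>\<close>
proof (induction arbitrary: \<epsilon>)
  case (Basic a)
  then obtain n where "a \<in> sets (G n)" by auto
  then show ?case using \<open>0 < \<epsilon>\<close> by (intro exI[of _ n] bexI[of _ a]) auto
next
  case Empty
  then show ?case by (intro exI[of _ 0] bexI[of _ "{}"]) auto
next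
  case (Compl a)
  obtain n D where D: "D \<in> sets (G n)" "measure M ((a - D) \<union> (D - a)) < \<epsilon>"
    using Compl.IH[OF \<open>0 < \<epsilon>\<close>] by auto
  have sp: "space (G n) = space M" using sub[of n] by (simp add: subalgebra_def)
  have "(\<Union>n. sets (G n)) \<subseteq> Pow (space M)"
    using sub sets.space_closed by (metis UN_least subalgebra_def)
  from sigma_sets_into_sp[OF this Compl.hyps] have "a \<subseteq> space M" .
  moreover have "D \<subseteq> space M" using sets.sets_into_space[OF D(1)] sp by simp
  ultimately have "(space M - a - (space M - D)) \<union> (space M - D - (space M - a)) = (a - D) \<union> (D - a)" by auto
  then show ?case
    using D sp sets.compl_sets[OF D(1)] by (intro exI[of _ n] bexI[of _ "space M - D"]) auto
next
  case (Union a)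
  have "sigma_sets (space M) (\<Union>n. sets (G n)) \<subseteq> sets M"
    using sub by (intro sets.sigma_sets_subset) (auto simp: subalgebra_def)
  then have a [measurable]: "a i \<in> sets M" for i using Union.hyps by auto
  have G [measurable_dest]: "D \<in> sets (G n) \<Longrightarrow> D \<in> sets M" for D n using sub[of n] by (auto simp: subalgebra_def)
  have "(\<lambda>N. measure M (\<Union>i\<in>{..<N}. a i)) \<longlonglongrightarrow> measure M (\<Union>N. \<Union>i\<in>{..<N}. a i)"
    by (intro finite_Lim_measure_incseq monoI UN_mono) auto
  moreover have "(\<Union>N. \<Union>i\<in>{..<N}. a i) = (\<Union>i. a i)" by auto
  ultimately have "\<forall>\<^sub>F N in sequentially. measure M (\<Union>i. a i) - \<epsilon> / 2 < measure M (\<Union>i\<in>{..<N}. a i)"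
    using \<open>0 < \<epsilon>\<close> by (intro order_tendstoD(1)) auto
  then obtain N where N: "measure M (\<Union>i. a i) - \<epsilon> / 2 < measure M (\<Union>i\<in>{..<N}. a i)"
    by (auto simp: eventually_sequentially)
  have "measure M ((\<Union>i. a i) - (\<Union>i\<in>{..<N}. a i)) < \<epsilon> / 2"
    using N by (subst finite_measure_Diff) auto
  \<comment> \<open>Half of \<open>\<epsilon>\<close> pays for the truncation, the other half is
    shared among \<open>N\<close> approximations; \<open>N + 1\<close> keeps the quotient meaningful
    for \<open>N = 0\<close>.\<close>
  define \<delta> where "\<delta> = \<epsilon> / (2 * (real N + 1))"
  have "0 < \<delta>" using \<open>0 < \<epsilon>\<close> by (simp add: \<delta>_def)
  then have "\<exists>n D. D \<in> sets (G n) \<and> measure M ((a i - D) \<union> (D - a i)) < \<delta>" for i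
    using Union.IH[of \<delta> i] by auto
  then obtain n D where D: "\<And>i. D i \<in> sets (G (n i))" "\<And>i. measure M ((a i - D i) \<union> (D i - a i)) < \<delta>"
    by metis
  define m where "m = Max (insert 0 (n ` {..<N}))"
  have "D i \<in> sets (G m)" if "i < N" for i
    using D(1)[of i] mono[of "n i" m] that by (auto simp: m_def)
  then have Dm: "(\<Union>i\<in>{..<N}. D i) \<in> sets (G m)" by auto
  note [measurable] = G[OF D(1)]
  let ?X = "(\<Union>i. a i) - (\<Union>i\<in>{..<N}. a i)" and ?Y = "\<lambda>i. (a i - D i) \<union> (D i - a i)"
  have "measure M (((\<Union>i. a i) - (\<Union>i\<in>{..<N}. D i)) \<union> ((\<Union>i\<in>{..<N}. D i) - (\<Union>i. a i)))
      \<le> measure M (?X \<union> (\<Union>i\<in>{..<N}. ?Y i))"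
    by (intro finite_measure_mono) auto
  also have "\<dots> \<le> measure M ?X + measure M (\<Union>i\<in>{..<N}. ?Y i)"
    by (intro measure_Un_le) auto
  also have "measure M (\<Union>i\<in>{..<N}. ?Y i) \<le> (\<Sum>i\<in>{..<N}. measure M (?Y i))"
    by (intro measure_UNION_le) auto
  also have "\<dots> \<le> (\<Sum>i\<in>{..<N}. \<delta>)" using D(2) by (intro sum_mono) (simp add: less_imp_le)
  also have "\<dots> \<le> \<epsilon> / 2" using \<open>0 < \<epsilon>\<close> by (simp add: \<delta>_def field_simps)
  finally show ?case
    using Dm \<open>measure M ?X < \<epsilon> / 2\<close> by (intro exI[of _ m] bexI[OF _ Dm]) linarith
qed

text \<open>Choosing symmetric differences of measure below \<open>(1/2)^k\<close> makes them
  summable, and Borel-Cantelli turns approximation in measure into almost-sure convergence, the form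
  that continuity of an evaluation accepts.\<close>

lemma (in finite_measure) indicator_approx_AE:
  fixes G :: "nat \<Rightarrow> 'a measure"
  assumes sub: "\<And>n. subalgebra M (G n)"
    and mono: "\<And>m n. m \<le> n \<Longrightarrow> sets (G m) \<subseteq> sets (G n)"
    and A: "A \<in> sigma_sets (space M) (\<Union>n. sets (G n))"
  obtains n :: "nat \<Rightarrow> nat" and D where "\<And>k. D k \<in> sets (G (n k))"
    "AE x in M. (\<lambda>k. indicator (D k) x :: real) \<longlonglongrightarrow> indicator A x"
proof -
  have "\<forall>k::nat. \<exists>n D. D \<in> sets (G n) \<and> measure M ((A - D) \<union> (D - A)) < (1/2)^k"
    using approx_by_increasing_union[OF sub mono A] by (metis half_gt_zero_iff zero_less_one zero_less_power)
  then obtain n D where D: "\<And>k. D k \<in> sets (G (n k))" "\<And>k. measure M ((A - D k) \<union> (D k - A)) < (1/2)^k"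
    by metis
  have "sigma_sets (space M) (\<Union>n. sets (G n)) \<subseteq> sets M"
    using sub by (intro sets.sigma_sets_subset) (auto simp: subalgebra_def)
  then have [measurable]: "A \<in> sets M" using A by auto
  have [measurable]: "D k \<in> sets M" for k using D(1)[of k] sub by (auto simp: subalgebra_def)
  have "summable (\<lambda>k. measure M ((A - D k) \<union> (D k - A)))"
    by (rule summable_comparison_test'[of "\<lambda>k. (1/2)^k" 0]) (auto simp: D(2) less_imp_le)
  then have "AE x in M. \<forall>\<^sub>F k in sequentially. x \<in> space M - ((A - D k) \<union> (D k - A))"
    by (intro borel_cantelli_AE1) (auto simp: less_top[symmetric] emeasure_eq_measure)
  then have "AE x in M. (\<lambda>k. indicator (D k) x :: real) \<longlonglongrightarrow> indicator A x"
  proof eventually_elim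
    case (elim x)
    then have "\<forall>\<^sub>F k in sequentially. indicator (D k) x = (indicator A x :: real)"
      by eventually_elim (auto split: split_indicator)
    then show ?case by (rule tendsto_eventually)
  qed
  then show ?thesis using that D(1) by blast
qed

text \<open>The set where \<open>c\<close> exceeds \<open>R\<close> inside \<open>B\<close> is small
  and has average above \<open>R\<close>, but belongs only to the generated sigma-algebra.
  Approximating it by a set of some \<open>G n\<close> preserves both strict inequalities.\<close>

lemma (in prob_space) small_set_large_average:
  fixes G :: "nat \<Rightarrow> 'a measure" and c :: "'a \<Rightarrow> real"
  assumes sub: "\<And>n. subalgebra M (G n)"
    and mono: "\<And>m n. m \<le> n \<Longrightarrow> sets (G m) \<subseteq> sets (G n)"
    and c: "integrable M c" "c \<in> borel_measurable (sigma (space M) (\<Union>n. sets (G n)))"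
    and B: "B \<in> sets (G m)" "\<not> (AE x in M. x \<in> B \<longrightarrow> c x \<le> R)"
    and small: "prob {x \<in> space M. R < c x} < \<epsilon>"
  shows "\<exists>n\<ge>m. \<exists>D\<in>sets (G n). D \<subseteq> B \<and> prob D < \<epsilon> \<and> R * prob D < (\<integral>x. indicator D x * c x \<partial>M)"
proof -
  let ?S = "sigma (space M) (\<Union>n. sets (G n))"
  have cl: "(\<Union>n. sets (G n)) \<subseteq> Pow (space M)"
    using sub sets.space_closed by (metis UN_least subalgebra_def)
  have [measurable]: "c \<in> borel_measurable M" using c(1) by simp
  have G [measurable_dest]: "D \<in> sets (G n) \<Longrightarrow> D \<in> sets M" for D n using sub[of n] by (auto simp: subalgebra_def)
  note [measurable] = B(1)[THEN G]
  define A where "A = B \<inter> {x\<in>space M. R < c x}"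
  have "B \<in> sets ?S" using B(1) cl by auto
  moreover have "{x\<in>space ?S. R < c x} \<in> sets ?S" using c(2) by measurable
  ultimately have "A \<in> sets ?S" unfolding A_def by (auto simp: space_measure_of_conv)
  then have A: "A \<in> sigma_sets (space M) (\<Union>n. sets (G n))" using cl by simp
  have [measurable]: "A \<in> sets M" unfolding A_def by measurable
  define h where "h x = c x - R" for x
  have h [measurable]: "integrable M h" unfolding h_def using c(1) by simp
  note ih = integrable_mult_indicator[OF _ h, simplified]
  have pos: "0 < (\<integral>x. indicator A x * h x \<partial>M)"
  proof (rule ccontr)
    have "0 \<le> (\<integral>x. indicator A x * h x \<partial>M)"
      by (intro integral_nonneg_AE AE_I2) (auto simp: A_def h_def split: split_indicator)
    moreover assume "\<not> 0 < (\<integral>x. indicator A x * h x \<partial>M)"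
    ultimately have "(\<integral>x. indicator A x * h x \<partial>M) = 0" by simp
    then have "AE x in M. indicator A x * h x = 0"
      by (subst (asm) integral_nonneg_eq_0_iff_AE)
        (use ih[of A] in \<open>auto intro!: AE_I2 simp: A_def h_def split: split_indicator\<close>)
    then have "AE x in M. x \<in> B \<longrightarrow> c x \<le> R"
      using AE_space by eventually_elim (auto simp: A_def h_def split: split_indicator_asm)
    then show False using B(2) by simp
  qed
  \<comment> \<open>The weight \<open>1 + \<bar>h x\<bar>\<close> makes one approximation control
    two quantities: the summand 1 controls the probability, the summand
    \<open>\<bar>h x\<bar>\<close> the integral of \<open>h\<close>.\<close>
  define \<mu> where "\<mu> = density M (\<lambda>x. ennreal (1 + \<bar>h x\<bar>))"
  have meas_\<mu>: "measure \<mu> X = (\<integral>x. indicator X x * (1 + \<bar>h x\<bar>) \<partial>M)" if [measurable]: "X \<in> sets M" for X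
  proof -
    have "emeasure \<mu> X = (\<integral>\<^sup>+x. ennreal (indicator X x * (1 + \<bar>h x\<bar>)) \<partial>M)"
      unfolding \<mu>_def by (subst emeasure_density) (auto intro!: nn_integral_cong split: split_indicator)
    also have "\<dots> = ennreal (\<integral>x. indicator X x * (1 + \<bar>h x\<bar>) \<partial>M)"
      using integrable_mult_indicator[OF that, of "\<lambda>x. 1 + \<bar>h x\<bar>"] h
      by (intro nn_integral_eq_integral) auto
    finally show ?thesis by (simp add: measure_def integral_nonneg_AE)
  qed
  interpret \<mu>: finite_measure \<mu>
  proof
    have "emeasure \<mu> (space \<mu>) = (\<integral>\<^sup>+x. ennreal (1 + \<bar>h x\<bar>) \<partial>M)"
      by (auto simp: \<mu>_def emeasure_density intro!: nn_integral_cong)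
    also have "\<dots> = ennreal (\<integral>x. 1 + \<bar>h x\<bar> \<partial>M)"
      using h by (intro nn_integral_eq_integral) auto
    finally show "emeasure \<mu> (space \<mu>) \<noteq> \<infinity>" by simp
  qed
  \<comment> \<open>The first entry is the slack left for \<open>prob D < \<epsilon>\<close>; the
    second is what the integral of \<open>h\<close> may lose while staying positive.\<close>
  define \<delta> where "\<delta> = min (\<epsilon> - prob {x \<in> space M. R < c x}) (\<integral>x. indicator A x * h x \<partial>M)"
  have "0 < \<delta>" using pos small by (simp add: \<delta>_def)
  then have "\<exists>n. \<exists>D\<in>sets (G n). measure \<mu> ((A - D) \<union> (D - A)) < \<delta>"
    using A sub mono by (intro \<mu>.approx_by_increasing_union) (auto simp: \<mu>_def subalgebra_def)
  then obtain n D' where D': "D' \<in> sets (G n)" "measure \<mu> ((A - D') \<union> (D' - A)) < \<delta>" by auto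
  define D where "D = D' \<inter> B"
  have DG: "D \<in> sets (G (max n m))"
    unfolding D_def using D'(1) B(1) mono[of n "max n m"] mono[of m "max n m"] by auto
  note [measurable] = G[OF DG] G[OF D'(1)]
  let ?U = "(A - D) \<union> (D - A)"
  have "?U \<subseteq> (A - D') \<union> (D' - A)" by (auto simp: D_def A_def)
  then have "measure \<mu> ?U \<le> measure \<mu> ((A - D') \<union> (D' - A))"
    by (intro \<mu>.finite_measure_mono) (auto simp: \<mu>_def)
  then have U: "(\<integral>x. indicator ?U x * (1 + \<bar>h x\<bar>) \<partial>M) < \<delta>"
    using D'(2) by (simp add: meas_\<mu>)
  have iU: "integrable M (\<lambda>x. indicator ?U x * (1 + \<bar>h x\<bar>))"
    using integrable_mult_indicator[of ?U M "\<lambda>x. 1 + \<bar>h x\<bar>"] h by auto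
  have "prob D \<le> prob (A \<union> ?U)" by (intro finite_measure_mono) auto
  also have "\<dots> \<le> prob A + prob ?U" by (intro measure_Un_le) auto
  also have "prob A \<le> prob {x \<in> space M. R < c x}" by (intro finite_measure_mono) (auto simp: A_def)
  also have "prob ?U = (\<integral>x. indicator ?U x \<partial>M)" by (subst Bochner_Integration.integral_indicator) (auto simp: Int_absorb2 sets.sets_into_space)
  also have "\<dots> \<le> (\<integral>x. indicator ?U x * (1 + \<bar>h x\<bar>) \<partial>M)"
    by (intro integral_mono iU) (auto split: split_indicator simp: less_top[symmetric])
  also note U
  finally have "prob D < \<epsilon>" by (simp add: \<delta>_def)
  moreover have "0 < (\<integral>x. indicator D x * h x \<partial>M)"
  proof -
    have "(\<integral>x. indicator A x * h x \<partial>M) - (\<integral>x. indicator ?U x * (1 + \<bar>h x\<bar>) \<partial>M)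
      = (\<integral>x. indicator A x * h x - indicator ?U x * (1 + \<bar>h x\<bar>) \<partial>M)"
      by (intro Bochner_Integration.integral_diff[symmetric] ih iU) auto
    also have "\<dots> \<le> (\<integral>x. indicator D x * h x \<partial>M)"
      by (intro integral_mono Bochner_Integration.integrable_diff ih iU) (auto split: split_indicator)
    finally show ?thesis using U by (simp add: \<delta>_def)
  qed
  moreover have "(\<integral>x. indicator D x * h x \<partial>M) = (\<integral>x. indicator D x * c x \<partial>M) - R * prob D"
  proof -
    have "(\<integral>x. indicator D x * h x \<partial>M) = (\<integral>x. indicator D x * c x - R * indicator D x \<partial>M)"
      by (intro Bochner_Integration.integral_cong) (auto simp: h_def algebra_simps)
    also have "\<dots> = (\<integral>x. indicator D x * c x \<partial>M) - (\<integral>x. R * indicator D x \<partial>M)"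
      using integrable_mult_indicator[of D M c] c(1)
      by (intro Bochner_Integration.integral_diff) (auto simp: less_top[symmetric])
    finally show ?thesis by (simp add: Int_absorb2 sets.sets_into_space)
  qed
  ultimately show ?thesis using DG by (intro exI[of _ "max n m"]) (auto intro!: bexI[of _ D] simp: D_def)
qed

text \<open>If \<open>c\<close> is essentially bounded by \<open>R\<close> on \<open>B\<close> from
  above, then \<open>- c\<close> is not, so the one-sided version applies to \<open>c\<close> or to
  \<open>- c\<close>.\<close>

lemma (in prob_space) small_set_large_abs_average:
  fixes G :: "nat \<Rightarrow> 'a measure" and c :: "'a \<Rightarrow> real"
  assumes sub: "\<And>n. subalgebra M (G n)"
    and mono: "\<And>m n. m \<le> n \<Longrightarrow> sets (G m) \<subseteq> sets (G n)"
    and c: "integrable M c" "c \<in> borel_measurable (sigma (space M) (\<Union>n. sets (G n)))"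
    and B: "B \<in> sets (G m)" "\<not> (AE x in M. x \<in> B \<longrightarrow> \<bar>c x\<bar> \<le> R)"
    and small: "prob {x \<in> space M. R < \<bar>c x\<bar>} < \<epsilon>"
  shows "\<exists>n\<ge>m. \<exists>D\<in>sets (G n). D \<subseteq> B \<and> prob D < \<epsilon> \<and> R * prob D < \<bar>\<integral>x. indicator D x * c x \<partial>M\<bar>"
proof -
  have [measurable]: "c \<in> borel_measurable M" using c(1) by simp
  show ?thesis
  proof (cases "AE x in M. x \<in> B \<longrightarrow> c x \<le> R")
    case False
    have "prob {x \<in> space M. R < c x} \<le> prob {x \<in> space M. R < \<bar>c x\<bar>}"
      by (intro finite_measure_mono) auto
    with small have "prob {x \<in> space M. R < c x} < \<epsilon>" by simp
    from small_set_large_average[OF sub mono c B(1) False this] show ?thesis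
      by (meson abs_ge_self less_le_trans)
  next
    case True
    have "\<not> (AE x in M. x \<in> B \<longrightarrow> - c x \<le> R)"
    proof
      assume "AE x in M. x \<in> B \<longrightarrow> - c x \<le> R"
      with True have "AE x in M. x \<in> B \<longrightarrow> \<bar>c x\<bar> \<le> R" by eventually_elim auto
      with B(2) show False ..
    qed
    moreover have "prob {x \<in> space M. R < - c x} \<le> prob {x \<in> space M. R < \<bar>c x\<bar>}"
      by (intro finite_measure_mono) auto
    with small have "prob {x \<in> space M. R < - c x} < \<epsilon>" by simp
    ultimately have "\<exists>n\<ge>m. \<exists>D\<in>sets (G n). D \<subseteq> B \<and> prob D < \<epsilon> \<and> R * prob D < (\<integral>x. indicator D x * - c x \<partial>M)"
      using c B(1) by (intro small_set_large_average[OF sub mono]) auto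
    then show ?thesis by simp (meson abs_ge_minus_self less_le_trans)
  qed
qed

lemma (in prob_space) prob_abs_gt_small:
  fixes c :: "'a \<Rightarrow> real"
  assumes [measurable]: "c \<in> borel_measurable M" and "0 < \<epsilon>"
  obtains K where "R \<le> K" "prob {x \<in> space M. K < \<bar>c x\<bar>} < \<epsilon>"
proof -
  have "(\<lambda>n. prob {x \<in> space M. real n < \<bar>c x\<bar>}) \<longlonglongrightarrow> prob (\<Inter>n. {x \<in> space M. real n < \<bar>c x\<bar>})"
    by (intro finite_Lim_measure_decseq) (auto simp: decseq_def)
  moreover have "(\<Inter>n. {x \<in> space M. real n < \<bar>c x\<bar>}) = {}"
    using real_arch_simple[of "\<bar>c _\<bar>"] by (auto simp: set_eq_iff not_less)
  ultimately have "\<forall>\<^sub>F n in sequentially. prob {x \<in> space M. real n < \<bar>c x\<bar>} < \<epsilon>"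
    using \<open>0 < \<epsilon>\<close> by (intro order_tendstoD(2)[where y = 0]) auto
  then have "\<forall>\<^sub>F n in sequentially. prob {x \<in> space M. real n < \<bar>c x\<bar>} < \<epsilon> \<and> nat \<lceil>R\<rceil> \<le> n"
    by (intro eventually_conj eventually_ge_at_top)
  then obtain n where "prob {x \<in> space M. real n < \<bar>c x\<bar>} < \<epsilon>" "nat \<lceil>R\<rceil> \<le> n"
    by (auto simp: eventually_sequentially)
  then show ?thesis using that[of "real n"] by linarith
qed

text \<open>A gliding hump argument.  Every set of some \<open>G m\<close> on which \<open>c\<close> is unbounded contains a set \<open>D\<close> on
  which \<open>c\<close> has a large average and whose removal leaves \<open>c\<close> unbounded: otherwise \<open>c\<close> is bounded off
  arbitrarily small sets, and the resulting countable partition contradicts the hypothesis \<open>avg\<close>.\<close>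

lemma (in prob_space) bounded_if_averages_bounded:
  fixes G :: "nat \<Rightarrow> 'a measure" and c :: "'a \<Rightarrow> real"
  assumes sub: "\<And>n. subalgebra M (G n)"
    and mono: "\<And>m n. m \<le> n \<Longrightarrow> sets (G m) \<subseteq> sets (G n)"
    and c: "integrable M c" "c \<in> borel_measurable (sigma (space M) (\<Union>n. sets (G n)))"
    and avg: "\<And>D k. disjoint_family D \<Longrightarrow> (\<And>j::nat. D j \<in> sets (G (k j))) \<Longrightarrow>
      \<exists>R. \<forall>j. \<bar>\<integral>x. indicator (D j) x * c x \<partial>M\<bar> \<le> R * prob (D j)"
  shows "\<exists>R. AE x in M. \<bar>c x\<bar> \<le> R"
proof -
  have [measurable]: "c \<in> borel_measurable M" using c(1) by simp
  have G [measurable_dest]: "D \<in> sets (G n) \<Longrightarrow> D \<in> sets M" for D n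
    using sub[of n] by (auto simp: subalgebra_def)
  have sp: "space (G n) = space M" for n using sub[of n] by (simp add: subalgebra_def)
  define bdd where "bdd B \<longleftrightarrow> (\<exists>r. AE x in M. x \<in> B \<longrightarrow> \<bar>c x\<bar> \<le> r)" for B
  have step: "\<exists>n\<ge>m. \<exists>D\<in>sets (G n). D \<subseteq> B \<and> R * prob D < \<bar>\<integral>x. indicator D x * c x \<partial>M\<bar> \<and> \<not> bdd (B - D)"
    if B: "B \<in> sets (G m)" "\<not> bdd B" for B m R
  proof (rule ccontr)
    \<comment> \<open>Under \<open>neg\<close>, removing any set with a large average leaves a part
      of \<open>B\<close> on which \<open>c\<close> is bounded. Such sets can be taken arbitrarily
      small by raising the level.\<close>
    assume neg: "\<not> ?thesis"
    have "\<exists>n D. n \<ge> m \<and> D \<in> sets (G n) \<and> D \<subseteq> B \<and> prob D < (1/2)^j \<and> bdd (B - D)" for j :: nat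
    proof -
      obtain K where K: "R \<le> K" "prob {x \<in> space M. K < \<bar>c x\<bar>} < (1/2)^j"
        by (rule prob_abs_gt_small[of c "(1/2)^j" R]) auto
      have "\<not> (AE x in M. x \<in> B \<longrightarrow> \<bar>c x\<bar> \<le> K)" using B(2) by (auto simp: bdd_def)
      from small_set_large_abs_average[OF sub mono c B(1) this K(2)]
      obtain n D where nD: "n \<ge> m" "D \<in> sets (G n)" "D \<subseteq> B" "prob D < (1/2)^j"
        "K * prob D < \<bar>\<integral>x. indicator D x * c x \<partial>M\<bar>" by blast
      have "R * prob D \<le> K * prob D" using K(1) by (intro mult_right_mono) auto
      with nD neg have "bdd (B - D)" by (meson le_less_trans)
      with nD show ?thesis by blast
    qed
    then obtain n D where nD: "\<And>j. n j \<ge> m" "\<And>j. D j \<in> sets (G (n j))" "\<And>j. D j \<subseteq> B"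
      "\<And>j. prob (D j) < (1/2)^j" "\<And>j. bdd (B - D j)" by metis
    note [measurable] = G[OF nD(2)]
    \<comment> \<open>A point of \<open>B\<close> goes into \<open>N j\<close> for the first
      \<open>j\<close> with \<open>x \<notin> D j\<close>. These pieces are disjoint,
      \<open>c\<close> is bounded on each, and they exhaust \<open>B\<close> up to the null set
      where all \<open>D j\<close> meet.\<close>
    define N where "N j = (B - D j) \<inter> (\<Inter>i\<in>{..<j}. D i \<inter> space M)" for j
    define l where "l j = Max (insert m (n ` {..j}))" for j
    have NG: "N j \<in> sets (G (l j))" for j
    proof -
      have "B \<in> sets (G (l j))" using B(1) mono[of m "l j"] by (auto simp: l_def)
      moreover have "D i \<in> sets (G (l j))" if "i \<le> j" for i
      proof -
        have "n i \<le> l j" unfolding l_def using that by (intro Max_ge) auto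
        from mono[OF this] show ?thesis using nD(2)[of i] by blast
      qed
      moreover have "N j = (B - D j) \<inter> (space (G (l j)) \<inter> (\<Inter>i\<in>{..<j}. D i \<inter> space (G (l j))))"
        using sets.sets_into_space[OF B(1)] by (auto simp: N_def sp)
      moreover have "space (G (l j)) \<inter> (\<Inter>i\<in>{..<j}. D i \<inter> space (G (l j))) \<in> sets (G (l j))"
        using calculation by (cases "j = 0") (auto intro!: sets.Int sets.finite_INT)
      ultimately show ?thesis by auto
    qed
    have dis: "N i \<inter> N j = {}" if "i < j" for i j
      using that by (auto simp: N_def)
    have bN: "\<exists>r::nat. AE x in M. x \<in> N j \<longrightarrow> \<bar>c x\<bar> \<le> real r" for j
    proof -
      obtain r where r: "AE x in M. x \<in> B - D j \<longrightarrow> \<bar>c x\<bar> \<le> r" using nD(5)[of j] by (auto simp: bdd_def)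
      have "AE x in M. x \<in> N j \<longrightarrow> \<bar>c x\<bar> \<le> real (nat \<lceil>r\<rceil>)"
        using r by eventually_elim (auto simp: N_def, linarith)
      then show ?thesis ..
    qed
    \<comment> \<open>Taking the least integer bound forces an average above \<open>r j - 1\<close>
      on some subset of \<open>N j\<close>. The hypothesis \<open>avg\<close>, applied to these
      disjoint subsets, then bounds all \<open>r j\<close> at once.\<close>
    define r where "r j = (LEAST r::nat. AE x in M. x \<in> N j \<longrightarrow> \<bar>c x\<bar> \<le> real r)" for j
    have r: "AE x in M. x \<in> N j \<longrightarrow> \<bar>c x\<bar> \<le> real (r j)" for j
      unfolding r_def by (rule LeastI_ex[OF bN])
    have "\<exists>k E. E \<in> sets (G k) \<and> E \<subseteq> N j \<and>
      (r j = 0 \<or> (real (r j) - 1) * prob E < \<bar>\<integral>x. indicator E x * c x \<partial>M\<bar>)" for j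
    proof (cases "r j = 0")
      case True
      then show ?thesis by (intro exI[of _ 0] exI[of _ "{}"]) auto
    next
      case False
      then have "\<not> (AE x in M. x \<in> N j \<longrightarrow> \<bar>c x\<bar> \<le> real (r j - 1))"
        unfolding r_def by (intro not_less_Least) auto
      moreover have "real (r j - 1) = real (r j) - 1" using False by simp
      ultimately have "\<not> (AE x in M. x \<in> N j \<longrightarrow> \<bar>c x\<bar> \<le> real (r j) - 1)" by simp
      \<comment> \<open>No smallness is wanted here, so the tolerance 2 makes that condition
        vacuous.\<close>
      moreover have "prob {x \<in> space M. real (r j) - 1 < \<bar>c x\<bar>} < 2"
        by (rule le_less_trans[OF prob_le_1]) simp
      ultimately show ?thesis
        using small_set_large_abs_average[OF sub mono c NG] by meson
    qed
    then obtain k E where E: "\<And>j. E j \<in> sets (G (k j))" "\<And>j. E j \<subseteq> N j"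
      "\<And>j. r j = 0 \<or> (real (r j) - 1) * prob (E j) < \<bar>\<integral>x. indicator (E j) x * c x \<partial>M\<bar>" by metis
    have "disjoint_family E"
      unfolding disjoint_family_on_def
    proof (intro ballI impI)
      fix i j :: nat assume "i \<noteq> j"
      then have "N i \<inter> N j = {}" using dis[of i j] dis[of j i] by (cases i j rule: linorder_cases) auto
      then show "E i \<inter> E j = {}" using E(2)[of i] E(2)[of j] by blast
    qed
    from avg[OF this E(1)] obtain R' where
      R': "\<And>j. \<bar>\<integral>x. indicator (E j) x * c x \<partial>M\<bar> \<le> R' * prob (E j)" by blast
    have rle: "real (r j) \<le> max 0 (R' + 1)" for j
    proof (cases "r j = 0")
      case False
      with E(3)[of j] R'[of j] have "(real (r j) - 1) * prob (E j) < R' * prob (E j)" by linarith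
      then have "real (r j) - 1 < R'" using mult_less_cancel_right measure_nonneg by (metis less_asym' linorder_not_le)
      then show ?thesis by linarith
    qed simp
    have "AE x in M. x \<notin> (\<Inter>j. D j)"
    proof -
      have "prob (\<Inter>j. D j) \<le> (1/2)^j" for j
      proof -
        have "prob (\<Inter>j. D j) \<le> prob (D j)" by (intro finite_measure_mono) auto
        with nD(4)[of j] show ?thesis by linarith
      qed
      moreover have "(\<lambda>j. (1/2::real)^j) \<longlonglongrightarrow> 0" by (rule LIMSEQ_power_zero) simp
      ultimately have "prob (\<Inter>j. D j) \<le> 0" by (intro LIMSEQ_le_const) auto
      then have "(\<Inter>j. D j) \<in> null_sets M" by (auto simp: null_sets_def emeasure_eq_measure measure_le_0_iff)
      then show ?thesis by (rule AE_not_in)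
    qed
    moreover have "AE x in M. \<forall>j. x \<in> N j \<longrightarrow> \<bar>c x\<bar> \<le> real (r j)"
      using r by (simp add: AE_all_countable)
    ultimately have "AE x in M. x \<in> B \<longrightarrow> \<bar>c x\<bar> \<le> max 0 (R' + 1)"
      using AE_space
    proof eventually_elim
      case (elim x)
      show ?case
      proof
        assume "x \<in> B"
        have ex: "\<exists>j. x \<notin> D j" using elim by blast
        define j where "j = (LEAST j. x \<notin> D j)"
        have "x \<notin> D j" unfolding j_def by (rule LeastI_ex[OF ex])
        moreover have "x \<in> D i" if "i < j" for i using not_less_Least[of i] that unfolding j_def by blast
        ultimately have "x \<in> N j" using \<open>x \<in> B\<close> elim by (auto simp: N_def)
        then show "\<bar>c x\<bar> \<le> max 0 (R' + 1)" using elim rle[of j] by (meson order_trans)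
      qed
    qed
    then show False using B(2) unfolding bdd_def by blast
  qed
  have "bdd (space M)"
  proof (rule ccontr)
    assume nb: "\<not> bdd (space M)"
    \<comment> \<open>A state holds the remaining set \<open>B\<close>, the index of a sigma-algebra
      containing it, and the set just removed (a dummy at the start). Step \<open>k\<close> removes
      a set whose average exceeds \<open>k\<close> in absolute value, and unboundedness on the
      remainder keeps the recursion alive.\<close>
    define P where "P = (\<lambda>(B, m, D::'a set). B \<in> sets (G m) \<and> \<not> bdd B)"
    define Q where "Q = (\<lambda>(k::nat) (B, m::nat, D::'a set) (B', m'::nat, D').
      D' \<in> sets (G m') \<and> D' \<subseteq> B \<and> B' = B - D' \<and> real k * prob D' < \<bar>\<integral>x. indicator D' x * c x \<partial>M\<bar>)"
    have "\<exists>f. \<forall>k. P (f k) \<and> Q k (f k) (f (Suc k))"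
    proof (rule dependent_nat_choice)
      show "\<exists>x. P x"
        using nb by (intro exI[of _ "(space M, 0, {})"]) (auto simp: P_def sp[symmetric, of 0])
      fix x and k :: nat assume "P x"
      then obtain B m D where x: "x = (B, m, D)" and B: "B \<in> sets (G m)" "\<not> bdd B"
        by (cases x) (auto simp: P_def)
      from step[OF B, of "real k"] obtain n D' where
        nD: "n \<ge> m" "D' \<in> sets (G n)" "D' \<subseteq> B" "real k * prob D' < \<bar>\<integral>x. indicator D' x * c x \<partial>M\<bar>" "\<not> bdd (B - D')"
        by blast
      have "B - D' \<in> sets (G n)" using B(1) nD(2) mono[OF nD(1)] by auto
      with nD show "\<exists>y. P y \<and> Q k x y"
        by (intro exI[of _ "(B - D', n, D')"]) (auto simp: P_def Q_def x)
    qed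
    then obtain f where f: "\<And>k. Q k (f k) (f (Suc k))" by blast
    define B where "B k = fst (f k)" for k
    define m where "m k = fst (snd (f (Suc k)))" for k
    define D where "D k = snd (snd (f (Suc k)))" for k
    have D: "D k \<in> sets (G (m k))" "D k \<subseteq> B k" "B (Suc k) = B k - D k"
      "real k * prob (D k) < \<bar>\<integral>x. indicator (D k) x * c x \<partial>M\<bar>" for k
      using f[of k] by (auto simp: Q_def B_def m_def D_def split: prod.splits)
    have dec: "B j \<subseteq> B i" if "i \<le> j" for i j
      using that by (rule lift_Suc_antimono_le[of B, rotated]) (simp add: D(3) Diff_subset)
    have dis: "D i \<inter> D j = {}" if "i < j" for i j
      using D(2)[of j] D(3)[of i] dec[of "Suc i" j] that by auto
    have "disjoint_family D"
      unfolding disjoint_family_on_def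
    proof (intro ballI impI)
      fix i j :: nat assume "i \<noteq> j"
      then show "D i \<inter> D j = {}" using dis[of i j] dis[of j i] by (cases i j rule: linorder_cases) auto
    qed
    from avg[OF this D(1)] obtain R where R: "\<And>j. \<bar>\<integral>x. indicator (D j) x * c x \<partial>M\<bar> \<le> R * prob (D j)"
      by blast
    obtain k :: nat where "R \<le> real k" using real_arch_simple by blast
    then have "R * prob (D k) \<le> real k * prob (D k)" by (intro mult_right_mono) auto
    with R[of k] D(4)[of k] show False by linarith
  qed
  then obtain r where "AE x in M. x \<in> space M \<longrightarrow> \<bar>c x\<bar> \<le> r" by (auto simp: bdd_def)
  then have "AE x in M. \<bar>c x\<bar> \<le> r" using AE_space by eventually_elim auto
  then show ?thesis ..
qed

section \<open>Bounded claims and conditional evaluations\<close>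

abbreviation cut :: "'a set \<Rightarrow> ('a \<Rightarrow> real) \<Rightarrow> 'a \<Rightarrow> real" where
  "cut E H \<equiv> \<lambda>x. indicator E x * H x"

section \<open>Arithmetic of bounded claims\<close>

lemma Linf_add: "f \<in> Linf M A \<Longrightarrow> g \<in> Linf M A \<Longrightarrow> (\<lambda>x. f x + g x) \<in> Linf M A"
proof -
  assume f: "f \<in> Linf M A" and g: "g \<in> Linf M A"
  then obtain C D where "AE x in M. \<bar>f x\<bar> \<le> C" "AE x in M. \<bar>g x\<bar> \<le> D" by (auto simp: Linf_def)
  then have "AE x in M. \<bar>f x + g x\<bar> \<le> C + D" by eventually_elim auto
  with f g show ?thesis by (auto simp: Linf_def)
qed

lemma Linf_mult: "f \<in> Linf M A \<Longrightarrow> g \<in> Linf M A \<Longrightarrow> (\<lambda>x. f x * g x) \<in> Linf M A"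
proof -
  assume f: "f \<in> Linf M A" and g: "g \<in> Linf M A"
  then obtain C D where "AE x in M. \<bar>f x\<bar> \<le> C" "AE x in M. \<bar>g x\<bar> \<le> D" by (auto simp: Linf_def)
  then have "AE x in M. \<bar>f x * g x\<bar> \<le> C * D"
    by eventually_elim (auto simp: abs_mult intro!: mult_mono)
  with f g show ?thesis by (auto simp: Linf_def)
qed

lemma Linf_const: "(\<lambda>x. c) \<in> Linf M A"
  by (auto simp: Linf_def intro!: exI[of _ "\<bar>c\<bar>"])

lemma Linf_cmult: "f \<in> Linf M A \<Longrightarrow> (\<lambda>x. c * f x) \<in> Linf M A"
  by (intro Linf_mult Linf_const)

lemma Linf_uminus: "f \<in> Linf M A \<Longrightarrow> (\<lambda>x. - f x) \<in> Linf M A"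
  using Linf_cmult[of f M A "-1"] by simp

lemma Linf_diff: "f \<in> Linf M A \<Longrightarrow> g \<in> Linf M A \<Longrightarrow> (\<lambda>x. f x - g x) \<in> Linf M A"
  using Linf_add[of f M A "\<lambda>x. - g x"] Linf_uminus by auto

lemma Linf_indicator: "E \<in> sets A \<Longrightarrow> indicator E \<in> Linf M A"
  by (auto simp: Linf_def intro!: exI[of _ 1] AE_I2 split: split_indicator)

lemma Linf_indicator_mult: "E \<in> sets A \<Longrightarrow> f \<in> Linf M A \<Longrightarrow> (cut E f) \<in> Linf M A"
  by (intro Linf_mult Linf_indicator)

lemma Linf_sum: "(\<And>i. i \<in> I \<Longrightarrow> f i \<in> Linf M A) \<Longrightarrow> (\<lambda>x. \<Sum>i\<in>I. f i x) \<in> Linf M A"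
  by (induction I rule: infinite_finite_induct) (auto simp: Linf_const intro: Linf_add)

lemma Linf_mono: "sets A \<subseteq> sets B \<Longrightarrow> space A = space B \<Longrightarrow> f \<in> Linf M A \<Longrightarrow> f \<in> Linf M B"
  unfolding Linf_def by (auto intro: measurable_mono[THEN subsetD, rotated -1])

text \<open>A single evaluation at a fixed time: \<open>A\<close> is the information at that time
  and \<open>C\<close> carries the claims. \<open>Q\<close> is equivalent to \<open>M\<close>, so
  almost-sure statements move freely between the two measures while integrals are taken under
  \<open>Q\<close>.\<close>

locale conditional_evaluation = M: prob_space M + Q: prob_space Q for M Q :: "'a measure" +
  fixes A C :: "'a measure" and \<phi> :: "('a \<Rightarrow> real) \<Rightarrow> 'a \<Rightarrow> real"
  assumes sets_Q: "sets Q = sets M" and null_Q: "null_sets Q = null_sets M"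
    and eval: "cond_evaluation M A C \<phi>"
    and cont: "continuous_eval M C \<phi>"
begin

lemma subC: "sets C \<subseteq> sets M" and spC: "space C = space M"
  and subA: "sets A \<subseteq> sets C" and spA: "space A = space M"
  using eval by (auto simp: cond_evaluation_def subalgebra_def)

lemma spQ: "space Q = space M"
  using sets_Q by (rule sets_eq_imp_space_eq)

lemma AE_Q: "(AE x in Q. P x) \<longleftrightarrow> (AE x in M. P x)"
  by (simp add: eventually_ae_filter null_Q spQ)

lemma sigma_finite_subalgebra_Q: "sets B \<subseteq> sets M \<Longrightarrow> space B = space M \<Longrightarrow> sigma_finite_subalgebra Q B"
  by (intro finite_measure_subalgebra_is_sigma_finite)
    (auto simp: finite_measure_subalgebra_def finite_measure_subalgebra_axioms_def subalgebra_def sets_Q spQ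
      intro: Q.finite_measure_axioms)

lemma Linf_measurable: "f \<in> Linf M B \<Longrightarrow> sets B \<subseteq> sets M \<Longrightarrow> space B = space M \<Longrightarrow> f \<in> borel_measurable M"
  unfolding Linf_def by (auto intro: measurable_mono[THEN subsetD, rotated -1])

lemma Linf_integrable: "f \<in> Linf M B \<Longrightarrow> sets B \<subseteq> sets M \<Longrightarrow> space B = space M \<Longrightarrow> integrable Q f"
proof -
  assume f: "f \<in> Linf M B" and B: "sets B \<subseteq> sets M" "space B = space M"
  then obtain c where "AE x in M. \<bar>f x\<bar> \<le> c" by (auto simp: Linf_def)
  moreover have "f \<in> borel_measurable Q"
    using Linf_measurable[OF f B] measurable_cong_sets[OF sets_Q refl] by auto
  ultimately show ?thesis
    by (intro Q.integrable_const_bound[of _ c]) (auto simp: AE_Q)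
qed

lemma integral_mono_M: "integrable Q f \<Longrightarrow> integrable Q g \<Longrightarrow> AE x in M. f x \<le> g x \<Longrightarrow>
    (\<integral>x. f x \<partial>Q) \<le> (\<integral>x. g x \<partial>Q)" for f g :: "'a \<Rightarrow> real"
  by (intro integral_mono_AE) (auto simp: AE_Q)

lemma phi_Linf: "H \<in> Linf M C \<Longrightarrow> \<phi> H \<in> Linf M A"
  using eval by (simp add: cond_evaluation_def)

lemma phi_integrable: "H \<in> Linf M C \<Longrightarrow> integrable Q (\<phi> H)"
  by (rule Linf_integrable[OF phi_Linf]) (use subA subC spA in auto)

lemma phi_measurable: "H \<in> Linf M C \<Longrightarrow> \<phi> H \<in> borel_measurable Q"
  by (rule borel_measurable_integrable[OF phi_integrable])

lemma phi_zero: "AE x in M. \<phi> (\<lambda>_. 0) x = 0"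
  using eval by (simp add: cond_evaluation_def)

lemma phi_convergence:
  "(\<And>n. Hs n \<in> Linf M C) \<Longrightarrow> H \<in> Linf M C \<Longrightarrow> (\<And>n. AE x in M. \<bar>Hs n x\<bar> \<le> K) \<Longrightarrow>
    AE x in M. (\<lambda>n. Hs n x) \<longlonglongrightarrow> H x \<Longrightarrow> AE x in M. (\<lambda>n. \<phi> (Hs n) x) \<longlonglongrightarrow> \<phi> H x"
  using cont unfolding continuous_eval_def bounded_ae_conv_def by blast

text \<open>Evaluations act on representatives, and respecting almost-sure equality is not among the
  axioms; it follows by applying continuity to a constant sequence.\<close>

lemma phi_cong: "AE x in M. \<phi> H x = \<phi> H' x"
  if H: "H \<in> Linf M C" "H' \<in> Linf M C" "AE x in M. H x = H' x"
proof -
  obtain K where K: "AE x in M. \<bar>H x\<bar> \<le> K" using H(1) by (auto simp: Linf_def)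
  have "AE x in M. (\<lambda>n::nat. H x) \<longlonglongrightarrow> H' x"
    using H(3) by eventually_elim simp
  then have "AE x in M. (\<lambda>n::nat. \<phi> H x) \<longlonglongrightarrow> \<phi> H' x"
    by (rule phi_convergence[OF H(1) H(2) K])
  then show ?thesis by eventually_elim (simp add: LIMSEQ_const_iff)
qed

lemma eval_local: "\<forall>H\<^sub>1\<in>Linf M C. \<forall>H\<^sub>2\<in>Linf M C. \<forall>E\<in>sets A.
    (AE \<omega> in M. \<phi> (\<lambda>x. indicator E x * H\<^sub>1 x + indicator (space M - E) x * H\<^sub>2 x) \<omega>
      = indicator E \<omega> * \<phi> H\<^sub>1 \<omega> + indicator (space M - E) \<omega> * \<phi> H\<^sub>2 \<omega>)"
  using eval unfolding cond_evaluation_def by (elim conjE)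

lemma eval_convex: "\<forall>H\<^sub>1\<in>Linf M C. \<forall>H\<^sub>2\<in>Linf M C. \<forall>l\<in>Linf M A. (AE \<omega> in M. 0 \<le> l \<omega> \<and> l \<omega> \<le> 1) \<longrightarrow>
    (AE \<omega> in M. \<phi> (\<lambda>x. l x * H\<^sub>1 x + (1 - l x) * H\<^sub>2 x) \<omega> \<le> l \<omega> * \<phi> H\<^sub>1 \<omega> + (1 - l \<omega>) * \<phi> H\<^sub>2 \<omega>)"
  using eval unfolding cond_evaluation_def by (elim conjE)

lemma phi_local: "AE x in M. \<phi> (cut E H) x = indicator E x * \<phi> H x"
  if "E \<in> sets A" "H \<in> Linf M C"
proof -
  have "AE x in M. \<phi> (\<lambda>x. indicator E x * H x + indicator (space M - E) x * 0) x
      = indicator E x * \<phi> H x + indicator (space M - E) x * \<phi> (\<lambda>_. 0) x"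
    by (rule bspec[OF bspec[OF bspec[OF eval_local that(2)] Linf_const] that(1)])
  with phi_zero show ?thesis by eventually_elim simp
qed

lemma phi_convex: "AE x in M. \<phi> (\<lambda>x. l * H x + (1 - l) * K x) x \<le> l * \<phi> H x + (1 - l) * \<phi> K x"
  if "0 \<le> l" "l \<le> 1" "H \<in> Linf M C" "K \<in> Linf M C" for l :: real
proof -
  have "(\<lambda>_. l) \<in> Linf M A" "AE x in M. 0 \<le> l \<and> l \<le> 1" using that by (auto simp: Linf_const)
  from mp[OF bspec[OF bspec[OF bspec[OF eval_convex that(3)] that(4)] this(1)] this(2)] show ?thesis .
qed

text \<open>Convexity at the midpoint of \<open>H\<close> and \<open>- H\<close>, together with the
  value zero at zero. It converts upper bounds for all claims into lower bounds.\<close>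

lemma phi_ge_uminus: "AE x in M. - \<phi> (\<lambda>x. - H x) x \<le> \<phi> H x" if H: "H \<in> Linf M C"
proof -
  have "AE x in M. \<phi> (\<lambda>x. (1/2) * H x + (1 - (1/2)) * - H x) x \<le> (1/2) * \<phi> H x + (1 - (1/2)) * \<phi> (\<lambda>x. - H x) x"
    by (rule phi_convex) (use H Linf_uminus in auto)
  with phi_zero show ?thesis by eventually_elim simp
qed

section \<open>Bounds on the evaluation that are uniform over all restrictions of a claim\<close>

lemma monotone_evalD: "monotone_eval M C \<phi> \<Longrightarrow> H \<in> Linf M C \<Longrightarrow> K \<in> Linf M C \<Longrightarrow>
    AE x in M. H x \<le> K x \<Longrightarrow> AE x in M. \<phi> H x \<le> \<phi> K x"
  by (simp add: monotone_eval_def)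

text \<open>Every restriction of \<open>H\<close> lies between the constants
  \<open>- \<bar>K\<bar>\<close> and \<open>\<bar>K\<bar>\<close>, so the evaluations of these two
  constants bound all others.\<close>

lemma uniformly_bounded_monotone:
  assumes mono: "monotone_eval M C \<phi>" and H: "H \<in> Linf M C"
  shows "\<exists>R. \<forall>E\<in>sets C. AE x in M. \<bar>\<phi> (cut E H) x\<bar> \<le> R"
proof -
  obtain K where K: "AE x in M. \<bar>H x\<bar> \<le> K" using H by (auto simp: Linf_def)
  obtain R1 where R1: "AE x in M. \<bar>\<phi> (\<lambda>_. \<bar>K\<bar>) x\<bar> \<le> R1"
    using phi_Linf[OF Linf_const] by (auto simp: Linf_def)
  obtain R2 where R2: "AE x in M. \<bar>\<phi> (\<lambda>_. - \<bar>K\<bar>) x\<bar> \<le> R2"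
    using phi_Linf[OF Linf_const] by (auto simp: Linf_def)
  have "AE x in M. \<bar>\<phi> (cut E H) x\<bar> \<le> max R1 R2" if E: "E \<in> sets C" for E
  proof -
    note EH = Linf_indicator_mult[OF E H]
    have "AE x in M. indicator E x * H x \<le> \<bar>K\<bar>"
      using K by eventually_elim (auto split: split_indicator)
    from monotone_evalD[OF mono EH Linf_const this]
    have 1: "AE x in M. \<phi> (cut E H) x \<le> \<phi> (\<lambda>_. \<bar>K\<bar>) x" .
    have "AE x in M. - \<bar>K\<bar> \<le> indicator E x * H x"
      using K by eventually_elim (auto split: split_indicator)
    from monotone_evalD[OF mono Linf_const EH this]
    have 2: "AE x in M. \<phi> (\<lambda>_. - \<bar>K\<bar>) x \<le> \<phi> (cut E H) x" .
    from 1 2 R1 R2 show ?thesis by eventually_elim auto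
  qed
  then show ?thesis by (intro exI ballI)
qed

text \<open>All restrictions of \<open>H\<close> and their negatives are dominated by the same
  constant, hence so is the conditional expectation in the p-norm bound. The lower estimate comes
  from \<open>phi_ge_uminus\<close>.\<close>

lemma uniformly_bounded_p_norm:
  assumes pn: "p_norm_bounded_eval M A C \<phi>" and H: "H \<in> Linf M C"
  shows "\<exists>R. \<forall>E\<in>sets C. AE x in M. \<bar>\<phi> (cut E H) x\<bar> \<le> R"
proof -
  obtain p l P' where p: "1 < p" and l: "l \<in> Linf_nonneg M A" and P': "prob_space P'" "sets P' = sets M"
    "null_sets P' = null_sets M" and bd: "\<And>H. H \<in> Linf M C \<Longrightarrow>
      AE x in M. \<phi> H x \<le> l x * real_cond_exp P' A (\<lambda>x. \<bar>H x\<bar> + \<bar>H x\<bar> powr p) x"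
    using pn by (auto simp: p_norm_bounded_eval_def)
  interpret P': prob_space P' by fact
  have spP: "space P' = space M" using P'(2) by (rule sets_eq_imp_space_eq)
  have AE_P: "(AE x in P'. T x) \<longleftrightarrow> (AE x in M. T x)" for T
    by (simp add: eventually_ae_filter P'(3) spP)
  interpret PA: finite_measure_subalgebra P' A
    using subA subC spA spP P'(2) by unfold_locales (auto simp: subalgebra_def)
  obtain K where K: "AE x in M. \<bar>H x\<bar> \<le> K" using H by (auto simp: Linf_def)
  obtain L where L: "AE x in M. \<bar>l x\<bar> \<le> L" and l0: "AE x in M. 0 \<le> l x"
    using l by (auto simp: Linf_nonneg_def Linf_def)
  define b where "b = \<bar>K\<bar> + \<bar>K\<bar> powr p"
  have upper: "AE x in M. \<phi> X x \<le> \<bar>L\<bar> * b" if X: "X \<in> Linf M C" "AE x in M. \<bar>X x\<bar> \<le> \<bar>K\<bar>" for X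
  proof -
    have Xm: "X \<in> borel_measurable M" by (rule Linf_measurable[OF X(1) subC spC])
    have [measurable]: "X \<in> borel_measurable P'"
      using Xm measurable_cong_sets[OF P'(2) refl] by auto
    have b: "AE x in P'. \<bar>X x\<bar> + \<bar>X x\<bar> powr p \<le> b"
      unfolding AE_P using X(2)
      by eventually_elim (use p in \<open>auto simp: b_def intro!: add_mono powr_mono2\<close>)
    have "integrable P' (\<lambda>x. \<bar>X x\<bar> + \<bar>X x\<bar> powr p)"
      using b by (intro P'.integrable_const_bound[of _ b]) (auto elim!: eventually_mono)
    from PA.real_cond_exp_le_c[OF this b]
    have "AE x in M. real_cond_exp P' A (\<lambda>x. \<bar>X x\<bar> + \<bar>X x\<bar> powr p) x \<le> b" by (simp add: AE_P)
    with bd[OF X(1)] l0 L show ?thesis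
    proof eventually_elim
      case (elim x)
      have "l x * real_cond_exp P' A (\<lambda>x. \<bar>X x\<bar> + \<bar>X x\<bar> powr p) x \<le> l x * b"
        using elim by (intro mult_left_mono) auto
      also have "\<dots> \<le> \<bar>L\<bar> * b" using elim by (intro mult_right_mono) (auto simp: b_def)
      finally show ?case using elim by simp
    qed
  qed
  have "AE x in M. \<bar>\<phi> (cut E H) x\<bar> \<le> \<bar>L\<bar> * b" if E: "E \<in> sets C" for E
  proof -
    note EH = Linf_indicator_mult[OF E H]
    have "AE x in M. \<bar>indicator E x * H x\<bar> \<le> \<bar>K\<bar>"
      using K by eventually_elim (auto split: split_indicator)
    then have "AE x in M. \<phi> (cut E H) x \<le> \<bar>L\<bar> * b"
      "AE x in M. \<phi> (\<lambda>x. - (indicator E x * H x)) x \<le> \<bar>L\<bar> * b"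
      using upper[OF EH] upper[OF Linf_uminus[OF EH]] by simp_all
    with phi_ge_uminus[OF EH] show ?thesis by eventually_elim linarith
  qed
  then show ?thesis by (intro exI ballI)
qed

end

context conditional_evaluation begin

text \<open>Gliding hump: if \<open>\<phi> (indicator (E k) * H)\<close> exceeds \<open>4 ^ k\<close> on a non-null set, then the
  functions \<open>2 ^ - k * indicator (E k) * H\<close>, glued together along disjoint non-null sets of \<open>A\<close>, form
  a bounded claim with an unbounded evaluation.\<close>

lemma uniformly_bounded_pos_homogeneous:
  assumes ph: "pos_homogeneous_eval M A C \<phi>" and H: "H \<in> Linf M C"
  shows "\<exists>R. \<forall>E\<in>sets C. AE x in M. \<bar>\<phi> (cut E H) x\<bar> \<le> R"
proof (rule ccontr)
  assume "\<not> ?thesis"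
  \<comment> \<open>The threshold \<open>4^k\<close> still leaves an excess of \<open>2^k\<close>
    after the scaling by \<open>(1/2)^k\<close> that makes the claims tend to zero.\<close>
  then have "\<forall>k::nat. \<exists>E. E \<in> sets C \<and> \<not> (AE x in M. \<bar>\<phi> (cut E H) x\<bar> \<le> 4^k)"
    by blast
  then obtain E where E: "\<And>k::nat. E k \<in> sets C"
    and big: "\<And>k. \<not> (AE x in M. \<bar>\<phi> (cut (E k) H) x\<bar> \<le> 4^k)" by metis
  obtain K where K: "AE x in M. \<bar>H x\<bar> \<le> K" using H by (auto simp: Linf_def)
  define X where "X k x = (1/2)^k * (indicator (E k) x * H x)" for k x
  have X: "X k \<in> Linf M C" for k
    unfolding X_def by (intro Linf_cmult Linf_indicator_mult E H)
  have Xle: "\<bar>X k x\<bar> \<le> (1/2)^k * \<bar>H x\<bar>" for k x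
    by (auto simp: X_def abs_mult split: split_indicator)
  have X1: "\<bar>X k x\<bar> \<le> \<bar>H x\<bar>" for k x
  proof -
    have "(1/2)^k * \<bar>H x\<bar> \<le> 1 * \<bar>H x\<bar>" by (intro mult_right_mono power_le_one) auto
    with Xle[of k x] show ?thesis by simp
  qed
  have phiX: "AE x in M. \<phi> (X k) x = (1/2)^k * \<phi> (cut (E k) H) x" for k
  proof -
    have "(\<lambda>_. (1/2)^k) \<in> Linf_nonneg M A" by (auto simp: Linf_nonneg_def Linf_const)
    from bspec[OF bspec[OF ph[unfolded pos_homogeneous_eval_def] Linf_indicator_mult[OF E H, of k]] this]
    show ?thesis unfolding X_def .
  qed
  have phim: "\<phi> (X k) \<in> borel_measurable A" for k using phi_Linf[OF X] by (auto simp: Linf_def)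
  define B where "B k = {x \<in> space A. 2^k < \<bar>\<phi> (X k) x\<bar>}" for k
  have BA: "B k \<in> sets A" for k unfolding B_def using phim[of k] by measurable
  have [measurable]: "B k \<in> sets M" for k using BA subA subC by blast
  have Bpos: "0 < M.prob (B k)" for k
  proof (rule ccontr)
    assume "\<not> 0 < M.prob (B k)"
    then have "B k \<in> null_sets M"
      by (auto simp: null_sets_def M.emeasure_eq_measure zero_less_measure_iff)
    from AE_not_in[OF this] phiX[of k] AE_space
    have "AE x in M. \<bar>\<phi> (cut (E k) H) x\<bar> \<le> 4^k"
    proof eventually_elim
      case (elim x)
      then have "\<bar>(1/2)^k * \<phi> (cut (E k) H) x\<bar> \<le> 2^k"
        by (auto simp: B_def spA)
      then have "\<bar>\<phi> (cut (E k) H) x\<bar> \<le> 2^k * 2^k"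
        by (simp add: abs_mult power_one_over field_simps)
      then show ?case by (simp add: power_mult_distrib[symmetric])
    qed
    with big[of k] show False ..
  qed
  have "AE x in M. (\<lambda>k. \<phi> (X k) x) \<longlonglongrightarrow> \<phi> (\<lambda>_. 0) x"
  proof (rule phi_convergence[OF X Linf_const])
    show "AE x in M. \<bar>X n x\<bar> \<le> K" for n
      using K by eventually_elim (use X1[of n] in \<open>blast intro: order_trans\<close>)
    show "AE x in M. (\<lambda>n. X n x) \<longlonglongrightarrow> 0"
    proof (rule AE_I2)
      fix x
      have "(\<lambda>n. (1/2)^n * \<bar>H x\<bar>) \<longlonglongrightarrow> 0 * \<bar>H x\<bar>"
        by (intro tendsto_intros LIMSEQ_power_zero) auto
      then show "(\<lambda>n. X n x) \<longlonglongrightarrow> 0"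
        by (intro Lim_null_comparison[of "\<lambda>n. X n x" "\<lambda>n. (1/2)^n * \<bar>H x\<bar>"]) (auto simp: Xle)
    qed
  qed
  with phi_zero have "AE x in M. (\<lambda>k. indicator (B k) x :: real) \<longlonglongrightarrow> 0"
  proof eventually_elim
    case (elim x)
    then have "(\<lambda>k. \<phi> (X k) x) \<longlonglongrightarrow> 0" by simp
    from tendstoD[OF this zero_less_one] have "\<forall>\<^sub>F k in sequentially. indicator (B k) x = (0::real)"
    proof eventually_elim
      case (elim k)
      have "1 \<le> (2::real)^k" by simp
      moreover have "\<bar>\<phi> (X k) x\<bar> < 1" using elim by simp
      ultimately have "\<not> 2^k < \<bar>\<phi> (X k) x\<bar>" by linarith
      then show ?case by (simp add: B_def)
    qed
    then show ?case by (rule tendsto_eventually)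
  qed
  then have "(\<lambda>k. \<integral>x. indicator (B k) x \<partial>M) \<longlonglongrightarrow> (\<integral>x. 0 \<partial>M :: real)"
    by (intro integral_dominated_convergence[where w = "\<lambda>_. 1"]) auto
  moreover have "(\<integral>x. indicator (B k) x \<partial>M) = M.prob (B k)" for k
    by (simp add: Int_absorb2 sets.sets_into_space)
  ultimately have lim: "(\<lambda>k. M.prob (B k)) \<longlonglongrightarrow> 0" by simp
  \<comment> \<open>Continuity at zero makes the probabilities of the \<open>B k\<close> vanish,
    while each is positive. With ratio 3 the later sets carry at most
    \<open>1/3 + 1/9 + ... = 1/2\<close> of the probability of \<open>B (s i)\<close>, so removing
    them leaves a set of positive probability.\<close>
  have "\<exists>s. \<forall>i. True \<and> s i < s (Suc i) \<and> 3 * M.prob (B (s (Suc i))) \<le> M.prob (B (s i))"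
  proof (rule dependent_nat_choice)
    fix m :: nat
    have "\<forall>\<^sub>F n in sequentially. M.prob (B n) < M.prob (B m) / 3"
      using lim Bpos[of m] by (intro order_tendstoD(2)) auto
    then have "\<forall>\<^sub>F n in sequentially. M.prob (B n) < M.prob (B m) / 3 \<and> m < n"
      by (intro eventually_conj eventually_gt_at_top)
    then obtain n where "M.prob (B n) < M.prob (B m) / 3" "m < n"
      by (auto simp: eventually_sequentially)
    then show "\<exists>y. True \<and> m < y \<and> 3 * M.prob (B y) \<le> M.prob (B m)"
      by (intro exI[of _ n]) auto
  qed simp
  then obtain s where s: "\<And>i. s i < s (Suc i)" "\<And>i. 3 * M.prob (B (s (Suc i))) \<le> M.prob (B (s i))"
    by auto
  have geo: "M.prob (B (s (i + k))) \<le> M.prob (B (s i)) * (1/3)^k" for i k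
  proof (induction k)
    case (Suc k)
    then show ?case using s(2)[of "i + k"] by simp
  qed simp
  define D where "D i = B (s i) - (\<Union>k. B (s (i + Suc k)))" for i
  have DA: "D i \<in> sets A" for i unfolding D_def using BA by auto
  have dis: "D i \<inter> D j = {}" if "i < j" for i j
  proof -
    from less_imp_Suc_add[OF that] obtain k where "j = Suc (i + k)" ..
    then have "D j \<subseteq> B (s (i + Suc k))" by (auto simp: D_def)
    then show ?thesis unfolding D_def[of i] by blast
  qed
  have Dpos: "0 < M.prob (D i)" for i
  proof -
    have su: "(\<lambda>k. M.prob (B (s i)) * (1/3)^Suc k) sums (M.prob (B (s i)) * (1/2))"
    proof -
      have "(\<lambda>k. (1/3::real)^k) sums (3/2)" using geometric_sums[of "1/3::real"] by simp
      then have "(\<lambda>k. (M.prob (B (s i)) * (1/3)) * (1/3::real)^k) sums ((M.prob (B (s i)) * (1/3)) * (3/2))"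
        by (rule sums_mult)
      then show ?thesis by (simp add: mult_ac)
    qed
    have summ: "summable (\<lambda>k. M.prob (B (s (i + Suc k))))"
      by (rule summable_comparison_test'[OF sums_summable[OF su], of 0]) (use geo[of i "Suc _"] in simp)
    have "M.prob (\<Union>k. B (s (i + Suc k))) \<le> (\<Sum>k. M.prob (B (s (i + Suc k))))"
      by (rule M.finite_measure_subadditive_countably) (use summ in auto)
    also have "\<dots> \<le> (\<Sum>k. M.prob (B (s i)) * (1/3)^Suc k)"
      by (rule suminf_le[OF geo summ sums_summable[OF su]])
    also have "\<dots> = M.prob (B (s i)) * (1/2)" using su by (rule sums_unique[symmetric])
    also have "\<dots> < M.prob (B (s i))" using Bpos[of "s i"] by simp
    finally have "M.prob (\<Union>k. B (s (i + Suc k))) < M.prob (B (s i))" .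
    moreover have "M.prob (B (s i)) \<le> M.prob (D i \<union> (\<Union>k. B (s (i + Suc k))))"
      by (intro M.finite_measure_mono) (auto simp: D_def)
    moreover have "\<dots> \<le> M.prob (D i) + M.prob (\<Union>k. B (s (i + Suc k)))"
      by (intro measure_Un_le) (auto simp: D_def)
    ultimately show ?thesis by linarith
  qed
  \<comment> \<open>At most one summand is nonzero at each point, and every \<open>X k\<close> is
    dominated by \<open>H\<close>; thus \<open>H'\<close> is a bounded claim although infinitely
    many pieces are glued.\<close>
  define H' where "H' x = (\<Sum>j. indicator (D j) x * X (s j) x)" for x
  have H'_D: "H' x = X (s i) x" if "x \<in> D i" for x i
  proof -
    have "x \<notin> D j" if "j \<noteq> i" for j
      using dis[of i j] dis[of j i] that \<open>x \<in> D i\<close> by (cases i j rule: linorder_cases) auto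
    then have "H' x = (\<Sum>j\<in>{i}. indicator (D j) x * X (s j) x)"
      unfolding H'_def by (intro suminf_finite) auto
    then show ?thesis using that by simp
  qed
  have H'0: "H' x = 0" if "\<And>i. x \<notin> D i" for x using that by (simp add: H'_def)
  have "H' \<in> Linf M C"
  proof -
    have [measurable]: "D j \<in> sets C" "X (s j) \<in> borel_measurable C" for j
      using DA subA X by (auto simp: Linf_def)
    have "H' \<in> borel_measurable C" unfolding H'_def by measurable
    moreover have "\<bar>H' x\<bar> \<le> \<bar>H x\<bar>" for x
      using H'_D[of x] H'0[of x] X1 by (cases "\<exists>i. x \<in> D i") auto
    then have "AE x in M. \<bar>H' x\<bar> \<le> K" using K by (auto elim!: eventually_mono intro: order_trans)
    ultimately show ?thesis by (auto simp: Linf_def)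
  qed
  then obtain R where R: "AE x in M. \<bar>\<phi> H' x\<bar> \<le> R" using phi_Linf by (auto simp: Linf_def)
  obtain i :: nat where i: "R < 2 ^ i" using real_arch_pow[of 2 R] by auto
  have "i \<le> s i" using s(1) by (intro seq_suble strict_mono_Suc_iff[THEN iffD2]) auto
  then have "(2::real) ^ i \<le> 2 ^ s i" by (intro power_increasing) auto
  from less_le_trans[OF i this] have Rs: "R < 2 ^ s i" .
  have eq: "(cut (D i) H') = (\<lambda>x. indicator (D i) x * X (s i) x)"
    using H'_D[of _ i] by (auto split: split_indicator)
  \<comment> \<open>Locality identifies \<open>\<phi> H'\<close> with
    \<open>\<phi> (X (s i))\<close> on \<open>D i\<close>, where the latter exceeds
    \<open>2 ^ s i\<close>. Once this passes the bound \<open>R\<close>, the set would have to be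
    null.\<close>
  have "AE x in M. x \<notin> D i"
    using phi_local[OF DA \<open>H' \<in> Linf M C\<close>, of i] phi_local[OF DA X, of i "s i"] R unfolding eq
  proof eventually_elim
    case (elim x)
    show ?case
    proof
      assume "x \<in> D i"
      with elim have "\<bar>\<phi> (X (s i)) x\<bar> \<le> R" by simp
      moreover have "2 ^ s i < \<bar>\<phi> (X (s i)) x\<bar>" using \<open>x \<in> D i\<close> by (auto simp: D_def B_def)
      ultimately show False using Rs by linarith
    qed
  qed
  moreover have "D i \<in> sets M" using DA subA subC by blast
  ultimately have "D i \<in> null_sets M" by (simp add: AE_iff_null_sets)
  with Dpos[of i] show False by (auto simp: null_sets_def M.emeasure_eq_measure)
qed

end

text \<open>\<open>G\<close> lies between \<open>A\<close> and \<open>C\<close> and consists of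
  events whose claims the market prices. The locale serves two choices of \<open>G\<close>: the
  sigma-algebra generated along an announcing sequence, and the stock sigma-algebra at the next
  jump.\<close>

locale market_evaluation = conditional_evaluation +
  fixes G :: "'a measure"
  assumes subG: "sets G \<subseteq> sets C" and spG: "space G = space M" and A_sub_G: "sets A \<subseteq> sets G"
    and market: "\<And>m H. m \<in> Linf M G \<Longrightarrow> H \<in> Linf M C \<Longrightarrow>
      AE x in M. \<phi> (\<lambda>x. m x + H x) x = real_cond_exp Q A m x + \<phi> H x"
begin

lemma LinfG_C: "f \<in> Linf M G \<Longrightarrow> f \<in> Linf M C"
  by (rule Linf_mono) (use subG spG spC in auto)

lemma LinfA_G: "f \<in> Linf M A \<Longrightarrow> f \<in> Linf M G"
  by (rule Linf_mono) (use A_sub_G spG spA in auto)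

lemma LinfG_integrable: "f \<in> Linf M G \<Longrightarrow> integrable Q f"
  by (rule Linf_integrable[where B = G]) (use subG subC spG in auto)

sublocale QA: sigma_finite_subalgebra Q A
  by (rule sigma_finite_subalgebra_Q) (use subA subC spA in auto)

text \<open>The set function
  \<open>E \<mapsto> (\<integral>x. \<phi> (cut E H) x \<partial>Q)\<close> is additive by
  hypothesis, continuous at the empty set by continuity of \<open>\<phi>\<close> and dominated
  convergence, and vanishes on null sets. The uniform bound \<open>R\<close> serves as dominating
  function and as upper bound of the set function.\<close>

lemma density_exists:
  assumes additive: "\<And>E H. E \<in> sets G \<Longrightarrow> H \<in> Linf M C \<Longrightarrow> AE x in M.
      \<phi> H x = \<phi> (cut E H) x + \<phi> (cut (space M - E) H) x"
    and bounded: "\<And>E. E \<in> sets G \<Longrightarrow> AE x in M. \<bar>\<phi> (cut E H) x\<bar> \<le> R"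
    and H: "H \<in> Linf M C"
  shows "\<exists>c. integrable Q c \<and> c \<in> borel_measurable G \<and>
    (\<forall>E\<in>sets G. (\<integral>x. indicator E x * c x \<partial>Q) = (\<integral>x. \<phi> (cut E H) x \<partial>Q))"
proof -
  have subQG: "subalgebra Q G" using subG subC spG by (auto simp: subalgebra_def sets_Q spQ)
  \<comment> \<open>Taking the density on the restriction of \<open>Q\<close> to \<open>G\<close>
    makes it measurable with respect to \<open>G\<close>.\<close>
  define N where "N = restr_to_subalg Q G"
  have sets_N: "sets N = sets G" unfolding N_def by (rule sets_restr_to_subalg[OF subQG])
  interpret N: prob_space N
    unfolding N_def by (rule prob_space_restr_to_subalg[OF subQG Q.prob_space_axioms])
  define \<nu> where "\<nu> E = (\<integral>x. \<phi> (cut E H) x \<partial>Q)" for E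
  have EH: "(cut E H) \<in> Linf M C" if "E \<in> sets G" for E
    using that subG by (intro Linf_indicator_mult H) auto
  have "\<exists>c. integrable N c \<and> (\<forall>E\<in>sets N. \<nu> E = (\<integral>x. indicator E x * c x \<partial>N))"
  proof (rule N.set_function_density[of \<nu> R])
    fix E F assume "E \<in> sets N" "F \<in> sets N" and dis: "E \<inter> F = {}"
    then have EF: "E \<in> sets G" "F \<in> sets G" "E \<union> F \<in> sets G" by (auto simp: sets_N)
    have F_sub: "F \<subseteq> space M" using sets.sets_into_space[OF EF(2)] spG by simp
    have 1: "(\<lambda>x. indicator E x * (indicator (E \<union> F) x * H x)) = (cut E H)"
      by (auto split: split_indicator)
    have 2: "(\<lambda>x. indicator (space M - E) x * (indicator (E \<union> F) x * H x)) = (cut F H)"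
      by (rule ext) (use dis F_sub in \<open>auto simp: indicator_def\<close>)
    have "AE x in Q. \<phi> (cut (E \<union> F) H) x
        = \<phi> (cut E H) x + \<phi> (cut F H) x"
      using additive[OF EF(1) EH[OF EF(3)]] unfolding 1 2 AE_Q .
    then have "\<nu> (E \<union> F) = (\<integral>x. \<phi> (cut E H) x + \<phi> (cut F H) x \<partial>Q)"
      unfolding \<nu>_def using phi_measurable EH EF
      by (intro integral_cong_AE borel_measurable_add) auto
    then show "\<nu> (E \<union> F) = \<nu> E + \<nu> F"
      unfolding \<nu>_def using phi_integrable EH EF by simp
  next
    fix F :: "nat \<Rightarrow> 'a set" assume "range F \<subseteq> sets N" "decseq F" and emp: "(\<Inter>i. F i) = {}"
    then have F: "F i \<in> sets G" for i by (auto simp: sets_N)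
    obtain K where K: "AE x in M. \<bar>H x\<bar> \<le> K" using H by (auto simp: Linf_def)
    have "AE x in M. (\<lambda>i. \<phi> (cut (F i) H) x) \<longlonglongrightarrow> \<phi> (\<lambda>_. 0) x"
    proof (rule phi_convergence[OF EH[OF F] Linf_const])
      show "AE x in M. \<bar>indicator (F n) x * H x\<bar> \<le> K" for n
        using K by eventually_elim (auto split: split_indicator)
      show "AE x in M. (\<lambda>i. indicator (F i) x * H x) \<longlonglongrightarrow> 0"
      proof (rule AE_I2)
        fix x
        obtain i where "x \<notin> F i" using emp by blast
        then have "indicator (F j) x * H x = 0" if "j \<ge> i" for j
          using \<open>decseq F\<close> that by (auto simp: decseq_def split: split_indicator)
        then show "(\<lambda>i. indicator (F i) x * H x) \<longlonglongrightarrow> 0"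
          by (intro tendsto_eventually) (auto simp: eventually_sequentially)
      qed
    qed
    with phi_zero have "AE x in Q. (\<lambda>i. \<phi> (cut (F i) H) x) \<longlonglongrightarrow> 0"
      unfolding AE_Q by eventually_elim simp
    then have "(\<lambda>i. \<nu> (F i)) \<longlonglongrightarrow> (\<integral>x. 0 \<partial>Q)"
      unfolding \<nu>_def using bounded[OF F] phi_measurable[OF EH[OF F]]
      by (intro integral_dominated_convergence[where w = "\<lambda>_. R"]) (auto simp: AE_Q)
    then show "(\<lambda>i. \<nu> (F i)) \<longlonglongrightarrow> 0" by simp
  next
    fix E assume "E \<in> null_sets N"
    then have E: "E \<in> sets G" "E \<in> null_sets M"
      using null_sets_restr_to_subalg[OF subQG] by (auto simp: N_def null_Q)
    have "AE x in M. indicator E x * H x = 0"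
      using AE_not_in[OF E(2)] by eventually_elim simp
    from phi_cong[OF EH[OF E(1)] Linf_const this] phi_zero
    have "AE x in Q. \<phi> (cut E H) x = 0" unfolding AE_Q by eventually_elim simp
    then show "\<nu> E = 0" unfolding \<nu>_def by (rule integral_eq_zero_AE)
  next
    fix E assume "E \<in> sets N"
    then have E: "E \<in> sets G" by (simp add: sets_N)
    have "AE x in M. \<phi> (cut E H) x \<le> R" using bounded[OF E] by eventually_elim simp
    then have "\<nu> E \<le> (\<integral>x. R \<partial>Q)"
      unfolding \<nu>_def by (intro integral_mono_M phi_integrable EH E) auto
    then show "\<nu> E \<le> R" by (simp add: Q.prob_space)
  qed
  then obtain c where "integrable N c \<and> (\<forall>E\<in>sets N. \<nu> E = (\<integral>x. indicator E x * c x \<partial>N))" ..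
  note c = conjunct1[OF this] conjunct2[OF this]
  have cm: "c \<in> borel_measurable G"
    using borel_measurable_integrable[OF c(1)] measurable_cong_sets[OF sets_N refl] by auto
  have ce: "(\<integral>x. indicator E x * c x \<partial>Q) = \<nu> E" if E: "E \<in> sets G" for E
  proof -
    have "(\<integral>x. indicator E x * c x \<partial>N) = (\<integral>x. indicator E x * c x \<partial>Q)"
      unfolding N_def by (rule integral_subalgebra2[OF subQG]) (use cm E in measurable)
    then show ?thesis using c(2) E by (simp add: sets_N)
  qed
  have "integrable Q c" by (rule integrable_from_subalg[OF subQG c(1)[unfolded N_def]])
  with cm ce show ?thesis unfolding \<nu>_def by (intro exI[of _ c] conjI ballI)
qed

end

section \<open>The stock-conditional evaluation given by densities\<close>

context market_evaluation begin

text \<open>Testing on the set where \<open>Z x < X x\<close> forces it to be null. This is how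
  integrated relations between densities become almost-sure ones.\<close>

lemma G_integral_le_imp_AE_le:
  assumes X: "X \<in> Linf M G" and Z: "Z \<in> Linf M G"
    and le: "\<And>E. E \<in> sets G \<Longrightarrow> (\<integral>x. indicator E x * X x \<partial>Q) \<le> (\<integral>x. indicator E x * Z x \<partial>Q)"
  shows "AE x in M. X x \<le> Z x"
proof -
  have [measurable]: "X \<in> borel_measurable G" "Z \<in> borel_measurable G" using X Z by (auto simp: Linf_def)
  define E where "E = {x \<in> space G. Z x < X x}"
  have E: "E \<in> sets G" unfolding E_def by measurable
  define f where "f x = indicator E x * (X x - Z x)" for x
  have fL: "f \<in> Linf M G" unfolding f_def by (intro Linf_indicator_mult Linf_diff E X Z)
  have "(\<integral>x. f x \<partial>Q) = (\<integral>x. indicator E x * X x \<partial>Q) - (\<integral>x. indicator E x * Z x \<partial>Q)"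
    unfolding f_def right_diff_distrib
    by (intro Bochner_Integration.integral_diff LinfG_integrable Linf_indicator_mult E X Z)
  then have "(\<integral>x. f x \<partial>Q) \<le> 0" using le[OF E] by simp
  have nonneg: "0 \<le> f x" for x by (auto simp: f_def E_def split: split_indicator)
  note \<open>(\<integral>x. f x \<partial>Q) \<le> 0\<close>
  moreover have "0 \<le> (\<integral>x. f x \<partial>Q)" using nonneg by simp
  ultimately have "(\<integral>x. f x \<partial>Q) = 0" by (intro antisym)
  then have "AE x in Q. f x = 0"
    using LinfG_integrable[OF fL] nonneg by (subst (asm) integral_nonneg_eq_0_iff_AE) auto
  then have "AE x in M. f x = 0" by (simp add: AE_Q)
  then show ?thesis
    using AE_space by eventually_elim (auto simp: f_def E_def spG split: split_indicator_asm)
qed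

lemma G_integral_eq_imp_AE_eq:
  assumes X: "X \<in> Linf M G" and Z: "Z \<in> Linf M G"
    and eq: "\<And>E. E \<in> sets G \<Longrightarrow> (\<integral>x. indicator E x * X x \<partial>Q) = (\<integral>x. indicator E x * Z x \<partial>Q)"
  shows "AE x in M. X x = Z x"
  using G_integral_le_imp_AE_le[OF X Z] G_integral_le_imp_AE_le[OF Z X] eq
  by (auto elim: eventually_elim2)

end

text \<open>\<open>\<Psi> H\<close> is the density on \<open>G\<close> of the set function
  \<open>E \<mapsto> (\<integral>x. \<phi> (cut E H) x \<partial>Q)\<close>. Every property of a
  conditional evaluation is derived from this one identity.\<close>

locale market_density = market_evaluation +
  fixes \<Psi> :: "('a \<Rightarrow> real) \<Rightarrow> 'a \<Rightarrow> real"
  assumes Psi_Linf: "\<And>H. H \<in> Linf M C \<Longrightarrow> \<Psi> H \<in> Linf M G"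
    and Psi: "\<And>H E. H \<in> Linf M C \<Longrightarrow> E \<in> sets G \<Longrightarrow>
      (\<integral>x. indicator E x * \<Psi> H x \<partial>Q) = (\<integral>x. \<phi> (cut E H) x \<partial>Q)"
begin

lemma EH: "E \<in> sets G \<Longrightarrow> H \<in> Linf M C \<Longrightarrow> (cut E H) \<in> Linf M C"
  using subG by (intro Linf_indicator_mult) auto

text \<open>The defining identity is used for \<open>B \<inter> E\<close> with \<open>B\<close> in
  \<open>A\<close>; locality of \<open>\<phi>\<close> moves the indicator of \<open>B\<close>
  outside. Letting \<open>B\<close> vary upgrades equality of integrals to equality of conditional
  expectations.\<close>

lemma cond_exp_Psi:
  assumes E: "E \<in> sets G" and H: "H \<in> Linf M C"
  shows "AE x in M. real_cond_exp Q A (cut E (\<Psi> H)) x = \<phi> (cut E H) x"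
  unfolding AE_Q[symmetric]
proof (rule QA.real_cond_exp_charact)
  note iL = Linf_indicator_mult[OF E Psi_Linf[OF H]]
  show "integrable Q (cut E (\<Psi> H))" by (rule LinfG_integrable[OF iL])
  show "integrable Q (\<phi> (cut E H))" by (rule phi_integrable[OF EH[OF E H]])
  show "\<phi> (cut E H) \<in> borel_measurable A"
    using phi_Linf[OF EH[OF E H]] by (auto simp: Linf_def)
  fix B assume B: "B \<in> sets A"
  then have BG: "B \<in> sets G" using A_sub_G by auto
  have BE: "B \<inter> E \<in> sets G" using BG E by auto
  have 1: "(cut (B \<inter> E) H) = (\<lambda>x. indicator B x * (indicator E x * H x))"
    by (auto split: split_indicator)
  have "(\<integral>x\<in>B. indicator E x * \<Psi> H x \<partial>Q) = (\<integral>x. indicator (B \<inter> E) x * \<Psi> H x \<partial>Q)"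
    unfolding set_lebesgue_integral_def by (intro Bochner_Integration.integral_cong) (auto split: split_indicator)
  also have "\<dots> = (\<integral>x. \<phi> (\<lambda>x. indicator B x * (indicator E x * H x)) x \<partial>Q)"
    by (simp only: Psi[OF H BE] 1)
  also have "\<dots> = (\<integral>x. indicator B x * \<phi> (cut E H) x \<partial>Q)"
  proof (rule integral_cong_AE)
    show "AE x in Q. \<phi> (\<lambda>x. indicator B x * (indicator E x * H x)) x = indicator B x * \<phi> (cut E H) x"
      unfolding AE_Q by (rule phi_local[OF B EH[OF E H]])
    show "\<phi> (\<lambda>x. indicator B x * (indicator E x * H x)) \<in> borel_measurable Q"
      by (intro phi_measurable EH E H BG)
    show "(\<lambda>x. indicator B x * \<phi> (cut E H) x) \<in> borel_measurable Q"
      by (intro borel_measurable_integrable LinfG_integrable Linf_indicator_mult[OF BG] LinfA_G phi_Linf EH E H)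
  qed
  finally show "(\<integral>x\<in>B. indicator E x * \<Psi> H x \<partial>Q) = (\<integral>x\<in>B. \<phi> (cut E H) x \<partial>Q)"
    unfolding set_lebesgue_integral_def by simp
qed

lemma cond_exp_Psi_space: "H \<in> Linf M C \<Longrightarrow> AE x in M. \<phi> H x = real_cond_exp Q A (\<Psi> H) x"
proof -
  assume H: "H \<in> Linf M C"
  \<comment> \<open>The set \<open>E\<close> is the whole space; its indicator differs from 1 as a
    function outside \<open>space M\<close>, so both sides still need a congruence argument.\<close>
  have sp: "space M \<in> sets G" using spG sets.top[of G] by simp
  have "(cut (space M) (\<Psi> H)) \<in> borel_measurable Q" "\<Psi> H \<in> borel_measurable Q"
    using LinfG_integrable[OF Psi_Linf[OF H]] LinfG_integrable[OF Linf_indicator_mult[OF sp Psi_Linf[OF H]]] by auto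
  then have "AE x in Q. real_cond_exp Q A (cut (space M) (\<Psi> H)) x = real_cond_exp Q A (\<Psi> H) x"
    by (intro QA.real_cond_exp_cong AE_I2) (auto simp: spQ)
  moreover have "AE x in M. \<phi> (cut (space M) H) x = \<phi> H x"
    by (intro phi_cong EH sp H AE_I2) auto
  ultimately show ?thesis
    using cond_exp_Psi[OF sp H] unfolding AE_Q by eventually_elim simp
qed

lemma Psi_indicator: "E \<in> sets G \<Longrightarrow> H \<in> Linf M C \<Longrightarrow>
    AE x in M. \<Psi> (cut E H) x = indicator E x * \<Psi> H x"
proof (rule G_integral_eq_imp_AE_eq)
  assume E: "E \<in> sets G" and H: "H \<in> Linf M C"
  show "\<Psi> (cut E H) \<in> Linf M G" by (intro Psi_Linf EH E H)
  show "(cut E (\<Psi> H)) \<in> Linf M G" by (intro Linf_indicator_mult E Psi_Linf H)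
  fix F assume F: "F \<in> sets G"
  have eq: "indicator F x * (indicator E x * u) = indicator (F \<inter> E) x * (u::real)" for x u
    by (auto split: split_indicator)
  show "(\<integral>x. indicator F x * \<Psi> (cut E H) x \<partial>Q) = (\<integral>x. indicator F x * (indicator E x * \<Psi> H x) \<partial>Q)"
    unfolding Psi[OF EH[OF E H] F] eq using Psi[OF H, of "F \<inter> E"] E F by simp
qed

text \<open>Locality in \<open>G\<close>, which is finer than the locality in \<open>A\<close>
  enjoyed by \<open>\<phi>\<close>. It evaluates claims glued along sets of \<open>G\<close> piece
  by piece.\<close>

lemma Psi_cong_on:
  assumes E: "E \<in> sets G" and H: "H \<in> Linf M C" "K \<in> Linf M C" and eq: "\<And>x. x \<in> E \<Longrightarrow> H x = K x"
  shows "AE x in M. x \<in> E \<longrightarrow> \<Psi> H x = \<Psi> K x"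
proof -
  have "(cut E H) = (cut E K)"
    using eq by (auto split: split_indicator)
  with Psi_indicator[OF E H(1)] Psi_indicator[OF E H(2)]
  show ?thesis by (auto elim!: eventually_elim2)
qed

text \<open>Market consistency splits off the conditional expectation of \<open>cut E m\<close>, and
  its \<open>Q\<close>-integral is that of \<open>cut E m\<close> itself; conditioning on
  \<open>A\<close> thus disappears and translation by all of \<open>G\<close> remains.\<close>

lemma Psi_add:
  assumes H: "H \<in> Linf M C" and m: "m \<in> Linf M G"
  shows "AE x in M. \<Psi> (\<lambda>x. H x + m x) x = \<Psi> H x + m x"
proof (rule G_integral_eq_imp_AE_eq)
  note mC = LinfG_C[OF m]
  show "\<Psi> (\<lambda>x. H x + m x) \<in> Linf M G" by (intro Psi_Linf Linf_add H mC)
  show "(\<lambda>x. \<Psi> H x + m x) \<in> Linf M G" by (intro Linf_add Psi_Linf H m)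
  fix E assume E: "E \<in> sets G"
  note Em = Linf_indicator_mult[OF E m]
  have i1: "integrable Q (real_cond_exp Q A (cut E m))"
    by (intro QA.real_cond_exp_int LinfG_integrable Em)
  have i2: "integrable Q (\<phi> (cut E H))" by (intro phi_integrable EH E H)
  have eq: "(\<lambda>x. indicator E x * (H x + m x)) = (\<lambda>x. indicator E x * m x + indicator E x * H x)"
    by (simp add: algebra_simps)
  have "(\<integral>x. indicator E x * \<Psi> (\<lambda>x. H x + m x) x \<partial>Q)
      = (\<integral>x. \<phi> (\<lambda>x. indicator E x * m x + indicator E x * H x) x \<partial>Q)"
    by (simp only: Psi[OF Linf_add[OF H mC] E] eq)
  also have "\<dots> = (\<integral>x. real_cond_exp Q A (cut E m) x + \<phi> (cut E H) x \<partial>Q)"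
  proof (rule integral_cong_AE)
    show "AE x in Q. \<phi> (\<lambda>x. indicator E x * m x + indicator E x * H x) x
      = real_cond_exp Q A (cut E m) x + \<phi> (cut E H) x"
      unfolding AE_Q by (rule market[OF Em EH[OF E H]])
    show "\<phi> (\<lambda>x. indicator E x * m x + indicator E x * H x) \<in> borel_measurable Q"
      by (intro phi_measurable Linf_add EH E H mC)
  qed (use i1 i2 in simp)
  also have "\<dots> = (\<integral>x. indicator E x * m x \<partial>Q) + (\<integral>x. \<phi> (cut E H) x \<partial>Q)"
    using i1 i2 QA.real_cond_exp_int(2)[OF LinfG_integrable[OF Em]] by simp
  also have "\<dots> = (\<integral>x. indicator E x * (\<Psi> H x + m x) \<partial>Q)"
    using LinfG_integrable[OF Em] LinfG_integrable[OF Linf_indicator_mult[OF E Psi_Linf[OF H]]]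
    by (simp add: Psi[OF H E, symmetric] distrib_left)
  finally show "(\<integral>x. indicator E x * \<Psi> (\<lambda>x. H x + m x) x \<partial>Q) = (\<integral>x. indicator E x * (\<Psi> H x + m x) \<partial>Q)" .
qed

lemma Psi_local:
  assumes H: "H \<in> Linf M C" "K \<in> Linf M C" and E: "E \<in> sets G"
  shows "AE x in M. \<Psi> (\<lambda>x. indicator E x * H x + indicator (space M - E) x * K x) x
    = indicator E x * \<Psi> H x + indicator (space M - E) x * \<Psi> K x"
proof -
  let ?W = "\<lambda>x. indicator E x * H x + indicator (space M - E) x * K x"
  have cE: "space M - E \<in> sets G" using sets.compl_sets[OF E] spG by simp
  have W: "?W \<in> Linf M C" by (intro Linf_add EH E cE H)
  have "AE x in M. x \<in> E \<longrightarrow> \<Psi> ?W x = \<Psi> H x" by (rule Psi_cong_on[OF E W H(1)]) auto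
  moreover have "AE x in M. x \<in> space M - E \<longrightarrow> \<Psi> ?W x = \<Psi> K x"
    by (rule Psi_cong_on[OF cE W H(2)]) auto
  ultimately show ?thesis using AE_space by eventually_elim (auto split: split_indicator)
qed

text \<open>A constant weight commutes with the indicator and is measurable with respect to
  \<open>A\<close>, so convexity of \<open>\<phi>\<close> can be integrated. Weights in
  \<open>G\<close> need not be measurable with respect to \<open>A\<close> and are reached by
  approximation.\<close>

lemma Psi_convex_const:
  assumes l: "0 \<le> l" "l \<le> 1" and H: "H \<in> Linf M C" "K \<in> Linf M C"
  shows "AE x in M. \<Psi> (\<lambda>x. l * H x + (1 - l) * K x) x \<le> l * \<Psi> H x + (1 - l) * \<Psi> K x"
proof (rule G_integral_le_imp_AE_le)
  have HK: "(\<lambda>x. l * H x + (1 - l) * K x) \<in> Linf M C" by (intro Linf_add Linf_cmult H)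
  show "\<Psi> (\<lambda>x. l * H x + (1 - l) * K x) \<in> Linf M G" by (rule Psi_Linf[OF HK])
  show "(\<lambda>x. l * \<Psi> H x + (1 - l) * \<Psi> K x) \<in> Linf M G" by (intro Linf_add Linf_cmult Psi_Linf H)
  fix E assume E: "E \<in> sets G"
  note EH1 = EH[OF E H(1)] and EH2 = EH[OF E H(2)]
  have eq: "(\<lambda>x. indicator E x * (l * H x + (1 - l) * K x))
      = (\<lambda>x. l * (indicator E x * H x) + (1 - l) * (indicator E x * K x))"
    by (simp add: algebra_simps)
  have "(\<integral>x. indicator E x * \<Psi> (\<lambda>x. l * H x + (1 - l) * K x) x \<partial>Q)
      = (\<integral>x. \<phi> (\<lambda>x. l * (indicator E x * H x) + (1 - l) * (indicator E x * K x)) x \<partial>Q)"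
    by (simp only: Psi[OF HK E] eq)
  also have "\<dots> \<le> (\<integral>x. l * \<phi> (cut E H) x + (1 - l) * \<phi> (cut E K) x \<partial>Q)"
  proof (rule integral_mono_M)
    show "AE x in M. \<phi> (\<lambda>x. l * (indicator E x * H x) + (1 - l) * (indicator E x * K x)) x
        \<le> l * \<phi> (cut E H) x + (1 - l) * \<phi> (cut E K) x"
      by (rule phi_convex[OF l EH1 EH2])
    show "integrable Q (\<phi> (\<lambda>x. l * (indicator E x * H x) + (1 - l) * (indicator E x * K x)))"
      by (intro phi_integrable Linf_add Linf_cmult EH1 EH2)
    show "integrable Q (\<lambda>x. l * \<phi> (cut E H) x + (1 - l) * \<phi> (cut E K) x)"
      using phi_integrable[OF EH1] phi_integrable[OF EH2] by simp
  qed
  also have "\<dots> = l * (\<integral>x. \<phi> (cut E H) x \<partial>Q) + (1 - l) * (\<integral>x. \<phi> (cut E K) x \<partial>Q)"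
    using phi_integrable[OF EH1] phi_integrable[OF EH2] by simp
  also have "\<dots> = l * (\<integral>x. indicator E x * \<Psi> H x \<partial>Q) + (1 - l) * (\<integral>x. indicator E x * \<Psi> K x \<partial>Q)"
    by (simp only: Psi[OF H(1) E] Psi[OF H(2) E])
  also have "\<dots> = (\<integral>x. l * (indicator E x * \<Psi> H x) + (1 - l) * (indicator E x * \<Psi> K x) \<partial>Q)"
    using LinfG_integrable[OF Linf_indicator_mult[OF E Psi_Linf[OF H(1)]]]
      LinfG_integrable[OF Linf_indicator_mult[OF E Psi_Linf[OF H(2)]]] by simp
  also have "\<dots> = (\<integral>x. indicator E x * (l * \<Psi> H x + (1 - l) * \<Psi> K x) \<partial>Q)"
    by (simp add: algebra_simps)
  finally show "(\<integral>x. indicator E x * \<Psi> (\<lambda>x. l * H x + (1 - l) * K x) x \<partial>Q)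
    \<le> (\<integral>x. indicator E x * (l * \<Psi> H x + (1 - l) * \<Psi> K x) \<partial>Q)" .
qed

end

section \<open>Lower semicontinuity and convexity of the density map\<close>

context market_density begin

text \<open>If \<open>\<Psi> (Hs n) \<le> \<Psi> H - \<epsilon>\<close> happens infinitely often on a non-null set, then gluing the \<open>Hs n\<close>
  together along the first such index \<open>n \<ge> N\<close> yields claims \<open>W N\<close> converging to \<open>H\<close> for which
  \<open>\<phi> (W N)\<close> stays away from \<open>\<phi> H\<close>.\<close>

lemma Psi_eventually_gt:
  assumes conv: "bounded_ae_conv M C Hs H" and "0 < \<epsilon>"
  shows "AE x in M. \<forall>\<^sub>F n in sequentially. \<Psi> H x - \<epsilon> < \<Psi> (Hs n) x"
proof -
  have Hs: "Hs n \<in> Linf M C" and H: "H \<in> Linf M C" and lim: "AE x in M. (\<lambda>n. Hs n x) \<longlonglongrightarrow> H x"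
    and "\<exists>b. \<forall>n. AE x in M. \<bar>Hs n x\<bar> \<le> b" for n
    using conv by (simp_all add: bounded_ae_conv_def)
  from this(4) obtain b where "\<forall>n. AE x in M. \<bar>Hs n x\<bar> \<le> b" ..
  then have b: "AE x in M. \<bar>Hs n x\<bar> \<le> b" for n by simp
  obtain b' where b': "AE x in M. \<bar>H x\<bar> \<le> b'" using H by (auto simp: Linf_def)
  have PL: "\<Psi> H \<in> Linf M G" "\<And>n. \<Psi> (Hs n) \<in> Linf M G" using Psi_Linf H Hs by auto
  then have [measurable]: "\<Psi> H \<in> borel_measurable G" "\<And>n. \<Psi> (Hs n) \<in> borel_measurable G"
    by (auto simp: Linf_def)
  define F where "F n = {x \<in> space G. \<Psi> (Hs n) x \<le> \<Psi> H x - \<epsilon>}" for n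
  have F [measurable]: "F n \<in> sets G" for n unfolding F_def by measurable
  have GQ: "E \<in> sets Q" if "E \<in> sets G" for E using that subG subC by (auto simp: sets_Q)
  define U where "U N = (\<Union>n. F (N + n))" for N
  \<comment> \<open>The points lying in infinitely many \<open>F n\<close> form the intersection of
    the \<open>U N\<close>. Keeping only finitely many indices makes each glued claim a finite sum,
    and \<open>K N\<close> is chosen so that at most \<open>(1/2)^N\<close> of the probability of
    \<open>U N\<close> is lost.\<close>
  define V where "V N K = (\<Union>n<K. F (N + n))" for N K
  have V: "V N K \<in> sets G" and U: "U N \<in> sets G" for N K by (auto simp: V_def U_def)
  have "\<exists>K. Q.prob (U N) < Q.prob (V N K) + (1/2)^N" for N
  proof -
    have "incseq (V N)" unfolding V_def by (intro monoI UN_mono) auto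
    then have "(\<lambda>K. Q.prob (V N K)) \<longlonglongrightarrow> Q.prob (\<Union>K. V N K)"
      using GQ[OF V] by (intro Q.finite_Lim_measure_incseq) auto
    moreover have "(\<Union>K. V N K) = U N" by (auto simp: V_def U_def)
    ultimately have "\<forall>\<^sub>F K in sequentially. Q.prob (U N) - (1/2)^N < Q.prob (V N K)"
      by (intro order_tendstoD(1)) auto
    then obtain K where "Q.prob (U N) - (1/2)^N < Q.prob (V N K)" by (auto simp: eventually_sequentially)
    then show ?thesis by (intro exI[of _ K]) linarith
  qed
  then obtain K where K: "\<And>N. Q.prob (U N) < Q.prob (V N (K N)) + (1/2)^N" by metis
  define V' where "V' N = V N (K N)" for N
  have V': "V' N \<in> sets G" for N unfolding V'_def by (rule V)
  have cV': "space M - V' N \<in> sets G" for N using sets.compl_sets[OF V'] spG by simp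
  define D where "D N n = F (N + n) - (\<Union>i<n. F (N + i))" for N n
  have D: "D N n \<in> sets G" for N n by (auto simp: D_def)
  have Ddis: "n = m" if "x \<in> D N n" "x \<in> D N m" for x N n m
    using that by (cases n m rule: linorder_cases) (auto simp: D_def)
  have DV: "\<exists>n<K N. x \<in> D N n" if xV: "x \<in> V' N" for x N
  proof -
    have ex: "\<exists>n. x \<in> F (N + n)" using xV by (auto simp: V'_def V_def)
    define n where "n = (LEAST n. x \<in> F (N + n))"
    have "x \<in> F (N + n)" unfolding n_def by (rule LeastI_ex[OF ex])
    moreover have "x \<notin> F (N + i)" if "i < n" for i using not_less_Least[of i] that unfolding n_def by blast
    moreover obtain m where "m < K N" "x \<in> F (N + m)" using xV by (auto simp: V'_def V_def)
    then have "n < K N" using Least_le[of "\<lambda>n. x \<in> F (N + n)" m] unfolding n_def by simp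
    ultimately show ?thesis by (auto simp: D_def)
  qed
  have D_sub: "D N n \<subseteq> V' N" if "n < K N" for N n using that by (auto simp: D_def V'_def V_def)
  define W where "W N x = (\<Sum>n<K N. indicator (D N n) x * Hs (N + n) x) + indicator (space M - V' N) x * H x" for N x
  have W: "W N \<in> Linf M C" for N
    unfolding W_def by (intro Linf_add Linf_sum EH D cV' Hs H)
  have W_D: "W N x = Hs (N + n) x" if "x \<in> D N n" "n < K N" for N n x
  proof -
    have "x \<notin> D N m" if "m \<noteq> n" for m using Ddis[OF \<open>x \<in> D N n\<close>, of m] that by blast
    then have "(\<Sum>m<K N. indicator (D N m) x * Hs (N + m) x) = (\<Sum>m<K N. if m = n then Hs (N + n) x else 0)"
      using that by (intro sum.cong) auto
    moreover have "x \<in> V' N" using D_sub that by blast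
    ultimately show ?thesis using that by (simp add: W_def)
  qed
  have W_H: "W N x = H x" if "x \<in> space M - V' N" for N x
  proof -
    have "(\<Sum>m<K N. indicator (D N m) x * Hs (N + m) x) = (\<Sum>m<K N. 0)"
    proof (rule sum.cong)
      fix m assume "m \<in> {..<K N}"
      then have "x \<notin> D N m" using D_sub[of m N] that by blast
      then show "indicator (D N m) x * Hs (N + m) x = 0" by simp
    qed simp
    then show ?thesis using that by (simp add: W_def)
  qed
  have W_cases: "W N x = H x \<or> (\<exists>n. W N x = Hs (N + n) x)" if "x \<in> space M" for N x
    using DV[of x N] W_D[of x N] W_H[of x N] that by blast
  have "AE x in M. (\<lambda>N. \<phi> (W N) x) \<longlonglongrightarrow> \<phi> H x"
  proof (rule phi_convergence[OF W H])
    have "AE x in M. \<forall>n. \<bar>Hs n x\<bar> \<le> b" using b by (simp add: AE_all_countable)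
    with b' AE_space show "AE x in M. \<bar>W N x\<bar> \<le> max b b'" for N
    proof eventually_elim
      case (elim x)
      from W_cases[OF elim(2), of N] elim show ?case by (auto simp: le_max_iff_disj)
    qed
    show "AE x in M. (\<lambda>N. W N x) \<longlonglongrightarrow> H x"
      using lim AE_space
    proof eventually_elim
      case (elim x)
      show ?case
      proof (rule LIMSEQ_I)
        fix r :: real assume "0 < r"
        from LIMSEQ_D[OF elim(1) this] obtain N0 where N0: "\<And>n. n \<ge> N0 \<Longrightarrow> norm (Hs n x - H x) < r" by blast
        have "norm (W N x - H x) < r" if "N \<ge> N0" for N
          using W_cases[OF elim(2), of N]
        proof
          assume "\<exists>n. W N x = Hs (N + n) x"
          then obtain n where "W N x = Hs (N + n) x" ..
          then show ?thesis using N0[of "N + n"] that by simp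
        qed (use \<open>0 < r\<close> in simp)
        then show "\<exists>N0. \<forall>N\<ge>N0. norm (W N x - H x) < r" by blast
      qed
    qed
  qed
  then have lim_W: "AE x in Q. (\<lambda>N. \<phi> (W N) x) \<longlonglongrightarrow> \<phi> H x" by (simp add: AE_Q)
  \<comment> \<open>\<open>Z N\<close> is the conditional probability of the glued region. A drop by
    \<open>\<epsilon>\<close> there gives
    \<open>\<epsilon> * Z N x \<le> \<phi> H x - \<phi> (W N) x\<close>, and continuity of
    \<open>\<phi>\<close> sends the right side to zero.\<close>
  define Z where "Z N = real_cond_exp Q A (indicator (V' N))" for N
  have iV: "integrable Q (indicator (V' N) :: 'a \<Rightarrow> real)" for N
    by (intro LinfG_integrable Linf_indicator V')
  have PsiW: "AE x in M. \<Psi> (W N) x \<le> \<Psi> H x - \<epsilon> * indicator (V' N) x" for N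
  proof -
    have "AE x in M. \<forall>n. n < K N \<longrightarrow> x \<in> D N n \<longrightarrow> \<Psi> (W N) x = \<Psi> (Hs (N + n)) x"
      unfolding AE_all_countable
    proof
      fix n show "AE x in M. n < K N \<longrightarrow> x \<in> D N n \<longrightarrow> \<Psi> (W N) x = \<Psi> (Hs (N + n)) x"
      proof (cases "n < K N")
        case True
        then show ?thesis using Psi_cong_on[OF D W Hs] W_D by simp
      qed simp
    qed
    moreover have "AE x in M. x \<in> space M - V' N \<longrightarrow> \<Psi> (W N) x = \<Psi> H x"
      by (rule Psi_cong_on[OF cV' W H W_H])
    ultimately show ?thesis using AE_space
    proof eventually_elim
      case (elim x)
      show ?case
      proof (cases "x \<in> V' N")
        case True
        then obtain n where n: "n < K N" "x \<in> D N n" using DV by blast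
        then have "\<Psi> (Hs (N + n)) x \<le> \<Psi> H x - \<epsilon>" by (auto simp: D_def F_def)
        with elim n True show ?thesis by simp
      next
        case False
        with elim show ?thesis by simp
      qed
    qed
  qed
  have Zle: "AE x in Q. \<epsilon> * Z N x \<le> \<phi> H x - \<phi> (W N) x" for N
  proof -
    have i1: "integrable Q (\<lambda>x. \<epsilon> * indicator (V' N) x)" using iV by simp
    have i2: "integrable Q (\<lambda>x. \<Psi> H x - \<epsilon> * indicator (V' N) x)"
      using LinfG_integrable[OF PL(1)] i1 by simp
    have "AE x in Q. real_cond_exp Q A (\<Psi> (W N)) x \<le> real_cond_exp Q A (\<lambda>x. \<Psi> H x - \<epsilon> * indicator (V' N) x) x"
      by (intro QA.real_cond_exp_mono LinfG_integrable Psi_Linf W i2) (simp add: AE_Q PsiW)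
    moreover have "AE x in Q. real_cond_exp Q A (\<lambda>x. \<Psi> H x - \<epsilon> * indicator (V' N) x) x
      = real_cond_exp Q A (\<Psi> H) x - real_cond_exp Q A (\<lambda>x. \<epsilon> * indicator (V' N) x) x"
      by (intro QA.real_cond_exp_diff LinfG_integrable PL i1)
    moreover have "AE x in Q. real_cond_exp Q A (\<lambda>x. \<epsilon> * indicator (V' N) x) x = \<epsilon> * Z N x"
      unfolding Z_def by (intro QA.real_cond_exp_cmult iV)
    ultimately show ?thesis
      using cond_exp_Psi_space[OF H, folded AE_Q] cond_exp_Psi_space[OF W, of N, folded AE_Q]
      by eventually_elim simp
  qed
  have Z0: "AE x in Q. 0 \<le> Z N x" for N
    unfolding Z_def using iV by (intro QA.real_cond_exp_pos) auto
  have Z1: "AE x in Q. Z N x \<le> 1" for N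
    unfolding Z_def by (intro QA.real_cond_exp_le_c iV) (auto split: split_indicator)
  have "AE x in Q. \<forall>N. \<epsilon> * Z N x \<le> \<phi> H x - \<phi> (W N) x \<and> 0 \<le> Z N x"
    unfolding AE_all_countable using Zle Z0 by simp
  with lim_W have "AE x in Q. (\<lambda>N. Z N x) \<longlonglongrightarrow> 0"
  proof eventually_elim
    case (elim x)
    have "(\<lambda>N. (\<phi> H x - \<phi> (W N) x) / \<epsilon>) \<longlonglongrightarrow> (\<phi> H x - \<phi> H x) / \<epsilon>"
      using elim(1) \<open>0 < \<epsilon>\<close> by (intro tendsto_intros) auto
    then have l: "(\<lambda>N. (\<phi> H x - \<phi> (W N) x) / \<epsilon>) \<longlonglongrightarrow> 0" by simp
    have "norm (Z N x) \<le> (\<phi> H x - \<phi> (W N) x) / \<epsilon>" for N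
      using elim(2) \<open>0 < \<epsilon>\<close> by (simp add: field_simps)
    then show ?case by (intro Lim_null_comparison[OF _ l]) auto
  qed
  moreover have "AE x in Q. norm (Z N x) \<le> 1" for N
    using Z0[of N] Z1[of N] by eventually_elim simp
  ultimately have "(\<lambda>N. \<integral>x. Z N x \<partial>Q) \<longlonglongrightarrow> (\<integral>x. 0 \<partial>Q)"
    by (intro integral_dominated_convergence[where w = "\<lambda>_. 1"]) (auto simp: Z_def)
  moreover have "(\<integral>x. Z N x \<partial>Q) = Q.prob (V' N)" for N
    unfolding Z_def QA.real_cond_exp_int(2)[OF iV] using GQ[OF V'[of N]]
    by (simp add: Int_absorb2 sets.sets_into_space)
  ultimately have "(\<lambda>N. Q.prob (V' N)) \<longlonglongrightarrow> 0" by simp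
  then have "(\<lambda>N. Q.prob (V' N) + (1/2)^N) \<longlonglongrightarrow> 0 + 0"
    by (intro tendsto_add LIMSEQ_power_zero) auto
  moreover have "Q.prob (\<Inter>N. U N) \<le> Q.prob (V' N) + (1/2)^N" for N
  proof -
    have "Q.prob (\<Inter>N. U N) \<le> Q.prob (U N)" using GQ[OF U] by (intro Q.finite_measure_mono) auto
    also have "\<dots> \<le> Q.prob (V' N) + (1/2)^N" using K[of N] by (simp add: V'_def)
    finally show ?thesis .
  qed
  ultimately have "Q.prob (\<Inter>N. U N) \<le> 0 + 0" by (intro LIMSEQ_le_const) auto
  then have "(\<Inter>N. U N) \<in> null_sets Q"
    using GQ[OF U] by (auto simp: null_sets_def Q.emeasure_eq_measure measure_le_0_iff)
  then have "AE x in M. x \<notin> (\<Inter>N. U N)" unfolding null_Q by (rule AE_not_in)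
  then show ?thesis using AE_space
  proof eventually_elim
    case (elim x)
    then obtain N where N: "\<And>n. x \<notin> F (N + n)" by (auto simp: U_def)
    have "\<Psi> H x - \<epsilon> < \<Psi> (Hs n) x" if "N \<le> n" for n
      using N[of "n - N"] that elim by (simp add: F_def spG not_le)
    then show ?case by (auto simp: eventually_sequentially)
  qed
qed

text \<open>Upper estimates survive bounded almost-sure limits of claims because
  \<open>\<Psi>\<close> cannot jump upwards in the limit. The levels \<open>1 / real (Suc j)\<close>
  allow all tolerances on one common set of full measure.\<close>

lemma Psi_le_if_tendsto:
  assumes conv: "bounded_ae_conv M C Hs H" and le: "\<And>n. AE x in M. \<Psi> (Hs n) x \<le> L n x"
    and lim: "AE x in M. (\<lambda>n. L n x) \<longlonglongrightarrow> L' x"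
  shows "AE x in M. \<Psi> H x \<le> L' x"
proof -
  have "AE x in M. \<forall>j::nat. \<forall>\<^sub>F n in sequentially. \<Psi> H x - 1 / real (Suc j) < \<Psi> (Hs n) x"
    unfolding AE_all_countable by (intro allI Psi_eventually_gt[OF conv]) simp
  moreover have "AE x in M. \<forall>n. \<Psi> (Hs n) x \<le> L n x" using le by (simp add: AE_all_countable)
  ultimately show ?thesis using lim
  proof eventually_elim
    case (elim x)
    have "\<Psi> H x - 1 / real (Suc j) \<le> L' x" for j
    proof (rule tendsto_lowerbound[OF elim(3)])
      show "\<forall>\<^sub>F n in sequentially. \<Psi> H x - 1 / real (Suc j) \<le> L n x"
        using spec[OF elim(1), of j] by eventually_elim (use elim(2) in \<open>meson le_less_trans less_imp_le less_le_trans\<close>)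
    qed simp
    moreover have "(\<lambda>j. \<Psi> H x - 1 / real (Suc j)) \<longlonglongrightarrow> \<Psi> H x - 0"
      by (intro tendsto_intros LIMSEQ_Suc lim_1_over_n)
    ultimately have "\<Psi> H x - 0 \<le> L' x" by (intro LIMSEQ_le_const2) auto
    then show ?case by simp
  qed
qed

lemma Psi_lsc:
  assumes conv: "bounded_ae_conv M C Hs H"
  shows "AE x in M. ereal (\<Psi> H x) \<le> liminf (\<lambda>n. ereal (\<Psi> (Hs n) x))"
proof -
  have "AE x in M. \<forall>j::nat. \<forall>\<^sub>F n in sequentially. \<Psi> H x - 1 / real (Suc j) < \<Psi> (Hs n) x"
    unfolding AE_all_countable by (intro allI Psi_eventually_gt[OF conv]) simp
  then show ?thesis
  proof eventually_elim
    case (elim x)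
    have le: "ereal (\<Psi> H x - 1 / real (Suc j)) \<le> liminf (\<lambda>n. ereal (\<Psi> (Hs n) x))" for j
      by (rule Liminf_bounded) (use spec[OF elim, of j] in \<open>auto elim!: eventually_mono\<close>)
    have "(\<lambda>j. ereal (\<Psi> H x - 1 / real (Suc j))) \<longlonglongrightarrow> ereal (\<Psi> H x - 0)"
      by (intro tendsto_intros LIMSEQ_Suc lim_1_over_n)
    from LIMSEQ_le_const2[OF this] le have "ereal (\<Psi> H x - 0) \<le> liminf (\<lambda>n. ereal (\<Psi> (Hs n) x))"
      by blast
    then show ?case by simp
  qed
qed

text \<open>The weight is rounded down to finitely many values. On each level set locality reduces
  to a constant weight, and \<open>Psi_le_if_tendsto\<close> carries the inequality to the
  limit.\<close>

lemma Psi_convex: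
  assumes H: "H \<in> Linf M C" "K \<in> Linf M C" and l: "l \<in> Linf M G" and l01: "AE x in M. 0 \<le> l x \<and> l x \<le> 1"
  shows "AE x in M. \<Psi> (\<lambda>x. l x * H x + (1 - l x) * K x) x \<le> l x * \<Psi> H x + (1 - l x) * \<Psi> K x"
proof -
  \<comment> \<open>Rounding down to multiples of \<open>1 / real (Suc n)\<close>. Clamping to the
    unit interval gives bounds valid at every point, whereas \<open>l\<close> obeys them only almost
    surely.\<close>
  define g where "g n t = real_of_int \<lfloor>real (Suc n) * max 0 (min 1 t)\<rfloor> / real (Suc n)" for n and t :: real
  have g_le: "g n t \<le> max 0 (min 1 t)" for n t
    by (simp add: g_def divide_le_eq mult.commute del: of_nat_Suc)
  have g_ge: "max 0 (min 1 t) - 1 / real (Suc n) \<le> g n t" for n t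
  proof -
    have "real (Suc n) * max 0 (min 1 t) - 1 \<le> real_of_int \<lfloor>real (Suc n) * max 0 (min 1 t)\<rfloor>" by linarith
    then have "(real (Suc n) * max 0 (min 1 t) - 1) / real (Suc n) \<le> g n t"
      unfolding g_def by (intro divide_right_mono) auto
    then show ?thesis by (simp add: diff_divide_distrib del: of_nat_Suc)
  qed
  have g01: "0 \<le> g n t" "g n t \<le> 1" for n t
    using order_trans[OF g_le[of n t], of 1] by (simp_all add: g_def del: of_nat_Suc)
  have [measurable]: "l \<in> borel_measurable G" using l by (auto simp: Linf_def)
  have gm: "(\<lambda>x. g n (l x)) \<in> borel_measurable G" for n unfolding g_def by measurable
  have gL: "(\<lambda>x. g n (l x)) \<in> Linf M G" for n
    using gm g01 unfolding Linf_def by (auto intro!: exI[of _ 1])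
  define W where "W n x = g n (l x) * H x + (1 - g n (l x)) * K x" for n x
  have W: "W n \<in> Linf M C" for n
    unfolding W_def by (intro Linf_add Linf_mult Linf_diff Linf_const H LinfG_C gL)
  have W0: "(\<lambda>x. l x * H x + (1 - l x) * K x) \<in> Linf M C"
    by (intro Linf_add Linf_mult Linf_diff Linf_const H LinfG_C l)
  have g_lim: "(\<lambda>n. g n t) \<longlonglongrightarrow> t" if "0 \<le> t" "t \<le> 1" for t
  proof (rule tendsto_sandwich)
    show "\<forall>\<^sub>F n in sequentially. t - 1 / real (Suc n) \<le> g n t"
      using g_ge[of t] that by (intro always_eventually allI) (simp add: max_def min_def)
    show "\<forall>\<^sub>F n in sequentially. g n t \<le> t"
      using g_le[of _ t] that by (intro always_eventually allI) (simp add: max_def min_def)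
    have "(\<lambda>n. t - 1 / real (Suc n)) \<longlonglongrightarrow> t - 0" by (intro tendsto_intros LIMSEQ_Suc lim_1_over_n)
    then show "(\<lambda>n. t - 1 / real (Suc n)) \<longlonglongrightarrow> t" by simp
  qed simp
  obtain b b' where b: "AE x in M. \<bar>H x\<bar> \<le> b" "AE x in M. \<bar>K x\<bar> \<le> b'" using H by (auto simp: Linf_def)
  have "AE x in M. \<bar>W n x\<bar> \<le> b + b'" for n
    using b
  proof eventually_elim
    case (elim x)
    have "\<bar>W n x\<bar> \<le> \<bar>g n (l x) * H x\<bar> + \<bar>(1 - g n (l x)) * K x\<bar>" unfolding W_def by (rule abs_triangle_ineq)
    also have "\<dots> \<le> 1 * \<bar>H x\<bar> + 1 * \<bar>K x\<bar>"
      unfolding abs_mult using g01[of n "l x"] by (intro add_mono mult_right_mono) auto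
    finally show ?case using elim by simp
  qed
  moreover have "AE x in M. (\<lambda>n. W n x) \<longlonglongrightarrow> l x * H x + (1 - l x) * K x"
    using l01 unfolding W_def by eventually_elim (intro tendsto_intros g_lim; simp)
  ultimately have conv: "bounded_ae_conv M C W (\<lambda>x. l x * H x + (1 - l x) * K x)"
    unfolding bounded_ae_conv_def using W W0 by blast
  show ?thesis
  proof (rule Psi_le_if_tendsto[OF conv])
    fix n
    define E where "E k = {x \<in> space G. \<lfloor>real (Suc n) * max 0 (min 1 (l x))\<rfloor> = int k}" for k
    have E: "E k \<in> sets G" for k unfolding E_def by measurable
    have "AE x in M. \<forall>k. x \<in> E k \<longrightarrow> \<Psi> (W n) x \<le> g n (l x) * \<Psi> H x + (1 - g n (l x)) * \<Psi> K x"
      unfolding AE_all_countable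
    proof
      fix k
      define r where "r = real k / real (Suc n)"
      have r: "g n (l x) = r" if "x \<in> E k" for x using that by (simp add: E_def g_def r_def)
      show "AE x in M. x \<in> E k \<longrightarrow> \<Psi> (W n) x \<le> g n (l x) * \<Psi> H x + (1 - g n (l x)) * \<Psi> K x"
      proof (cases "r \<le> 1")
        case True
        have rW: "(\<lambda>x. r * H x + (1 - r) * K x) \<in> Linf M C" by (intro Linf_add Linf_cmult H)
        have "AE x in M. x \<in> E k \<longrightarrow> \<Psi> (W n) x = \<Psi> (\<lambda>x. r * H x + (1 - r) * K x) x"
          by (rule Psi_cong_on[OF E W rW]) (simp add: W_def r)
        moreover have "AE x in M. \<Psi> (\<lambda>x. r * H x + (1 - r) * K x) x \<le> r * \<Psi> H x + (1 - r) * \<Psi> K x"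
          by (rule Psi_convex_const[OF _ True H]) (simp add: r_def)
        ultimately show ?thesis by eventually_elim (simp add: r)
      next
        case False
        \<comment> \<open>The index \<open>k\<close> ranges over all naturals, but a rounded weight
          never exceeds 1.\<close>
        have "E k = {}" using r g01(2)[of n "l _"] False by fastforce
        then show ?thesis by simp
      qed
    qed
    then show "AE x in M. \<Psi> (W n) x \<le> g n (l x) * \<Psi> H x + (1 - g n (l x)) * \<Psi> K x"
      using AE_space
    proof eventually_elim
      case (elim x)
      have "x \<in> E (nat \<lfloor>real (Suc n) * max 0 (min 1 (l x))\<rfloor>)" using elim(2) by (simp add: E_def spG)
      with elim(1) show ?case by blast
    qed
  next
    show "AE x in M. (\<lambda>n. g n (l x) * \<Psi> H x + (1 - g n (l x)) * \<Psi> K x) \<longlonglongrightarrow> l x * \<Psi> H x + (1 - l x) * \<Psi> K x"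
      using l01 by eventually_elim (intro tendsto_intros g_lim; simp)
  qed
qed

text \<open>The domain may be any sigma-algebra between \<open>G\<close> and \<open>C\<close>; in
  the application it is the information at the next jump, while \<open>\<phi>\<close> is defined on
  all terminal claims.\<close>

lemma cond_evaluation_Psi:
  assumes B: "sets G \<subseteq> sets B" "sets B \<subseteq> sets C" "space B = space M"
  shows "cond_evaluation M G B \<Psi>"
proof -
  have BC: "H \<in> Linf M C" if "H \<in> Linf M B" for H
    by (rule Linf_mono[OF B(2) _ that]) (simp add: B spC)
  have "AE x in M. \<Psi> (\<lambda>_. 0) x = 0"
    using Psi_indicator[of "{}" "\<lambda>_. 0"] by (simp add: Linf_const)
  then show ?thesis
    unfolding cond_evaluation_def
  proof (intro conjI ballI allI impI)
    show "subalgebra M B" "subalgebra B G" using B subC spG by (auto simp: subalgebra_def)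
  next
    fix Hs H assume "bounded_ae_conv M B Hs H"
    then have "bounded_ae_conv M C Hs H" unfolding bounded_ae_conv_def using BC by simp
    then show "AE x in M. ereal (\<Psi> H x) \<le> liminf (\<lambda>n. ereal (\<Psi> (Hs n) x))" by (rule Psi_lsc)
  next
    fix H m assume "H \<in> Linf M B" "m \<in> Linf M G"
    then show "AE x in M. \<Psi> (\<lambda>x. H x + m x) x = \<Psi> H x + m x" by (intro Psi_add BC)
  next
    fix H K l assume "H \<in> Linf M B" "K \<in> Linf M B" "l \<in> Linf M G" "AE x in M. 0 \<le> l x \<and> l x \<le> 1"
    then show "AE x in M. \<Psi> (\<lambda>x. l x * H x + (1 - l x) * K x) x \<le> l x * \<Psi> H x + (1 - l x) * \<Psi> K x"
      by (intro Psi_convex BC)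
  next
    fix H K E assume "H \<in> Linf M B" "K \<in> Linf M B" "E \<in> sets G"
    then show "AE x in M. \<Psi> (\<lambda>x. indicator E x * H x + indicator (space M - E) x * K x) x
        = indicator E x * \<Psi> H x + indicator (space M - E) x * \<Psi> K x"
      by (intro Psi_local BC)
  qed (auto intro: Psi_Linf BC)
qed

end

section \<open>Stopping times of a complete filtration\<close>

text \<open>The sets whose trace on \<open>Z\<close> lies in \<open>N\<close> are closed under
  complements, as \<open>Z\<close> itself is in \<open>N\<close>. Inclusions of sigma-algebras can
  so be checked on generators locally on \<open>Z\<close>.\<close>

lemma sigma_sets_Int_trace:
  assumes a: "a \<in> sigma_sets \<Omega> \<A>" and Z: "Z \<in> sets N" "Z \<subseteq> \<Omega>"
    and gen: "\<And>a. a \<in> \<A> \<Longrightarrow> a \<inter> Z \<in> sets N"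
  shows "a \<inter> Z \<in> sets N"
  using a
proof induction
  case (Compl a)
  have "(\<Omega> - a) \<inter> Z = Z - a \<inter> Z" using Z(2) by auto
  then show ?case using Compl.IH Z(1) by auto
next
  case (Union a)
  have "(\<Union>i. a i) \<inter> Z = (\<Union>i. a i \<inter> Z)" by auto
  then show ?case using Union.IH by (metis sets.countable_UN image_subsetI)
qed (use gen in auto)

section \<open>Joined sigma-algebras and generated filtrations\<close>

lemma space_join_sigma: "space (join_sigma M A B) = space M"
  by (simp add: join_sigma_def space_measure_of_conv)

lemma sets_join_sigma:
  "space A = space M \<Longrightarrow> space B = space M \<Longrightarrow> sets (join_sigma M A B) = sigma_sets (space M) (sets A \<union> sets B)"
  unfolding join_sigma_def by (rule sets_measure_of) (metis Un_least sets.space_closed)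

lemma sets_join_sigma_least:
  assumes "space A = space M" "space B = space M" "space N = space M" "sets A \<subseteq> sets N" "sets B \<subseteq> sets N"
  shows "sets (join_sigma M A B) \<subseteq> sets N"
  unfolding sets_join_sigma[OF assms(1,2)] using assms
  by (metis Un_least sets.sigma_sets_subset)

lemma sets_join_sigma_upper:
  assumes "space A = space M" "space B = space M"
  shows "sets A \<subseteq> sets (join_sigma M A B)" "sets B \<subseteq> sets (join_sigma M A B)"
  unfolding sets_join_sigma[OF assms] by (auto intro: sigma_sets.Basic)

lemma space_gen_filtration: "space (gen_filtration M T X t) = space M"
  by (simp add: gen_filtration_def space_measure_of_conv)

lemma sets_gen_filtration: "sets (gen_filtration M T X t) = sigma_sets (space M)
     ({X u -` B \<inter> space M | u B. 0 \<le> u \<and> u \<le> T \<and> u \<le> t \<and> B \<in> sets borel} \<union> null_sets M)"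
  unfolding gen_filtration_def
  by (rule sets_measure_of) (use sets.sets_into_space in \<open>auto simp: null_sets_def\<close>)

text \<open>Generators use times up to \<open>T\<close> only, so the filtration is constant from
  \<open>T\<close> on. The bound \<open>min s T\<close> covers indices beyond the horizon.\<close>

lemma sets_gen_filtration_mono:
  assumes "min s T \<le> t"
  shows "sets (gen_filtration M T X s) \<subseteq> sets (gen_filtration M T X t)"
  unfolding sets_gen_filtration
proof (intro sigma_sets_mono' Un_mono order_refl subsetI)
  fix A assume "A \<in> {X u -` B \<inter> space M |u B. 0 \<le> u \<and> u \<le> T \<and> u \<le> s \<and> B \<in> sets borel}"
  then obtain u B where A: "A = X u -` B \<inter> space M" "0 \<le> u" "u \<le> T" "u \<le> s" "B \<in> sets borel" by blast
  then have "u \<le> t" using assms by linarith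
  with A show "A \<in> {X u -` B \<inter> space M |u B. 0 \<le> u \<and> u \<le> T \<and> u \<le> t \<and> B \<in> sets borel}" by blast
qed

lemma sets_gen_filtration_subset:
  assumes "\<And>u. u \<in> {0..T} \<Longrightarrow> X u \<in> borel_measurable M"
  shows "sets (gen_filtration M T X t) \<subseteq> sets M"
  unfolding sets_gen_filtration
  by (intro sets.sigma_sets_subset) (auto intro: measurable_sets[OF assms] simp: null_sets_def)

lemma null_sets_gen_filtration: "null_sets M \<subseteq> sets (gen_filtration M T X t)"
  unfolding sets_gen_filtration by (auto intro: sigma_sets.Basic)

lemma filtration_gen_filtration: "filtration (space M) (gen_filtration M T X)"
  by unfold_locales (auto simp: space_gen_filtration intro: sets_gen_filtration_mono[THEN subsetD, rotated])

lemma gen_filtration_vimage: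
  "0 \<le> u \<Longrightarrow> u \<le> T \<Longrightarrow> u \<le> t \<Longrightarrow> B \<in> sets borel \<Longrightarrow> X u -` B \<inter> space M \<in> sets (gen_filtration M T X t)"
  unfolding sets_gen_filtration by (intro sigma_sets.Basic) blast

text \<open>Every \<open>F t\<close> contains all null sets, and subsets of null sets are
  measurable. This permits stopping times and events to be altered on null sets.\<close>

locale complete_filtration = prob_space M + complete_measure M + filtration "space M" F
  for M :: "'a measure" and F :: "real \<Rightarrow> 'a measure" +
  fixes T :: real
  assumes T_pos: "0 < T" and F_sub: "\<And>t. sets (F t) \<subseteq> sets M" and F_null: "\<And>t. null_sets M \<subseteq> sets (F t)"
begin

abbreviation "\<S> \<equiv> stopping_times M T F"

text \<open>The two differences of \<open>A\<close> and \<open>B\<close> lie inside a null set,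
  hence are null by completeness and belong to \<open>N\<close>; no measurability of
  \<open>B\<close> is presupposed.\<close>

lemma AE_eq_sets:
  assumes A: "A \<in> sets N" and N: "null_sets M \<subseteq> sets N" and B: "B \<subseteq> space M"
    and eq: "AE x in M. x \<in> A \<longleftrightarrow> x \<in> B" and AM: "A \<subseteq> space M"
  shows "B \<in> sets N"
proof -
  from eq obtain Z where Z: "{x\<in>space M. \<not> (x \<in> A \<longleftrightarrow> x \<in> B)} \<subseteq> Z" "Z \<in> null_sets M"
    by (auto simp: eventually_ae_filter)
  have nul: "D \<in> null_sets M" if "D \<subseteq> Z" for D
    using complete[OF that Z(2)] null_sets_subset[OF Z(2) _ that] by simp
  have "A - B \<in> null_sets M" "B - A \<in> null_sets M"
    by (rule nul; use Z(1) B AM in blast)+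
  moreover have "B = (A - (A - B)) \<union> (B - A)" by auto
  ultimately show ?thesis using A N by (metis sets.Diff sets.Un subsetD)
qed

lemma AE_eq_measurable:
  assumes g: "g \<in> measurable N L" and N: "null_sets M \<subseteq> sets N" "space N = space M" and eq: "AE x in M. f x = g x"
    and f: "\<And>x. x \<in> space M \<Longrightarrow> f x \<in> space L"
  shows "f \<in> measurable N L"
proof (rule measurableI)
  fix B assume "B \<in> sets L"
  then have "g -` B \<inter> space N \<in> sets N" by (rule measurable_sets[OF g])
  then show "f -` B \<inter> space N \<in> sets N"
    by (rule AE_eq_sets) (use N eq in \<open>auto elim!: eventually_mono\<close>)
qed (use f N in auto)

lemma AE_limit_measurable:
  fixes f :: "nat \<Rightarrow> 'a \<Rightarrow> 'b::metric_space"
  assumes f: "\<And>n. f n \<in> borel_measurable N" and N: "null_sets M \<subseteq> sets N" "space N = space M"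
    and lim: "AE x in M. (\<lambda>n. f n x) \<longlonglongrightarrow> g x"
  shows "g \<in> borel_measurable N"
proof -
  from lim obtain Z where Z: "{x\<in>space M. \<not> (\<lambda>n. f n x) \<longlonglongrightarrow> g x} \<subseteq> Z" "Z \<in> null_sets M"
    by (auto simp: eventually_ae_filter)
  have ZN: "Z \<in> sets N" using Z N by auto
  \<comment> \<open>A fixed value on the exceptional set makes the convergence hold everywhere, as
    the pointwise limit theorem requires.\<close>
  define h where "h x = (if x \<in> Z then undefined else g x)" for x
  have "h \<in> borel_measurable N"
  proof (rule borel_measurable_LIMSEQ_metric)
    show "(\<lambda>x. if x \<in> Z then undefined else f n x) \<in> borel_measurable N" for n
      using f ZN by (intro measurable_If_set) auto
    show "(\<lambda>n. if x \<in> Z then undefined else f n x) \<longlonglongrightarrow> h x" if "x \<in> space N" for x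
      using that Z(1) N(2) by (auto simp: h_def)
  qed
  then show ?thesis
    by (rule AE_eq_measurable[OF _ N]) (use AE_not_in[OF Z(2)] in \<open>auto simp: h_def elim!: eventually_mono\<close>)
qed

lemma stopping_timesD:
  assumes "\<sigma> \<in> \<S>"
  shows "stopping_time F \<sigma>" "x \<in> space M \<Longrightarrow> 0 \<le> \<sigma> x" "x \<in> space M \<Longrightarrow> \<sigma> x \<le> T"
  using assms by (auto simp: stopping_times_def)

lemma stopping_timesI:
  assumes "\<And>t. {x\<in>space M. \<sigma> x \<le> t} \<in> sets (F t)" "\<And>x. x \<in> space M \<Longrightarrow> 0 \<le> \<sigma> x \<and> \<sigma> x \<le> T"
  shows "\<sigma> \<in> \<S>"
  using assms by (auto simp: stopping_times_def stopping_time_def pred_def space_F)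

lemma le_sets: "\<sigma> \<in> \<S> \<Longrightarrow> {x\<in>space M. \<sigma> x \<le> t} \<in> sets (F t)"
  using stopping_timeD[OF stopping_timesD(1)] by (simp add: pred_def space_F)

lemma sets_pre_iff:
  "\<sigma> \<in> \<S> \<Longrightarrow> A \<in> sets (pre_sigma \<sigma>) \<longleftrightarrow> (\<forall>t. {x\<in>A. \<sigma> x \<le> t} \<in> sets (F t))"
  using sets_pre_sigma[OF stopping_timesD(1)] by simp

lemma pre_sigma_sub_F_T: "\<sigma> \<in> \<S> \<Longrightarrow> sets (pre_sigma \<sigma>) \<subseteq> sets (F T)"
proof
  fix A assume s: "\<sigma> \<in> \<S>" and A: "A \<in> sets (pre_sigma \<sigma>)"
  then have "A \<subseteq> space M" using sets.sets_into_space[OF A] by (simp add: space_pre_sigma)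
  then have "{x\<in>A. \<sigma> x \<le> T} = A" using stopping_timesD(3)[OF s] by auto
  then show "A \<in> sets (F T)" using A sets_pre_iff[OF s] by metis
qed

lemma pre_sigma_sub: "\<sigma> \<in> \<S> \<Longrightarrow> sets (pre_sigma \<sigma>) \<subseteq> sets M"
  using pre_sigma_sub_F_T F_sub by blast

lemma pre_sigma_into_space: "A \<in> sets (pre_sigma \<sigma>) \<Longrightarrow> A \<subseteq> space M"
  using sets.sets_into_space[of A "pre_sigma \<sigma>"] by (simp add: space_pre_sigma)

lemma null_sets_pre_sigma: "\<sigma> \<in> \<S> \<Longrightarrow> null_sets M \<subseteq> sets (pre_sigma \<sigma>)"
proof
  fix A assume s: "\<sigma> \<in> \<S>" and A: "A \<in> null_sets M"
  have "{x\<in>A. \<sigma> x \<le> t} \<in> null_sets M" for t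
    using complete[OF _ A, of "{x\<in>A. \<sigma> x \<le> t}"] null_sets_subset[OF A] by auto
  then show "A \<in> sets (pre_sigma \<sigma>)" using F_null sets_pre_iff[OF s] by auto
qed

text \<open>Local comparison: on \<open>A\<close> the event \<open>\<tau> x \<le> r\<close> almost
  surely entails \<open>\<sigma> x \<le> r\<close>, so the two conditions may be intersected.
  Comparing times only on \<open>A\<close> is what pasting constructions need.\<close>

lemma pre_sigma_le_on:
  assumes s: "\<sigma> \<in> \<S>" and t: "\<tau> \<in> \<S>"
    and A: "A \<in> sets (pre_sigma \<sigma>)" and le: "AE x in M. x \<in> A \<longrightarrow> \<sigma> x \<le> \<tau> x"
  shows "A \<in> sets (pre_sigma \<tau>)"
  unfolding sets_pre_iff[OF t]
proof
  fix r
  have "{x\<in>A. \<sigma> x \<le> r} \<inter> {x\<in>space M. \<tau> x \<le> r} \<in> sets (F r)"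
    using A le_sets[OF t] unfolding sets_pre_iff[OF s] by auto
  then show "{x\<in>A. \<tau> x \<le> r} \<in> sets (F r)"
  proof (rule AE_eq_sets[OF _ F_null])
    show "AE x in M. x \<in> {x \<in> A. \<sigma> x \<le> r} \<inter> {x \<in> space M. \<tau> x \<le> r} \<longleftrightarrow> x \<in> {x \<in> A. \<tau> x \<le> r}"
      using le AE_space by eventually_elim auto
  qed (use pre_sigma_into_space[OF A] in auto)
qed

lemma pre_sigma_mono_AE:
  assumes "\<sigma> \<in> \<S>" "\<tau> \<in> \<S>" "AE x in M. \<sigma> x \<le> \<tau> x"
  shows "sets (pre_sigma \<sigma>) \<subseteq> sets (pre_sigma \<tau>)"
  using assms by (auto intro!: pre_sigma_le_on[OF assms(1,2)] elim!: eventually_mono)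

lemma less_in_pre_sigma:
  assumes s: "\<sigma> \<in> \<S>" and t: "\<tau> \<in> \<S>"
  shows "{x\<in>space M. \<sigma> x < \<tau> x} \<in> sets (pre_sigma \<sigma>)" "{x\<in>space M. \<sigma> x < \<tau> x} \<in> sets (pre_sigma \<tau>)"
proof -
  show 1: "{x\<in>space M. \<sigma> x < \<tau> x} \<in> sets (pre_sigma \<sigma>)"
    using stopping_time_less[OF stopping_timesD(1)[OF s] stopping_timesD(1)[OF t]]
    by (simp add: pred_def space_pre_sigma)
  show "{x\<in>space M. \<sigma> x < \<tau> x} \<in> sets (pre_sigma \<tau>)"
    by (rule pre_sigma_le_on[OF s t 1]) auto
qed

lemma le_in_pre_sigma:
  assumes s: "\<sigma> \<in> \<S>" and t: "\<tau> \<in> \<S>"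
  shows "{x\<in>space M. \<sigma> x \<le> \<tau> x} \<in> sets (pre_sigma \<sigma>)" "{x\<in>space M. \<sigma> x \<le> \<tau> x} \<in> sets (pre_sigma \<tau>)"
proof -
  have "{x\<in>space M. \<sigma> x \<le> \<tau> x} = space M - {x\<in>space M. \<tau> x < \<sigma> x}" by auto
  then show "{x\<in>space M. \<sigma> x \<le> \<tau> x} \<in> sets (pre_sigma \<sigma>)" "{x\<in>space M. \<sigma> x \<le> \<tau> x} \<in> sets (pre_sigma \<tau>)"
    using less_in_pre_sigma[OF t s] sets.compl_sets[of _ "pre_sigma \<sigma>"] sets.compl_sets[of _ "pre_sigma \<tau>"]
    by (simp_all add: space_pre_sigma)
qed

lemma stopping_times_max:
  assumes s: "\<sigma> \<in> \<S>" and t: "\<tau> \<in> \<S>"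
  shows "(\<lambda>x. max (\<sigma> x) (\<tau> x)) \<in> \<S>"
  using stopping_time_max[OF stopping_timesD(1)[OF s] stopping_timesD(1)[OF t]] s t
  by (auto simp: stopping_times_def le_max_iff_disj)

lemma stopping_times_const: "0 \<le> c \<Longrightarrow> c \<le> T \<Longrightarrow> (\<lambda>_. c) \<in> \<S>"
  using stopping_time_const[of F c] by (simp add: stopping_times_def)

text \<open>The event \<open>\<sigma> x \<le> t\<close> is the union of the events
  \<open>\<rho> k x \<le> t\<close> within \<open>D k\<close>, each known at \<open>t\<close>. A
  countable cover suffices; overlaps are harmless since the values agree there.\<close>

lemma stopping_times_patch:
  assumes \<rho>: "\<And>k::nat. \<rho> k \<in> \<S>" and D: "\<And>k. D k \<in> sets (pre_sigma (\<rho> k))"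
    and eq: "\<And>k x. x \<in> D k \<Longrightarrow> \<sigma> x = \<rho> k x" and cover: "space M \<subseteq> (\<Union>k. D k)"
  shows "\<sigma> \<in> \<S>"
proof (rule stopping_timesI)
  fix t
  have "{x\<in>space M. \<sigma> x \<le> t} = (\<Union>k. {x\<in>D k. \<rho> k x \<le> t})"
  proof (intro set_eqI iffI)
    fix x assume x: "x \<in> {x\<in>space M. \<sigma> x \<le> t}"
    then obtain k where "x \<in> D k" using cover by auto
    with x eq[OF this] show "x \<in> (\<Union>k. {x\<in>D k. \<rho> k x \<le> t})" by auto
  next
    fix x assume "x \<in> (\<Union>k. {x\<in>D k. \<rho> k x \<le> t})"
    then obtain k where "x \<in> D k" "\<rho> k x \<le> t" by auto
    then show "x \<in> {x\<in>space M. \<sigma> x \<le> t}" using eq[of x k] pre_sigma_into_space[OF D, of k] by auto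
  qed
  moreover have "{x\<in>D k. \<rho> k x \<le> t} \<in> sets (F t)" for k using D sets_pre_iff[OF \<rho>] by blast
  ultimately show "{x\<in>space M. \<sigma> x \<le> t} \<in> sets (F t)" by auto
next
  fix x assume x: "x \<in> space M"
  then obtain k where "x \<in> D k" using cover by auto
  then show "0 \<le> \<sigma> x \<and> \<sigma> x \<le> T" using eq stopping_timesD(2,3)[OF \<rho> x] by metis
qed

lemma stopping_times_AE_eq:
  assumes s: "\<sigma> \<in> \<S>" and eq: "AE x in M. \<sigma> x = \<tau> x"
    and bnd: "\<And>x. x \<in> space M \<Longrightarrow> 0 \<le> \<tau> x \<and> \<tau> x \<le> T"
  shows "\<tau> \<in> \<S>"
proof (rule stopping_timesI[OF _ bnd])
  fix t
  have "AE x in M. x \<in> {x\<in>space M. \<sigma> x \<le> t} \<longleftrightarrow> x \<in> {x\<in>space M. \<tau> x \<le> t}"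
    using eq by eventually_elim auto
  then show "{x\<in>space M. \<tau> x \<le> t} \<in> sets (F t)"
    by (rule AE_eq_sets[OF le_sets[OF s] F_null, rotated]) auto
qed

text \<open>The time grid approximates the stopping time from below, so that no right continuity of \<open>F\<close> is used.\<close>

lemma stopped_process_measurable:
  fixes S :: "real \<Rightarrow> 'a \<Rightarrow> 'b::metric_space"
  assumes r: "\<rho> \<in> \<S>" and u: "0 \<le> u" "u \<le> T"
    and adapted: "\<And>t B. 0 \<le> t \<Longrightarrow> t \<le> T \<Longrightarrow> B \<in> sets borel \<Longrightarrow> S t -` B \<inter> space M \<in> sets (F t)"
    and cont: "AE x in M. continuous_on {0..T} (\<lambda>t. S t x)"
  shows "(\<lambda>x. S (min u (\<rho> x)) x) \<in> borel_measurable (pre_sigma \<rho>)"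
proof -
  \<comment> \<open>Rounding down to the grid of mesh \<open>1 / real (Suc k)\<close>: the rounded
    time never exceeds the stopping time, so the process is read off at a time already past.\<close>
  define d where "d k s = real_of_int \<lfloor>s * real (Suc k)\<rfloor> / real (Suc k)" for k s
  have d_le: "d k s \<le> s" for k s
    by (simp add: d_def divide_le_eq del: of_nat_Suc)
  have d_ge: "s - 1 / real (Suc k) \<le> d k s" for k s
  proof -
    have "s * real (Suc k) - 1 \<le> real_of_int \<lfloor>s * real (Suc k)\<rfloor>" by linarith
    then have "(s * real (Suc k) - 1) / real (Suc k) \<le> d k s"
      unfolding d_def by (intro divide_right_mono) auto
    then show ?thesis by (simp add: diff_divide_distrib del: of_nat_Suc)
  qed
  have d_nonneg: "0 \<le> d k s" if "0 \<le> s" for k s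
    unfolding d_def using that by (intro divide_nonneg_nonneg) auto
  have d_lim: "(\<lambda>k. d k s) \<longlonglongrightarrow> s" for s
  proof (rule tendsto_sandwich[of "\<lambda>n. s - 1 / real (Suc n)" _ _ "\<lambda>_. s"])
    have "(\<lambda>n. s - 1 / real (Suc n)) \<longlonglongrightarrow> s - 0" by (intro tendsto_intros LIMSEQ_Suc lim_1_over_n)
    then show "(\<lambda>n. s - 1 / real (Suc n)) \<longlonglongrightarrow> s" by simp
  qed (use d_ge d_le in \<open>auto intro!: always_eventually simp del: of_nat_Suc\<close>)
  have rm: "\<rho> \<in> borel_measurable (pre_sigma \<rho>)"
    by (rule measurable_stopping_time_pre_sigma[OF stopping_timesD(1)[OF r]])
  have hm: "(\<lambda>x. S (d k (min u (\<rho> x))) x) \<in> borel_measurable (pre_sigma \<rho>)" for k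
  proof (rule measurableI)
    fix B :: "'b set" assume B: "B \<in> sets borel"
    define C where "C j = {x\<in>space M. \<lfloor>min u (\<rho> x) * real (Suc k)\<rfloor> = int j}" for j
    define q where "q j = real j / real (Suc k)" for j
    have C: "C j \<in> sets (pre_sigma \<rho>)" for j
    proof -
      have "{x\<in>space (pre_sigma \<rho>). \<lfloor>min u (\<rho> x) * real (Suc k)\<rfloor> = int j} \<in> sets (pre_sigma \<rho>)"
        using rm by measurable
      then show ?thesis by (simp add: C_def space_pre_sigma)
    qed
    have dq: "d k (min u (\<rho> x)) = q j" if "x \<in> C j" for x j using that by (simp add: C_def d_def q_def)
    have qle: "q j \<le> u" "q j \<le> \<rho> x" if "x \<in> C j" for x j
      using d_le[of k "min u (\<rho> x)"] dq[OF that] by auto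
    \<comment> \<open>On \<open>C j\<close> the grid time satisfies
      \<open>q j \<le> \<rho> x\<close>. The event with \<open>\<rho> x \<le> t\<close> is thus
      empty unless \<open>q j \<le> t\<close>, in which case \<open>S (q j)\<close> is known at
      \<open>t\<close>.\<close>
    have "C j \<inter> (S (q j) -` B \<inter> space M) \<in> sets (pre_sigma \<rho>)" for j
      unfolding sets_pre_iff[OF r]
    proof
      fix t
      show "{x \<in> C j \<inter> (S (q j) -` B \<inter> space M). \<rho> x \<le> t} \<in> sets (F t)"
      proof (cases "C j = {} \<or> t < q j")
        case True
        then have "{x \<in> C j \<inter> (S (q j) -` B \<inter> space M). \<rho> x \<le> t} = {}" using qle[of _ j] by fastforce
        then show ?thesis by (simp only: sets.empty_sets)
      next
        case False
        then have "q j \<le> T" "q j \<le> t" using qle(1)[of _ j] u by auto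
        moreover have "0 \<le> q j" by (simp add: q_def)
        ultimately have "S (q j) -` B \<inter> space M \<in> sets (F t)"
          using adapted[of "q j" B] sets_F_mono[of "q j" t] B by blast
        moreover have "{x\<in>C j. \<rho> x \<le> t} \<in> sets (F t)" using C sets_pre_iff[OF r] by blast
        moreover have "{x \<in> C j \<inter> (S (q j) -` B \<inter> space M). \<rho> x \<le> t} = {x\<in>C j. \<rho> x \<le> t} \<inter> (S (q j) -` B \<inter> space M)"
          by auto
        ultimately show ?thesis by auto
      qed
    qed
    moreover have "(\<lambda>x. S (d k (min u (\<rho> x))) x) -` B \<inter> space (pre_sigma \<rho>) = (\<Union>j. C j \<inter> (S (q j) -` B \<inter> space M))"
    proof (intro set_eqI iffI)
      fix x assume x: "x \<in> (\<lambda>x. S (d k (min u (\<rho> x))) x) -` B \<inter> space (pre_sigma \<rho>)"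
      then have sp: "x \<in> space M" by (simp add: space_pre_sigma)
      then have "0 \<le> min u (\<rho> x) * real (Suc k)" using u stopping_timesD(2)[OF r] by simp
      then have "x \<in> C (nat \<lfloor>min u (\<rho> x) * real (Suc k)\<rfloor>)" using sp by (simp add: C_def del: of_nat_Suc)
      with dq[OF this] x sp show "x \<in> (\<Union>j. C j \<inter> (S (q j) -` B \<inter> space M))" by auto
    next
      fix x assume "x \<in> (\<Union>j. C j \<inter> (S (q j) -` B \<inter> space M))"
      then show "x \<in> (\<lambda>x. S (d k (min u (\<rho> x))) x) -` B \<inter> space (pre_sigma \<rho>)"
        using dq by (auto simp: space_pre_sigma)
    qed
    ultimately show "(\<lambda>x. S (d k (min u (\<rho> x))) x) -` B \<inter> space (pre_sigma \<rho>) \<in> sets (pre_sigma \<rho>)" by auto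
  qed simp
  have lim: "AE x in M. (\<lambda>k. S (d k (min u (\<rho> x))) x) \<longlonglongrightarrow> S (min u (\<rho> x)) x"
    using cont AE_space
  proof eventually_elim
    case (elim x)
    have I: "min u (\<rho> x) \<in> {0..T}" using u stopping_timesD(2,3)[OF r elim(2)] by auto
    then have "d k (min u (\<rho> x)) \<in> {0..T}" for k
      using d_le[of k "min u (\<rho> x)"] d_nonneg[of "min u (\<rho> x)" k] by auto
    with I elim(1) d_lim[of "min u (\<rho> x)"] show ?case
      by (auto intro!: continuous_on_tendsto_compose[of "{0..T}" "\<lambda>t. S t x"])
  qed
  show ?thesis by (rule AE_limit_measurable[OF hm null_sets_pre_sigma[OF r] _ lim]) (simp add: space_pre_sigma)
qed

end

section \<open>Jump times and announcing sequences\<close>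

lemma next_jump_bdd_below: "bdd_below (insert T {t. \<sigma> \<omega> < t \<and> t \<le> T \<and> jump Y t \<omega> \<noteq> 0})"
  by (rule bdd_belowI[of _ "min T (\<sigma> \<omega>)"]) auto

lemma next_jump_le: "next_jump T Y \<sigma> \<omega> \<le> T"
  unfolding next_jump_def by (intro cInf_lower next_jump_bdd_below) simp

lemma next_jump_lower: "\<sigma> \<omega> < t \<Longrightarrow> t \<le> T \<Longrightarrow> jump Y t \<omega> \<noteq> 0 \<Longrightarrow> next_jump T Y \<sigma> \<omega> \<le> t"
  unfolding next_jump_def by (intro cInf_lower next_jump_bdd_below) simp

lemma next_jump_ge: "\<sigma> \<omega> \<le> T \<Longrightarrow> \<sigma> \<omega> \<le> next_jump T Y \<sigma> \<omega>"
  unfolding next_jump_def by (intro cInf_greatest) auto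

text \<open>No jump can lie after \<open>\<rho> \<omega>\<close> and up to
  \<open>\<sigma> \<omega>\<close>, so both infima range over the same times.\<close>

lemma next_jump_eq:
  assumes "\<rho> \<omega> \<le> \<sigma> \<omega>" "\<sigma> \<omega> < next_jump T Y \<rho> \<omega>"
  shows "next_jump T Y \<sigma> \<omega> = next_jump T Y \<rho> \<omega>"
proof -
  have "{t. \<sigma> \<omega> < t \<and> t \<le> T \<and> jump Y t \<omega> \<noteq> 0} = {t. \<rho> \<omega> < t \<and> t \<le> T \<and> jump Y t \<omega> \<noteq> 0}"
    using assms next_jump_lower[of \<rho> \<omega> _ T Y] by force
  then show ?thesis by (simp add: next_jump_def)
qed

lemma jump_time_bounds: "0 \<le> T \<Longrightarrow> 0 \<le> jump_time T Y i \<omega> \<and> jump_time T Y i \<omega> \<le> T"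
proof (induction i)
  case (Suc i)
  then show ?case
    using next_jump_le[of T Y "jump_time T Y i" \<omega>] next_jump_ge[of "jump_time T Y i" \<omega> T Y] by auto
qed simp

lemma jump_time_mono:
  assumes "0 \<le> T" "i \<le> j"
  shows "jump_time T Y i \<omega> \<le> jump_time T Y j \<omega>"
proof (rule lift_Suc_mono_le[OF _ assms(2)])
  fix n
  have "jump_time T Y n \<omega> \<le> T" using jump_time_bounds[OF assms(1), of Y n \<omega>] by blast
  then show "jump_time T Y n \<omega> \<le> jump_time T Y (Suc n) \<omega>"
    unfolding jump_time.simps(2) by (rule next_jump_ge)
qed

text \<open>While \<open>T\<close> is not reached, the infimum over a finite set is attained, so the
  jump times increase strictly through actual jumps; infinitely many would contradict
  finiteness.\<close>

lemma jump_time_eventually_T: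
  assumes T: "0 < T" and fin: "finite {t. 0 < t \<and> t \<le> T \<and> jump Y t \<omega> \<noteq> 0}"
  shows "\<exists>i. jump_time T Y i \<omega> = T"
proof (rule ccontr)
  assume "\<not> ?thesis"
  then have lt: "jump_time T Y i \<omega> < T" for i
    using jump_time_bounds[of T Y i \<omega>] T by (metis less_eq_real_def)
  let ?J = "{t. 0 < t \<and> t \<le> T \<and> jump Y t \<omega> \<noteq> 0}"
  have step: "jump_time T Y i \<omega> < jump_time T Y (Suc i) \<omega> \<and> jump_time T Y (Suc i) \<omega> \<in> ?J" for i
  proof -
    let ?X = "{t. jump_time T Y i \<omega> < t \<and> t \<le> T \<and> jump Y t \<omega> \<noteq> 0}"
    have sub: "?X \<subseteq> ?J" using jump_time_bounds[of T Y i \<omega>] T by auto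
    then have finX: "finite (insert T ?X)" using fin finite_subset by auto
    have "Min (insert T ?X) \<in> insert T ?X" by (rule Min_in[OF finX]) simp
    moreover have "Inf (insert T ?X) = Min (insert T ?X)" by (rule cInf_eq_Min[OF finX]) simp
    ultimately have "Inf (insert T ?X) \<in> insert T ?X" by (simp only:)
    then have "jump_time T Y (Suc i) \<omega> \<in> insert T ?X" by (simp add: next_jump_def)
    then have "jump_time T Y (Suc i) \<omega> \<in> ?X" using lt[of "Suc i"] by auto
    with sub show ?thesis by blast
  qed
  have sm: "strict_mono (\<lambda>i. jump_time T Y i \<omega>)"
    unfolding strict_mono_Suc_iff using step by blast
  have "inj (\<lambda>i. jump_time T Y (Suc i) \<omega>)"
  proof (rule injI)
    fix i j assume "jump_time T Y (Suc i) \<omega> = jump_time T Y (Suc j) \<omega>"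
    then have "Suc i = Suc j" by (rule strict_mono_eq[OF sm, THEN iffD1])
    then show "i = j" by simp
  qed
  moreover have "range (\<lambda>i. jump_time T Y (Suc i) \<omega>) \<subseteq> ?J" using step by blast
  ultimately show False using fin by (meson finite_subset range_inj_infinite)
qed

lemma full_filtration_complete:
  fixes S :: "real \<Rightarrow> 'a \<Rightarrow> real ^ 'n"
  assumes "prob_space M" "complete_measure M" "0 < T"
    and S: "\<And>t. t \<in> {0..T} \<Longrightarrow> S t \<in> borel_measurable M"
    and Y: "\<And>t. t \<in> {0..T} \<Longrightarrow> Y t \<in> borel_measurable M"
  shows "complete_filtration M (full_filtration M T S Y) T"
proof -
  interpret prob_space M by fact
  interpret complete_measure M by fact
  have sp: "space (full_filtration M T S Y t) = space M" for t
    by (simp add: full_filtration_def space_join_sigma)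
  note up = sets_join_sigma_upper[of "gen_filtration M T S _" M "gen_filtration M T Y _", OF space_gen_filtration space_gen_filtration]
  have mono: "sets (full_filtration M T S Y s) \<subseteq> sets (full_filtration M T S Y t)" if "min s T \<le> t" for s t
    unfolding full_filtration_def
  proof (rule sets_join_sigma_least)
    show "sets (gen_filtration M T S s) \<subseteq> sets (join_sigma M (gen_filtration M T S t) (gen_filtration M T Y t))"
      by (rule order_trans[OF sets_gen_filtration_mono[OF that] up(1)])
    show "sets (gen_filtration M T Y s) \<subseteq> sets (join_sigma M (gen_filtration M T S t) (gen_filtration M T Y t))"
      by (rule order_trans[OF sets_gen_filtration_mono[OF that] up(2)])
  qed (simp_all add: space_gen_filtration space_join_sigma)
  show ?thesis
  proof unfold_locales
    show "sets (full_filtration M T S Y t) \<subseteq> sets M" for t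
      unfolding full_filtration_def
      by (intro sets_join_sigma_least sets_gen_filtration_subset S Y) (auto simp: space_gen_filtration)
    show "null_sets M \<subseteq> sets (full_filtration M T S Y t)" for t
      using null_sets_gen_filtration[of M T S t] up(1) by (auto simp: full_filtration_def)
    show "sets (full_filtration M T S Y i) \<subseteq> sets (full_filtration M T S Y j)" if "i \<le> j" for i j
      by (rule mono) (use that in auto)
  qed (use sp \<open>0 < T\<close> in auto)
qed

section \<open>Intervals between jumps and announcing sequences\<close>

locale insurance_market = complete_filtration M F T
  for M :: "'a measure" and F :: "real \<Rightarrow> 'a measure" and T :: real +
  fixes S :: "real \<Rightarrow> 'a \<Rightarrow> real ^ 'n" and Y :: "real \<Rightarrow> 'a \<Rightarrow> real"
  assumes F_eq: "F = full_filtration M T S Y"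
    and S_cont: "AE x in M. continuous_on {0..T} (\<lambda>t. S t x)"
    and jumps: "finitely_many_predictable_jumps M T F Y"
    and no_randomness: "no_randomness_between_jumps M T Y"
begin

lemma gen_S_sub_F: "sets (gen_filtration M T S t) \<subseteq> sets (F t)"
  and gen_Y_sub_F: "sets (gen_filtration M T Y t) \<subseteq> sets (F t)"
  unfolding F_eq full_filtration_def
  by (rule sets_join_sigma_upper[OF space_gen_filtration space_gen_filtration])+

lemma jump_time_stopping: "jump_time T Y i \<in> \<S>"
proof (cases i)
  case 0
  then show ?thesis using stopping_times_const[of 0] T_pos by simp
next
  case (Suc j)
  then show ?thesis using jumps by (auto simp: finitely_many_predictable_jumps_def predictable_time_def simp del: jump_time.simps)
qed

text \<open>Half-open stochastic intervals sort the points by how many jumps have occurred by time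
  \<open>\<sigma>\<close>. On \<open>between \<sigma> i\<close> the next jump after
  \<open>\<sigma>\<close> is jump number \<open>i + 1\<close>.\<close>

definition between :: "('a \<Rightarrow> real) \<Rightarrow> nat \<Rightarrow> 'a set" where
  "between \<sigma> i = {x\<in>space M. jump_time T Y i x \<le> \<sigma> x \<and> \<sigma> x < jump_time T Y (Suc i) x}"

lemma between_pre_sigma: "\<sigma> \<in> \<S> \<Longrightarrow> between \<sigma> i \<in> sets (pre_sigma \<sigma>)"
proof -
  assume s: "\<sigma> \<in> \<S>"
  have eq: "between \<sigma> i = {x\<in>space M. jump_time T Y i x \<le> \<sigma> x} \<inter> {x\<in>space M. \<sigma> x < jump_time T Y (Suc i) x}"
    by (auto simp: between_def)
  show ?thesis
    unfolding eq by (rule sets.Int[OF le_in_pre_sigma(2)[OF jump_time_stopping s] less_in_pre_sigma(1)[OF s jump_time_stopping]])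
qed

lemma between_unique: "x \<in> between \<sigma> i \<Longrightarrow> x \<in> between \<sigma> j \<Longrightarrow> i = j"
proof (rule ccontr)
  have aux: False if "x \<in> between \<sigma> i" "x \<in> between \<sigma> j" "i < j" for i j
  proof -
    have "jump_time T Y (Suc i) x \<le> jump_time T Y j x"
      using that(3) T_pos by (intro jump_time_mono) auto
    with that show False by (auto simp: between_def simp del: jump_time.simps)
  qed
  assume "x \<in> between \<sigma> i" "x \<in> between \<sigma> j" "i \<noteq> j"
  then show False using aux[of i j] aux[of j i] by (cases i j rule: linorder_cases) auto
qed

lemma next_jump_between: "x \<in> between \<sigma> i \<Longrightarrow> next_jump T Y \<sigma> x = jump_time T Y (Suc i) x"
  unfolding between_def jump_time.simps(2) by (rule next_jump_eq) auto

text \<open>When \<open>\<sigma> x < T\<close>, finiteness of the jumps yields a least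
  \<open>k\<close> whose jump time exceeds \<open>\<sigma> x\<close>; it is positive because jump
  time 0 is zero, and its predecessor names the interval.\<close>

lemma between_cover:
  assumes s: "\<sigma> \<in> \<S>"
  shows "AE x in M. (\<forall>i. x \<notin> between \<sigma> i) \<longrightarrow> \<sigma> x = T"
proof -
  have "AE x in M. finite {t. 0 < t \<and> t \<le> T \<and> jump Y t x \<noteq> 0}"
    using jumps by (simp add: finitely_many_predictable_jumps_def)
  then show ?thesis using AE_space
  proof eventually_elim
    case (elim x)
    show ?case
    proof (intro impI, rule ccontr)
      assume nb: "\<forall>i. x \<notin> between \<sigma> i" and "\<sigma> x \<noteq> T"
      then have lt: "\<sigma> x < T" using stopping_timesD(3)[OF s elim(2)] by simp
      obtain i where "jump_time T Y i x = T" using jump_time_eventually_T[OF T_pos elim(1)] by blast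
      then have ex: "\<exists>i. \<sigma> x < jump_time T Y i x" using lt by metis
      define k where "k = (LEAST i. \<sigma> x < jump_time T Y i x)"
      have k: "\<sigma> x < jump_time T Y k x" unfolding k_def by (rule LeastI_ex[OF ex])
      have "k \<noteq> 0" using k stopping_timesD(2)[OF s elim(2)] by (cases k) auto
      then obtain j where j: "k = Suc j" by (cases k) auto
      then have "\<not> \<sigma> x < jump_time T Y j x" unfolding k_def by (intro not_less_Least) (metis lessI)
      then have "x \<in> between \<sigma> j" using k elim(2) by (simp add: between_def j del: jump_time.simps)
      with nb show False by blast
    qed
  qed
qed

text \<open>Pastes the times \<open>\<rho> i\<close> along the intervals. The remaining points,
  where \<open>\<sigma>\<close> is almost surely already \<open>T\<close>, keep the value of
  \<open>\<sigma>\<close>.\<close>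

definition splice :: "('a \<Rightarrow> real) \<Rightarrow> (nat \<Rightarrow> 'a \<Rightarrow> real) \<Rightarrow> 'a \<Rightarrow> real" where
  "splice \<sigma> \<rho> x = (if \<exists>i. x \<in> between \<sigma> i then \<rho> (THE i. x \<in> between \<sigma> i) x else \<sigma> x)"

lemma splice_between: "x \<in> between \<sigma> i \<Longrightarrow> splice \<sigma> \<rho> x = \<rho> i x"
proof -
  assume x: "x \<in> between \<sigma> i"
  then have "(THE i. x \<in> between \<sigma> i) = i" using between_unique by (intro the_equality) auto
  then show ?thesis using x by (auto simp: splice_def)
qed

lemma splice_other: "(\<And>i. x \<notin> between \<sigma> i) \<Longrightarrow> splice \<sigma> \<rho> x = \<sigma> x"
  by (simp add: splice_def)

text \<open>The condition \<open>\<sigma> x \<le> \<rho> i x\<close> on the interval moves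
  \<open>between \<sigma> i\<close> from \<open>pre_sigma \<sigma>\<close> into
  \<open>pre_sigma (\<rho> i)\<close>, after which countable patching applies.\<close>

lemma splice_stopping:
  assumes s: "\<sigma> \<in> \<S>" and \<rho>: "\<And>i. \<rho> i \<in> \<S>"
    and le: "\<And>i x. x \<in> between \<sigma> i \<Longrightarrow> \<sigma> x \<le> \<rho> i x"
  shows "splice \<sigma> \<rho> \<in> \<S>"
proof -
  define D where "D k = (case k of 0 \<Rightarrow> space M - (\<Union>i. between \<sigma> i) | Suc i \<Rightarrow> between \<sigma> i)" for k
  define r where "r k = (case k of 0 \<Rightarrow> \<sigma> | Suc i \<Rightarrow> \<rho> i)" for k
  show ?thesis
  proof (rule stopping_times_patch[of r D])
    show "r k \<in> \<S>" for k using s \<rho> by (simp add: r_def split: nat.split)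
    show "D k \<in> sets (pre_sigma (r k))" for k
    proof (cases k)
      case 0
      have "space (pre_sigma \<sigma>) - (\<Union>i. between \<sigma> i) \<in> sets (pre_sigma \<sigma>)"
        using between_pre_sigma[OF s] by auto
      then show ?thesis using 0 by (simp add: D_def r_def space_pre_sigma)
    next
      case (Suc i)
      then show ?thesis
        using pre_sigma_le_on[OF s \<rho> between_pre_sigma[OF s], of i i] le by (simp add: D_def r_def)
    qed
    show "splice \<sigma> \<rho> x = r k x" if "x \<in> D k" for k x
      using that splice_between splice_other by (auto simp: D_def r_def split: nat.splits)
    show "space M \<subseteq> (\<Union>k. D k)"
    proof
      fix x assume "x \<in> space M"
      then have "x \<in> D 0 \<or> (\<exists>i. x \<in> D (Suc i))" by (auto simp: D_def)
      then show "x \<in> (\<Union>k. D k)" by blast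
    qed
  qed
qed

text \<open>The next jump agrees almost surely with the jump times spliced along the intervals of
  \<open>\<sigma>\<close>; completeness absorbs the exceptional null set.\<close>

lemma next_jump_stopping:
  assumes s: "\<sigma> \<in> \<S>"
  shows "next_jump T Y \<sigma> \<in> \<S>"
proof (rule stopping_times_AE_eq)
  show "splice \<sigma> (\<lambda>i. jump_time T Y (Suc i)) \<in> \<S>"
    by (rule splice_stopping[OF s jump_time_stopping]) (simp add: between_def)
  show "AE x in M. splice \<sigma> (\<lambda>i. jump_time T Y (Suc i)) x = next_jump T Y \<sigma> x"
    using between_cover[OF s] AE_space
  proof eventually_elim
    case (elim x)
    show ?case
    proof (cases "\<exists>i. x \<in> between \<sigma> i")
      case True
      then show ?thesis using splice_between next_jump_between by metis
    next
      case False
      then have "\<sigma> x = T" using elim(1) by blast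
      moreover have "splice \<sigma> (\<lambda>i. jump_time T Y (Suc i)) x = \<sigma> x" using False by (intro splice_other) auto
      ultimately show ?thesis using next_jump_le[of T Y \<sigma> x] next_jump_ge[of \<sigma> x T Y] by simp
    qed
  qed
  show "0 \<le> next_jump T Y \<sigma> x \<and> next_jump T Y \<sigma> x \<le> T" if "x \<in> space M" for x
    using next_jump_le[of T Y \<sigma> x] next_jump_ge[of \<sigma> x T Y] stopping_timesD(2,3)[OF s that] by simp
qed

text \<open>The inequalities towards the next jump are weak because no time is left after
  \<open>\<sigma> x = T\<close>. Strictness, needed to stay before the jump, is demanded on the
  intervals only.\<close>

definition announces :: "(nat \<Rightarrow> 'a \<Rightarrow> real) \<Rightarrow> ('a \<Rightarrow> real) \<Rightarrow> bool" where
  "announces \<rho> \<sigma> \<longleftrightarrow> (\<forall>n. \<rho> n \<in> \<S>) \<and>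
    (AE x in M. (\<forall>n. \<sigma> x \<le> \<rho> n x \<and> \<rho> n x \<le> next_jump T Y \<sigma> x) \<and> incseq (\<lambda>n. \<rho> n x) \<and>
      (\<lambda>n. \<rho> n x) \<longlonglongrightarrow> next_jump T Y \<sigma> x \<and>
      (\<forall>n i. x \<in> between \<sigma> i \<longrightarrow> \<rho> n x < jump_time T Y (Suc i) x))"

lemma announcing_sequence:
  assumes s: "\<sigma> \<in> \<S>"
  obtains \<rho> where "announces \<rho> \<sigma>"
proof -
  have "\<exists>r::nat \<Rightarrow> 'a \<Rightarrow> real. (\<forall>n. r n \<in> \<S>) \<and>
    (AE x in M. (\<forall>n. r n x < jump_time T Y (Suc i) x) \<and> incseq (\<lambda>n. r n x) \<and> (\<lambda>n. r n x) \<longlonglongrightarrow> jump_time T Y (Suc i) x)" for i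
    using jumps by (simp add: finitely_many_predictable_jumps_def predictable_time_def del: jump_time.simps)
  from choice[OF allI, OF this] obtain r :: "nat \<Rightarrow> nat \<Rightarrow> 'a \<Rightarrow> real" where
    "\<forall>i. (\<forall>n. r i n \<in> \<S>) \<and>
      (AE x in M. (\<forall>n. r i n x < jump_time T Y (Suc i) x) \<and> incseq (\<lambda>n. r i n x) \<and>
        (\<lambda>n. r i n x) \<longlonglongrightarrow> jump_time T Y (Suc i) x)" ..
  note this[THEN spec]
  then have r: "r i n \<in> \<S>"
    and r_AE: "AE x in M. (\<forall>n. r i n x < jump_time T Y (Suc i) x) \<and> incseq (\<lambda>n. r i n x) \<and>
      (\<lambda>n. r i n x) \<longlonglongrightarrow> jump_time T Y (Suc i) x" for i n
    by (auto simp del: jump_time.simps)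
  \<comment> \<open>The maximum keeps the sequence after \<open>\<sigma>\<close>; strictness
    survives because \<open>\<sigma>\<close> itself lies strictly before jump \<open>i + 1\<close>
    on \<open>between \<sigma> i\<close>.\<close>
  define \<rho> where "\<rho> n = splice \<sigma> (\<lambda>i x. max (\<sigma> x) (r i n x))" for n
  have "\<rho> n \<in> \<S>" for n
    unfolding \<rho>_def by (intro splice_stopping[OF s stopping_times_max[OF s r]]) auto
  moreover have "AE x in M. (\<forall>n. \<sigma> x \<le> \<rho> n x \<and> \<rho> n x \<le> next_jump T Y \<sigma> x) \<and> incseq (\<lambda>n. \<rho> n x) \<and>
      (\<lambda>n. \<rho> n x) \<longlonglongrightarrow> next_jump T Y \<sigma> x \<and>
      (\<forall>n i. x \<in> between \<sigma> i \<longrightarrow> \<rho> n x < jump_time T Y (Suc i) x)"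
  proof -
    have "AE x in M. \<forall>i. (\<forall>n. r i n x < jump_time T Y (Suc i) x) \<and> incseq (\<lambda>n. r i n x) \<and>
      (\<lambda>n. r i n x) \<longlonglongrightarrow> jump_time T Y (Suc i) x"
      unfolding AE_all_countable using r_AE by blast
    then show ?thesis using between_cover[OF s] AE_space
    proof eventually_elim
      case (elim x)
      show ?case
      proof (cases "\<exists>i. x \<in> between \<sigma> i")
        case True
        then obtain i where i: "x \<in> between \<sigma> i" ..
        have eq: "\<rho> n x = max (\<sigma> x) (r i n x)" for n unfolding \<rho>_def by (rule splice_between[OF i])
        have lt: "\<sigma> x < jump_time T Y (Suc i) x" using i by (simp add: between_def)
        have nj: "next_jump T Y \<sigma> x = jump_time T Y (Suc i) x" by (rule next_jump_between[OF i])
        have ri: "\<And>n. r i n x < jump_time T Y (Suc i) x" "incseq (\<lambda>n. r i n x)"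
          "(\<lambda>n. r i n x) \<longlonglongrightarrow> jump_time T Y (Suc i) x" using elim(1) by blast+
        have "(\<lambda>n. max (\<sigma> x) (r i n x)) \<longlonglongrightarrow> max (\<sigma> x) (jump_time T Y (Suc i) x)"
          by (intro tendsto_max tendsto_const ri(3))
        then have "(\<lambda>n. \<rho> n x) \<longlonglongrightarrow> next_jump T Y \<sigma> x" using lt by (simp add: eq nj max_def del: jump_time.simps)
        moreover have "incseq (\<lambda>n. \<rho> n x)"
          unfolding eq using ri(2) by (auto simp: incseq_def intro: max.coboundedI2 max.mono)
        moreover have "\<rho> n x < jump_time T Y (Suc i) x" for n using lt ri(1)[of n] by (simp add: eq del: jump_time.simps)
        moreover have "\<sigma> x \<le> \<rho> n x" for n by (simp add: eq)
        moreover have "j = i" if "x \<in> between \<sigma> j" for j using between_unique that i by blast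
        ultimately show ?thesis unfolding nj by (auto simp: less_imp_le simp del: jump_time.simps)
      next
        case False
        then have "\<sigma> x = T" using elim(2) by blast
        moreover have "\<rho> n x = \<sigma> x" for n unfolding \<rho>_def using False by (intro splice_other) auto
        moreover have "next_jump T Y \<sigma> x = T"
          using \<open>\<sigma> x = T\<close> next_jump_le[of T Y \<sigma> x] next_jump_ge[of \<sigma> x T Y] by simp
        ultimately show ?thesis using False by simp
      qed
    qed
  qed
  ultimately show ?thesis using that[of \<rho>] unfolding announces_def by blast
qed

end

section \<open>Information available strictly before the next jump\<close>

context insurance_market begin

text \<open>Jump times are known to be stopping times of \<open>F\<close>, not of the insurance
  filtration. The sigma-algebra on the left is therefore handled through its generating
  family.\<close>

lemma sets_gen_Y_pre: "sets (sigma_at M (gen_filtration M T Y) (jump_time T Y i)) \<subseteq> sets (pre_sigma (jump_time T Y i))"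
proof -
  have "sets (sigma_at M (gen_filtration M T Y) (jump_time T Y i))
      = sigma_sets (space M) {A. \<forall>t. {\<omega>\<in>A. jump_time T Y i \<omega> \<le> t} \<in> sets (gen_filtration M T Y t)}"
    unfolding filtration.pre_sigma_def[OF filtration_gen_filtration]
  proof (rule sets_measure_of, rule subsetI, rule PowI)
    fix A assume "A \<in> {A. \<forall>t. {\<omega>\<in>A. jump_time T Y i \<omega> \<le> t} \<in> sets (gen_filtration M T Y t)}"
    then have *: "{\<omega>\<in>A. jump_time T Y i \<omega> \<le> t} \<subseteq> space M" for t
      using sets.sets_into_space[of _ "gen_filtration M T Y t"] by (simp add: space_gen_filtration)
    show "A \<subseteq> space M"
    proof
      fix x assume "x \<in> A"
      then have "x \<in> {\<omega>\<in>A. jump_time T Y i \<omega> \<le> jump_time T Y i x}" by simp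
      with * show "x \<in> space M" by blast
    qed
  qed
  moreover have "{A. \<forall>t. {\<omega>\<in>A. jump_time T Y i \<omega> \<le> t} \<in> sets (gen_filtration M T Y t)} \<subseteq> sets (pre_sigma (jump_time T Y i))"
    using gen_Y_sub_F sets_pre_iff[OF jump_time_stopping] by blast
  ultimately show ?thesis
    using sets.sigma_sets_subset[of _ "pre_sigma (jump_time T Y i)"] by (simp add: space_pre_sigma)
qed

lemma space_sigma_at_Y: "space (sigma_at M (gen_filtration M T Y) \<tau>) = space M"
  by (rule filtration.space_pre_sigma[OF filtration_gen_filtration])

text \<open>An insurance event at time \<open>r\<close>, cut to \<open>r\<close> before jump
  \<open>i + 1\<close>, is a generator of the sigma-algebra strictly before that jump, which by
  assumption equals the one at jump \<open>i\<close>. Stock events pass through unchanged.\<close>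

lemma trace_before_next_jump:
  assumes B: "B \<in> sets (F r)" and r: "0 \<le> r"
  shows "B \<inter> {x\<in>space M. r < jump_time T Y (Suc i) x}
    \<in> sets (join_sigma M (gen_filtration M T S T) (sigma_at M (gen_filtration M T Y) (jump_time T Y i)))"
    (is "_ \<in> sets ?N")
proof -
  let ?Z = "{x\<in>space M. r < jump_time T Y (Suc i) x}"
  let ?FY = "sigma_at M (gen_filtration M T Y) (jump_time T Y i)"
  note up = sets_join_sigma_upper[of "gen_filtration M T S T" M ?FY, OF space_gen_filtration space_sigma_at_Y]
  have FY: "a \<inter> ?Z \<in> sets ?FY" if "a \<in> sets (gen_filtration M T Y r)" for a
  proof -
    have "a \<inter> ?Z \<in> sigma_sets (space M) (sets (gen_filtration M T Y 0) \<union>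
        {A \<inter> {\<omega>\<in>space M. t < jump_time T Y (Suc i) \<omega>} | A t. 0 \<le> t \<and> A \<in> sets (gen_filtration M T Y t)})"
      using that r by (intro sigma_sets.Basic) blast
    also have "\<dots> = sets (sigma_before M (gen_filtration M T Y) (jump_time T Y (Suc i)))"
      unfolding sigma_before_def
      by (rule sets_measure_of[symmetric])
        (use sets.sets_into_space[of _ "gen_filtration M T Y _"] in \<open>auto simp: space_gen_filtration simp del: jump_time.simps\<close>)
    also have "\<dots> = sets ?FY" using no_randomness unfolding no_randomness_between_jumps_def by blast
    finally show ?thesis .
  qed
  have Z: "?Z \<in> sets ?FY"
  proof -
    have "space M \<in> sets (gen_filtration M T Y r)" using sets.top[of "gen_filtration M T Y r"] by (simp add: space_gen_filtration)
    from FY[OF this] have "space M \<inter> ?Z \<in> sets ?FY" .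
    moreover have "space M \<inter> ?Z = ?Z" by blast
    ultimately show ?thesis by simp
  qed
  have "B \<in> sigma_sets (space M) (sets (gen_filtration M T S r) \<union> sets (gen_filtration M T Y r))"
    using B unfolding F_eq full_filtration_def sets_join_sigma[OF space_gen_filtration space_gen_filtration] .
  then show ?thesis
  proof (rule sigma_sets_Int_trace)
    show "?Z \<in> sets ?N" using Z up(2) by blast
    fix a assume "a \<in> sets (gen_filtration M T S r) \<union> sets (gen_filtration M T Y r)"
    then show "a \<inter> ?Z \<in> sets ?N"
    proof
      assume "a \<in> sets (gen_filtration M T S r)"
      then have "a \<in> sets (gen_filtration M T S T)" using sets_gen_filtration_mono[of r T T M S] by auto
      then have "a \<in> sets ?N" using up(1) by blast
      moreover have "?Z \<in> sets ?N" using Z up(2) by blast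
      ultimately show ?thesis by (rule sets.Int)
    next
      assume "a \<in> sets (gen_filtration M T Y r)"
      with FY up(2) show ?thesis by blast
    qed
  qed blast
qed

text \<open>Where jump \<open>i\<close> has happened by time \<open>\<sigma>\<close>, the insurance
  information at that jump is already part of \<open>pre_sigma \<sigma>\<close>.\<close>

lemma trace_after_jump:
  assumes s: "\<sigma> \<in> \<S>"
    and B: "B \<in> sets (join_sigma M (gen_filtration M T S T) (sigma_at M (gen_filtration M T Y) (jump_time T Y i)))"
  shows "B \<inter> {x\<in>space M. jump_time T Y i x \<le> \<sigma> x} \<in> sets (join_sigma M (gen_filtration M T S T) (pre_sigma \<sigma>))"
    (is "_ \<inter> ?Z \<in> sets ?K")
proof -
  note up = sets_join_sigma_upper[of "gen_filtration M T S T" M "pre_sigma \<sigma>", OF space_gen_filtration space_pre_sigma]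
  note j = jump_time_stopping[of i]
  have Z: "?Z \<in> sets ?K" using le_in_pre_sigma(2)[OF j s] up(2) by blast
  have "B \<in> sigma_sets (space M) (sets (gen_filtration M T S T) \<union> sets (sigma_at M (gen_filtration M T Y) (jump_time T Y i)))"
    using B unfolding sets_join_sigma[OF space_gen_filtration space_sigma_at_Y] .
  then show ?thesis
  proof (rule sigma_sets_Int_trace[OF _ Z])
    fix a assume "a \<in> sets (gen_filtration M T S T) \<union> sets (sigma_at M (gen_filtration M T Y) (jump_time T Y i))"
    then show "a \<inter> ?Z \<in> sets ?K"
    proof
      assume "a \<in> sets (gen_filtration M T S T)"
      then have "a \<in> sets ?K" using up(1) by blast
      then show ?thesis using Z by (rule sets.Int)
    next
      assume "a \<in> sets (sigma_at M (gen_filtration M T Y) (jump_time T Y i))"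
      then have "a \<in> sets (pre_sigma (jump_time T Y i))" using sets_gen_Y_pre by blast
      then have "a \<inter> ?Z \<in> sets (pre_sigma (jump_time T Y i))" using le_in_pre_sigma(1)[OF j s] by (rule sets.Int)
      then have "a \<inter> ?Z \<in> sets (pre_sigma \<sigma>)" by (rule pre_sigma_le_on[OF j s]) auto
      then show ?thesis using up(2) by blast
    qed
  qed blast
qed

lemma null_sets_join_sigma: "null_sets M \<subseteq> sets (join_sigma M (gen_filtration M T S T) (pre_sigma \<sigma>))"
  using null_sets_gen_filtration sets_join_sigma_upper(1)[of "gen_filtration M T S T" M "pre_sigma \<sigma>", OF space_gen_filtration space_pre_sigma]
  by (rule order_trans)

text \<open>Between \<open>\<rho>\<close> and the next jump there is a rational \<open>r\<close>, at
  which an event of \<open>pre_sigma \<rho>\<close> is already decided. The two trace lemmas then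
  replace its insurance part by information at \<open>\<sigma>\<close>, and countably many rationals
  and intervals suffice.\<close>

lemma pre_sigma_before_next_jump:
  assumes s: "\<sigma> \<in> \<S>" and \<rho>: "\<rho> \<in> \<S>"
    and le: "AE x in M. \<sigma> x \<le> \<rho> x" "AE x in M. \<rho> x \<le> next_jump T Y \<sigma> x"
    and lt: "AE x in M. \<forall>i. x \<in> between \<sigma> i \<longrightarrow> \<rho> x < jump_time T Y (Suc i) x"
  shows "sets (pre_sigma \<rho>) \<subseteq> sets (join_sigma M (gen_filtration M T S T) (pre_sigma \<sigma>))" (is "_ \<subseteq> sets ?K")
proof
  fix A assume A: "A \<in> sets (pre_sigma \<rho>)"
  note up = sets_join_sigma_upper[of "gen_filtration M T S T" M "pre_sigma \<sigma>", OF space_gen_filtration space_pre_sigma]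
  have AM: "A \<subseteq> space M" by (rule pre_sigma_into_space[OF A])
  have bet: "between \<sigma> i \<in> sets (pre_sigma \<sigma>)" for i by (rule between_pre_sigma[OF s])
  have bet\<rho>: "between \<sigma> i \<in> sets (pre_sigma \<rho>)" for i using bet pre_sigma_mono_AE[OF s \<rho> le(1)] by blast
  \<comment> \<open>The last factor already holds on \<open>between \<sigma> i\<close>; it is
    written out so that the set has exactly the shape of the two trace lemmas.\<close>
  define P where "P i r = {x\<in>A \<inter> between \<sigma> i. \<rho> x \<le> r} \<inter> {x\<in>space M. r < jump_time T Y (Suc i) x}
      \<inter> {x\<in>space M. jump_time T Y i x \<le> \<sigma> x}" for i r
  have P: "P i r \<in> sets ?K" if "0 \<le> r" for i r
  proof -
    have "{x\<in>A \<inter> between \<sigma> i. \<rho> x \<le> r} \<in> sets (F r)"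
      using sets.Int[OF A bet\<rho>] sets_pre_iff[OF \<rho>] by blast
    from trace_after_jump[OF s trace_before_next_jump[OF this that]] show ?thesis unfolding P_def .
  qed
  \<comment> \<open>Off the intervals \<open>\<sigma>\<close> is almost surely \<open>T\<close>,
    hence \<open>\<rho> x \<le> \<sigma> x\<close>, and this part of \<open>A\<close> is known at
    \<open>\<sigma>\<close>.\<close>
  define R where "R = (A - (\<Union>i. between \<sigma> i))"
  have R: "R \<in> sets ?K"
  proof -
    have "(\<Union>i. between \<sigma> i) \<in> sets (pre_sigma \<rho>)" using bet\<rho> by (intro sets.countable_UN) auto
    then have "R \<in> sets (pre_sigma \<rho>)" unfolding R_def using A by (intro sets.Diff)
    moreover have "AE x in M. x \<in> R \<longrightarrow> \<rho> x \<le> \<sigma> x"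
      using between_cover[OF s] AE_space
    proof eventually_elim
      case (elim x)
      then show ?case using stopping_timesD(3)[OF \<rho>] by (auto simp: R_def)
    qed
    ultimately have "R \<in> sets (pre_sigma \<sigma>)" by (intro pre_sigma_le_on[OF \<rho> s])
    then show ?thesis using up(2) by blast
  qed
  define A' where "A' = R \<union> (\<Union>i. \<Union>r\<in>\<rat> \<inter> {0..}. P i r)"
  have "(\<Union>i. \<Union>r\<in>\<rat> \<inter> {0..}. P i r) \<in> sets ?K"
    using P countable_rat by (intro sets.countable_UN' countable_Int1) auto
  then have A': "A' \<in> sets ?K" unfolding A'_def using R by blast
  have A'M: "A' \<subseteq> space M" using sets.sets_into_space[OF A'] by (simp add: space_join_sigma)
  have "AE x in M. x \<in> A' \<longleftrightarrow> x \<in> A"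
    using lt AE_space
  proof eventually_elim
    case (elim x)
    show ?case
    proof
      assume "x \<in> A'" then show "x \<in> A" by (auto simp: A'_def R_def P_def)
    next
      assume xA: "x \<in> A"
      show "x \<in> A'"
      proof (cases "\<exists>i. x \<in> between \<sigma> i")
        case False
        then show ?thesis using xA by (auto simp: A'_def R_def)
      next
        case True
        then obtain i where i: "x \<in> between \<sigma> i" ..
        with elim(1) have "\<rho> x < jump_time T Y (Suc i) x" by blast
        then obtain q where q: "q \<in> \<rat>" "\<rho> x < q" "q < jump_time T Y (Suc i) x" using Rats_dense_in_real by blast
        have "0 \<le> q" using q(2) stopping_timesD(2)[OF \<rho> elim(2)] by simp
        moreover have "x \<in> P i q" using q xA i elim(2) by (auto simp: P_def between_def simp del: jump_time.simps)
        ultimately show ?thesis using q(1) unfolding A'_def by blast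
      qed
    qed
  qed
  then show "A \<in> sets ?K" by (rule AE_eq_sets[OF A' null_sets_join_sigma AM _ A'M])
qed

text \<open>By continuity, the stock at \<open>min u\<close> of the jump time is the limit of the
  stock at \<open>min u (\<rho> n x)\<close>, and each of these is known at \<open>\<rho> n\<close>.
  A stock price jumping together with \<open>Y\<close> would escape this argument.\<close>

lemma stock_sigma_next_jump_sub:
  assumes s: "\<sigma> \<in> \<S>" and ann: "announces \<rho> \<sigma>"
  shows "sets (stock_sigma_next_jump M T S Y \<sigma>) \<subseteq> sigma_sets (space M) (\<Union>n. sets (pre_sigma (\<rho> n)))"
proof -
  define N where "N = sigma (space M) (\<Union>n. sets (pre_sigma (\<rho> n)))"
  have \<rho>: "\<rho> n \<in> \<S>" for n using ann by (simp add: announces_def)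
  have "(\<Union>n. sets (pre_sigma (\<rho> n))) \<subseteq> Pow (space M)" using pre_sigma_into_space by blast
  then have sN: "sets N = sigma_sets (space M) (\<Union>n. sets (pre_sigma (\<rho> n)))" unfolding N_def by simp
  have spN: "space N = space M" by (simp add: N_def space_measure_of_conv)
  have preN: "sets (pre_sigma (\<rho> n)) \<subseteq> sets N" for n unfolding sN by (auto intro: sigma_sets.Basic)
  have nullN: "null_sets M \<subseteq> sets N" using null_sets_pre_sigma[OF \<rho>[of 0]] preN[of 0] by (rule order_trans)
  have AEann: "AE x in M. (\<forall>n. \<sigma> x \<le> \<rho> n x) \<and> (\<lambda>n. \<rho> n x) \<longlonglongrightarrow> next_jump T Y \<sigma> x"
    using ann unfolding announces_def by (auto elim!: eventually_mono)
  have "AE x in M. \<sigma> x \<le> \<rho> 0 x" using AEann by (auto elim!: eventually_mono)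
  from pre_sigma_mono_AE[OF s \<rho> this] have pre: "sets (pre_sigma \<sigma>) \<subseteq> sets N" using preN[of 0] by blast
  have adapted: "S t -` B \<inter> space M \<in> sets (F t)" if "0 \<le> t" "t \<le> T" "B \<in> sets borel" for t B
    using gen_S_sub_F gen_filtration_vimage[OF that(1,2) order_refl that(3)] by blast
  have "(\<lambda>x. S (min u (next_jump T Y \<sigma> x)) x) \<in> borel_measurable N" if u: "0 \<le> u" "u \<le> T" for u
  proof (rule AE_limit_measurable[OF _ nullN spN])
    fix n
    have "(\<lambda>x. S (min u (\<rho> n x)) x) \<in> borel_measurable (pre_sigma (\<rho> n))"
      by (rule stopped_process_measurable[OF \<rho> u adapted S_cont])
    then show "(\<lambda>x. S (min u (\<rho> n x)) x) \<in> borel_measurable N"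
      by (rule measurable_mono[THEN subsetD, rotated -1]) (use preN in \<open>auto simp: spN space_pre_sigma\<close>)
  next
    show "AE x in M. (\<lambda>n. S (min u (\<rho> n x)) x) \<longlonglongrightarrow> S (min u (next_jump T Y \<sigma> x)) x"
      using S_cont AEann AE_space
    proof eventually_elim
      case (elim x)
      have "min u (\<rho> n x) \<in> {0..T}" for n using u stopping_timesD(2,3)[OF \<rho> elim(3)] by auto
      moreover have "min u (next_jump T Y \<sigma> x) \<in> {0..T}"
        using u stopping_timesD(2,3)[OF next_jump_stopping[OF s] elim(3)] by auto
      moreover have "(\<lambda>n. min u (\<rho> n x)) \<longlonglongrightarrow> min u (next_jump T Y \<sigma> x)"
        using elim(2) by (intro tendsto_min tendsto_const) auto
      ultimately show ?case
        using elim(1) by (auto intro!: continuous_on_tendsto_compose[of "{0..T}" "\<lambda>t. S t x"])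
    qed
  qed
  then have vim: "(\<lambda>x. S (min u (next_jump T Y \<sigma> x)) x) -` B \<inter> space M \<in> sets N"
    if "0 \<le> u" "u \<le> T" "B \<in> sets borel" for u B
    using measurable_sets[of _ N borel B] that spN by metis
  have "sets (gen_sigma_upto M T S (next_jump T Y \<sigma>)) = sigma_sets (space M)
      ({(\<lambda>\<omega>. S (min u (next_jump T Y \<sigma> \<omega>)) \<omega>) -` B \<inter> space M | u B. 0 \<le> u \<and> u \<le> T \<and> B \<in> sets borel} \<union> null_sets M)"
    unfolding gen_sigma_upto_def
    by (rule sets_measure_of) (use sets.sets_into_space[of _ M] in \<open>auto simp: null_sets_def\<close>)
  also have "\<dots> \<subseteq> sets N"
    unfolding spN[symmetric] by (rule sets.sigma_sets_subset) (use vim nullN spN in auto)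
  finally have gen: "sets (gen_sigma_upto M T S (next_jump T Y \<sigma>)) \<subseteq> sets N" .
  show ?thesis
    unfolding stock_sigma_next_jump_def sN[symmetric] F_eq[symmetric]
    by (rule sets_join_sigma_least[OF _ space_pre_sigma spN gen pre]) (simp add: gen_sigma_upto_def space_measure_of_conv)
qed

lemma space_stock_sigma_next_jump: "space (stock_sigma_next_jump M T S Y \<sigma>) = space M"
  by (simp add: stock_sigma_next_jump_def space_join_sigma)

lemma pre_sigma_sub_stock_sigma_next_jump: "sets (pre_sigma \<sigma>) \<subseteq> sets (stock_sigma_next_jump M T S Y \<sigma>)"
  unfolding stock_sigma_next_jump_def F_eq[symmetric]
  by (rule sets_join_sigma_upper(2)[OF _ space_pre_sigma]) (simp add: gen_sigma_upto_def space_measure_of_conv)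

end

section \<open>The extended pricing measure\<close>

text \<open>The density of \<open>QS\<close> on the stock sigma-algebra is positive almost
  everywhere, because its zero set is null for \<open>QS\<close> and equivalence holds there.
  Positivity then gives equivalence on all of \<open>M\<close>.\<close>

lemma extended_measure_equivalent:
  fixes S :: "real \<Rightarrow> 'a \<Rightarrow> real ^ 'n"
  assumes M: "prob_space M" and sub: "sets (gen_filtration M T S T) \<subseteq> sets M" "space (gen_filtration M T S T) = space M"
    and emm: "equivalent_martingale_measure M T S QS"
  defines "Q \<equiv> extended_measure M T S QS"
  shows "prob_space Q" "sets Q = sets M" "null_sets Q = null_sets M"
proof -
  interpret M: prob_space M by fact
  define G where "G = gen_filtration M T S T"
  have sG: "subalgebra M G" using sub by (simp add: subalgebra_def G_def)
  have QS: "prob_space QS" "space QS = space M" "sets QS = sets G" "null_sets QS = null_sets M \<inter> sets G"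
    using emm by (simp_all add: equivalent_martingale_measure_def Let_def G_def)
  define M0 where "M0 = restr_to_subalg M G"
  interpret M0: prob_space M0
    unfolding M0_def by (rule prob_space_restr_to_subalg[OF sG M.prob_space_axioms])
  have sets0: "sets M0 = sets G" unfolding M0_def by (rule sets_restr_to_subalg[OF sG])
  have space0: "space M0 = space M" by (simp add: M0_def space_restr_to_subalg)
  define f where "f = RN_deriv M0 QS"
  have Q: "Q = density M f" by (simp add: Q_def extended_measure_def f_def M0_def G_def)
  have "absolutely_continuous M0 QS"
    unfolding absolutely_continuous_def QS(4) M0_def null_sets_restr_to_subalg[OF sG] by blast
  then have dens: "density M0 f = QS"
    unfolding f_def by (rule M0.density_RN_deriv) (simp add: QS(3) sets0)
  have "f \<in> borel_measurable M0" by (simp add: f_def)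
  then have fG: "f \<in> borel_measurable G" using measurable_cong_sets[OF sets0 refl] by auto
  then have fM [measurable]: "f \<in> borel_measurable M" by (rule measurable_from_subalg[OF sG])
  have em: "emeasure Q A = emeasure QS A" if A: "A \<in> sets G" for A
  proof -
    have AM: "A \<in> sets M" using A sub by (auto simp: G_def)
    have "emeasure QS A = (\<integral>\<^sup>+x. f x * indicator A x \<partial>M0)"
      unfolding dens[symmetric] by (rule emeasure_density) (simp_all add: f_def sets0 A)
    also have "\<dots> = (\<integral>\<^sup>+x. f x * indicator A x \<partial>M)"
      unfolding M0_def by (rule nn_integral_subalgebra2[OF sG]) (use fG A in measurable)
    also have "\<dots> = emeasure Q A" unfolding Q by (rule emeasure_density[symmetric]) (use AM in auto)
    finally show ?thesis by simp
  qed
  show "sets Q = sets M" by (simp add: Q)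
  have "space M \<in> sets G" using sets.top[of G] sub by (simp add: G_def)
  from em[OF this] have "emeasure Q (space M) = 1"
    using prob_space.emeasure_space_1[OF QS(1)] QS(2) by simp
  then show "prob_space Q" by (intro prob_spaceI) (simp add: Q)
  define Z where "Z = {x\<in>space G. f x = 0}"
  have Z: "Z \<in> sets G" unfolding Z_def using fG by measurable
  have "emeasure QS Z = (\<integral>\<^sup>+x. f x * indicator Z x \<partial>M0)"
    unfolding dens[symmetric] by (rule emeasure_density) (simp_all add: f_def sets0 Z)
  also have "\<dots> = 0"
    by (subst nn_integral_cong[of M0 _ "\<lambda>_. 0"]) (auto simp: Z_def split: split_indicator)
  finally have "Z \<in> null_sets QS" using Z by (simp add: null_sets_def QS(3))
  then have "Z \<in> null_sets M" by (simp add: QS(4))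
  from AE_not_in[OF this] AE_space have fpos: "AE x in M. f x \<noteq> 0"
    by eventually_elim (use sub in \<open>auto simp: Z_def G_def\<close>)
  show "null_sets Q = null_sets M"
  proof (intro set_eqI iffI)
    fix A assume "A \<in> null_sets Q"
    then have A: "A \<in> sets M" "AE x in M. x \<in> A \<longrightarrow> f x = 0" by (auto simp: Q null_sets_density_iff)
    from A(2) fpos have "AE x in M. x \<notin> A" by eventually_elim auto
    then show "A \<in> null_sets M" using A(1) by (simp add: AE_iff_null_sets)
  next
    fix A assume A: "A \<in> null_sets M"
    then show "A \<in> null_sets Q" using AE_not_in[OF A] by (auto simp: Q null_sets_density_iff elim!: eventually_mono)
  qed
qed

section \<open>Market-consistent dynamic evaluations\<close>

locale evaluated_market = insurance_market M F T S Y
  for M :: "'a measure" and F :: "real \<Rightarrow> 'a measure" and T :: real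
    and S :: "real \<Rightarrow> 'a \<Rightarrow> real ^ 'n" and Y :: "real \<Rightarrow> 'a \<Rightarrow> real" +
  fixes Q :: "'a measure" and \<Phi> :: "('a \<Rightarrow> real) \<Rightarrow> ('a \<Rightarrow> real) \<Rightarrow> 'a \<Rightarrow> real"
  assumes Q: "prob_space Q" "sets Q = sets M" "null_sets Q = null_sets M"
    and dynamic: "dynamic_evaluation M T F \<Phi>"
    and consistent: "market_consistent M T F (gen_filtration M T S T) Q \<Phi>"
    and continuous: "\<And>\<sigma>. \<sigma> \<in> \<S> \<Longrightarrow> continuous_eval M (F T) (\<Phi> \<sigma>)"
begin

abbreviation stock_at where
  "stock_at \<sigma> \<equiv> join_sigma M (gen_filtration M T S T) (pre_sigma \<sigma>)"

lemma conditional_evaluation_Phi: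
  "\<sigma> \<in> \<S> \<Longrightarrow> conditional_evaluation M Q (pre_sigma \<sigma>) (F T) (\<Phi> \<sigma>)"
  using Q dynamic continuous prob_space_axioms
  by (simp add: conditional_evaluation_def conditional_evaluation_axioms_def dynamic_evaluation_def)

lemma time_consistent:
  assumes "\<sigma> \<in> \<S>" "\<tau> \<in> \<S>" "AE x in M. \<sigma> x \<le> \<tau> x" "H \<in> Linf M (F T)"
  shows "AE x in M. \<Phi> \<sigma> H x = \<Phi> \<sigma> (\<Phi> \<tau> H) x"
proof -
  have "\<forall>\<sigma>\<in>\<S>. \<forall>\<tau>\<in>\<S>. (AE \<omega> in M. \<sigma> \<omega> \<le> \<tau> \<omega>) \<longrightarrow>
      (\<forall>H\<in>Linf M (F T). AE \<omega> in M. \<Phi> \<sigma> H \<omega> = \<Phi> \<sigma> (\<Phi> \<tau> H) \<omega>)"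
    using dynamic unfolding dynamic_evaluation_def by (rule conjunct2)
  from bspec[OF mp[OF bspec[OF bspec[OF this assms(1)] assms(2)] assms(3)] assms(4)] show ?thesis .
qed

lemma market_consistentD:
  assumes "\<sigma> \<in> \<S>" "m \<in> Linf M (stock_at \<sigma>)" "H \<in> Linf M (F T)"
  shows "AE x in M. \<Phi> \<sigma> (\<lambda>x. m x + H x) x = real_cond_exp Q (pre_sigma \<sigma>) m x + \<Phi> \<sigma> H x"
  by (rule bspec[OF bspec[OF bspec[OF consistent[unfolded market_consistent_def] assms(1)] assms(2)] assms(3)])

lemma stock_at_sub_F_T: "\<sigma> \<in> \<S> \<Longrightarrow> sets (stock_at \<sigma>) \<subseteq> sets (F T)"
  by (intro sets_join_sigma_least gen_S_sub_F pre_sigma_sub_F_T)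
    (simp_all add: space_gen_filtration space_pre_sigma space_F)

lemma market_evaluation_Phi:
  assumes s: "\<sigma> \<in> \<S>" and G: "sets G \<subseteq> sets (stock_at \<sigma>)" "space G = space M"
    "sets (pre_sigma \<sigma>) \<subseteq> sets G"
  shows "market_evaluation M Q (pre_sigma \<sigma>) (F T) (\<Phi> \<sigma>) G"
proof -
  interpret conditional_evaluation M Q "pre_sigma \<sigma>" "F T" "\<Phi> \<sigma>" by (rule conditional_evaluation_Phi[OF s])
  show ?thesis
  proof
    show "sets G \<subseteq> sets (F T)" using G(1) stock_at_sub_F_T[OF s] by (rule order_trans)
    fix m H assume "m \<in> Linf M G" and H: "H \<in> Linf M (F T)"
    then have "m \<in> Linf M (stock_at \<sigma>)"
      by (intro Linf_mono[OF G(1)]) (simp_all add: G space_join_sigma)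
    from market_consistentD[OF s this H]
    show "AE x in M. \<Phi> \<sigma> (\<lambda>x. m x + H x) x = real_cond_exp Q (pre_sigma \<sigma>) m x + \<Phi> \<sigma> H x" .
  qed (use G in auto)
qed

text \<open>Market consistency with zero residual claim: on claims decided by the full stock history
  and \<open>pre_sigma \<sigma>\<close>, the evaluation is linear.\<close>

lemma Phi_eq_cond_exp:
  assumes s: "\<sigma> \<in> \<S>" and X: "X \<in> Linf M (stock_at \<sigma>)"
  shows "AE x in M. \<Phi> \<sigma> X x = real_cond_exp Q (pre_sigma \<sigma>) X x"
proof -
  interpret conditional_evaluation M Q "pre_sigma \<sigma>" "F T" "\<Phi> \<sigma>" by (rule conditional_evaluation_Phi[OF s])
  have "AE x in M. \<Phi> \<sigma> (\<lambda>x. X x + 0) x = real_cond_exp Q (pre_sigma \<sigma>) X x + \<Phi> \<sigma> (\<lambda>_. 0) x"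
    by (rule market_consistentD[OF s X Linf_const])
  with phi_zero show ?thesis by eventually_elim simp
qed

text \<open>Time consistency inserts \<open>\<Phi> \<rho>\<close>, locality at \<open>\<rho>\<close>
  extracts the indicator, and market consistency prices the result. Only the restricted value must
  be a stock claim, so the lemma also covers pasted times whose evaluation is controlled merely on
  \<open>B\<close>.\<close>

lemma Phi_indicator_eq_cond_exp:
  assumes s: "\<sigma> \<in> \<S>" and r: "\<rho> \<in> \<S>" and le: "AE x in M. \<sigma> x \<le> \<rho> x"
    and B: "B \<in> sets (pre_sigma \<rho>)" and H: "H \<in> Linf M (F T)"
    and stock: "(cut B (\<Phi> \<rho> H)) \<in> Linf M (stock_at \<sigma>)"
  shows "AE x in M. \<Phi> \<sigma> (cut B H) x = real_cond_exp Q (pre_sigma \<sigma>) (cut B (\<Phi> \<rho> H)) x"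
proof -
  interpret s: conditional_evaluation M Q "pre_sigma \<sigma>" "F T" "\<Phi> \<sigma>" by (rule conditional_evaluation_Phi[OF s])
  interpret r: conditional_evaluation M Q "pre_sigma \<rho>" "F T" "\<Phi> \<rho>" by (rule conditional_evaluation_Phi[OF r])
  have BH: "(cut B H) \<in> Linf M (F T)"
    using B pre_sigma_sub_F_T[OF r] by (intro Linf_indicator_mult H) auto
  have rF: "X \<in> Linf M (F T)" if "X \<in> Linf M (pre_sigma \<rho>)" for X
    by (rule Linf_mono[OF pre_sigma_sub_F_T[OF r] _ that]) (simp add: space_pre_sigma space_F)
  have "AE x in M. \<Phi> \<sigma> (\<Phi> \<rho> (cut B H)) x = \<Phi> \<sigma> (cut B (\<Phi> \<rho> H)) x"
    by (rule s.phi_cong[OF rF[OF r.phi_Linf[OF BH]] _ r.phi_local[OF B H]])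
      (rule rF[OF Linf_indicator_mult[OF B r.phi_Linf[OF H]]])
  with time_consistent[OF s r le BH] Phi_eq_cond_exp[OF s stock]
  show ?thesis by eventually_elim simp
qed

text \<open>Where two stopping times coincide, so do their sigma-algebras. The value zero off
  \<open>D\<close> costs nothing, since \<open>D\<close> itself belongs to both.\<close>

lemma measurable_indicator_transfer:
  assumes r: "\<rho> \<in> \<S>" and t: "\<theta> \<in> \<S>"
    and D: "D \<in> sets (pre_sigma \<theta>)" and eq: "\<And>x. x \<in> D \<Longrightarrow> \<theta> x = \<rho> x" and f: "f \<in> borel_measurable (pre_sigma \<theta>)"
  shows "(\<lambda>x. indicator D x * f x :: real) \<in> borel_measurable (pre_sigma \<rho>)"
proof (rule measurableI)
  fix B :: "real set" assume B: "B \<in> sets borel"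
  have D\<rho>: "D \<in> sets (pre_sigma \<rho>)" by (rule pre_sigma_le_on[OF t r D]) (simp add: eq)
  have "f -` B \<inter> space (pre_sigma \<theta>) \<inter> D \<in> sets (pre_sigma \<theta>)"
    using measurable_sets[OF f B] D by (rule sets.Int)
  then have 1: "f -` B \<inter> space (pre_sigma \<theta>) \<inter> D \<in> sets (pre_sigma \<rho>)"
    by (rule pre_sigma_le_on[OF t r]) (simp add: eq)
  have DM: "D \<subseteq> space M" by (rule pre_sigma_into_space[OF D])
  have "(cut D f) -` B \<inter> space (pre_sigma \<rho>)
      = (f -` B \<inter> space (pre_sigma \<theta>) \<inter> D) \<union> (if 0 \<in> B then space (pre_sigma \<rho>) - D else {})"
    using DM by (auto simp: space_pre_sigma split: split_indicator_asm if_splits)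
  also have "\<dots> \<in> sets (pre_sigma \<rho>)" using 1 D\<rho> by auto
  finally show "(cut D f) -` B \<inter> space (pre_sigma \<rho>) \<in> sets (pre_sigma \<rho>)" .
qed simp

end

section \<open>Additivity and bounded densities along an announcing sequence\<close>

locale announced_market = evaluated_market M F T S Y Q \<Phi>
  for M :: "'a measure" and F :: "real \<Rightarrow> 'a measure" and T :: real
    and S :: "real \<Rightarrow> 'a \<Rightarrow> real ^ 'n" and Y :: "real \<Rightarrow> 'a \<Rightarrow> real" and Q \<Phi> +
  fixes \<sigma> :: "'a \<Rightarrow> real" and \<rho> :: "nat \<Rightarrow> 'a \<Rightarrow> real"
  assumes sigma: "\<sigma> \<in> \<S>" and ann: "announces \<rho> \<sigma>"
begin

sublocale E: conditional_evaluation M Q "pre_sigma \<sigma>" "F T" "\<Phi> \<sigma>"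
  by (rule conditional_evaluation_Phi[OF sigma])

lemma rho: "\<rho> n \<in> \<S>"
  using ann by (simp add: announces_def)

lemma sigma_le_rho: "AE x in M. \<sigma> x \<le> \<rho> n x"
  using ann unfolding announces_def by (auto elim!: eventually_mono)

lemma rho_le_next: "AE x in M. \<rho> n x \<le> next_jump T Y \<sigma> x"
  using ann unfolding announces_def by (auto elim!: eventually_mono)

lemma pre_rho_sub_stock: "sets (pre_sigma (\<rho> n)) \<subseteq> sets (stock_at \<sigma>)"
proof (rule pre_sigma_before_next_jump[OF sigma rho sigma_le_rho rho_le_next])
  have "AE x in M. \<forall>n i. x \<in> between \<sigma> i \<longrightarrow> \<rho> n x < jump_time T Y (Suc i) x"
    using ann unfolding announces_def by (elim conjE) (rule AE_mp, assumption, rule AE_I2, blast)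
  then show "AE x in M. \<forall>i. x \<in> between \<sigma> i \<longrightarrow> \<rho> n x < jump_time T Y (Suc i) x"
    by eventually_elim blast
qed

lemma pre_rho_mono:
  assumes "m \<le> n"
  shows "sets (pre_sigma (\<rho> m)) \<subseteq> sets (pre_sigma (\<rho> n))"
proof (rule pre_sigma_mono_AE[OF rho rho])
  have "AE x in M. incseq (\<lambda>n. \<rho> n x)"
    using ann unfolding announces_def by (auto elim!: eventually_mono)
  then show "AE x in M. \<rho> m x \<le> \<rho> n x"
    by eventually_elim (rule incseqD[OF _ assms])
qed

definition G :: "'a measure" where "G = sigma (space M) (\<Union>n. sets (pre_sigma (\<rho> n)))"

lemma space_G: "space G = space M"
  by (simp add: G_def space_measure_of_conv)

lemma sets_G: "sets G = sigma_sets (space M) (\<Union>n. sets (pre_sigma (\<rho> n)))"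
  unfolding G_def by (rule sets_measure_of) (use pre_sigma_into_space in blast)

lemma pre_rho_sub_G: "sets (pre_sigma (\<rho> n)) \<subseteq> sets G"
  unfolding sets_G by (auto intro: sigma_sets.Basic)

lemma G_least: "space N = space M \<Longrightarrow> (\<And>n. sets (pre_sigma (\<rho> n)) \<subseteq> sets N) \<Longrightarrow> sets G \<subseteq> sets N"
  unfolding sets_G using sets.sigma_sets_subset[of "\<Union>n. sets (pre_sigma (\<rho> n))" N] by auto

sublocale G: market_evaluation M Q "pre_sigma \<sigma>" "F T" "\<Phi> \<sigma>" G
proof (rule market_evaluation_Phi[OF sigma _ space_G])
  show "sets G \<subseteq> sets (stock_at \<sigma>)" by (rule G_least[OF space_join_sigma pre_rho_sub_stock])
  show "sets (pre_sigma \<sigma>) \<subseteq> sets G"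
    using pre_sigma_mono_AE[OF sigma rho[of 0] sigma_le_rho] pre_rho_sub_G by (rule order_trans)
qed

lemma Linf_pre_rho_stock: "X \<in> Linf M (pre_sigma (\<rho> n)) \<Longrightarrow> X \<in> Linf M (stock_at \<sigma>)"
  by (rule Linf_mono[OF pre_rho_sub_stock]) (simp_all add: space_pre_sigma space_join_sigma)

lemma indicator_mult_F_T: "E \<in> sets G \<Longrightarrow> H \<in> Linf M (F T) \<Longrightarrow> (cut E H) \<in> Linf M (F T)"
  using G.subG by (intro Linf_indicator_mult) auto

lemma additive_rho:
  assumes B: "B \<in> sets (pre_sigma (\<rho> n))" and H: "H \<in> Linf M (F T)"
  shows "AE x in M. \<Phi> \<sigma> H x = \<Phi> \<sigma> (cut B H) x + \<Phi> \<sigma> (cut (space M - B) H) x"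
proof -
  interpret r: conditional_evaluation M Q "pre_sigma (\<rho> n)" "F T" "\<Phi> (\<rho> n)"
    by (rule conditional_evaluation_Phi[OF rho])
  let ?X = "\<Phi> (\<rho> n) H"
  have cB: "space M - B \<in> sets (pre_sigma (\<rho> n))" using sets.compl_sets[OF B] by (simp add: space_pre_sigma)
  have X: "?X \<in> Linf M (pre_sigma (\<rho> n))" by (rule r.phi_Linf[OF H])
  note L = Linf_indicator_mult[OF B X] Linf_indicator_mult[OF cB X]
  note int = E.Linf_integrable[OF L(1) pre_sigma_sub[OF rho] space_pre_sigma]
    E.Linf_integrable[OF L(2) pre_sigma_sub[OF rho] space_pre_sigma]
  have 1: "AE x in M. \<Phi> \<sigma> H x = real_cond_exp Q (pre_sigma \<sigma>) ?X x"
    using time_consistent[OF sigma rho sigma_le_rho H, of n] Phi_eq_cond_exp[OF sigma Linf_pre_rho_stock[OF X]]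
    by eventually_elim simp
  have 2: "AE x in M. \<Phi> \<sigma> (cut B H) x = real_cond_exp Q (pre_sigma \<sigma>) (\<lambda>x. indicator B x * ?X x) x"
    by (rule Phi_indicator_eq_cond_exp[OF sigma rho sigma_le_rho B H Linf_pre_rho_stock[OF L(1)]])
  have 3: "AE x in M. \<Phi> \<sigma> (cut (space M - B) H) x
      = real_cond_exp Q (pre_sigma \<sigma>) (\<lambda>x. indicator (space M - B) x * ?X x) x"
    by (rule Phi_indicator_eq_cond_exp[OF sigma rho sigma_le_rho cB H Linf_pre_rho_stock[OF L(2)]])
  have "AE x in Q. ?X x = indicator B x * ?X x + indicator (space M - B) x * ?X x"
    using AE_space by eventually_elim (auto simp: E.spQ split: split_indicator)
  moreover have "?X \<in> borel_measurable Q" by (rule r.phi_measurable[OF H])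
  ultimately have "AE x in Q. real_cond_exp Q (pre_sigma \<sigma>) ?X x
      = real_cond_exp Q (pre_sigma \<sigma>) (\<lambda>x. indicator B x * ?X x + indicator (space M - B) x * ?X x) x"
    using int by (intro G.QA.real_cond_exp_cong) auto
  moreover note G.QA.real_cond_exp_add[OF int]
  ultimately have "AE x in M. real_cond_exp Q (pre_sigma \<sigma>) ?X x
      = real_cond_exp Q (pre_sigma \<sigma>) (\<lambda>x. indicator B x * ?X x) x
        + real_cond_exp Q (pre_sigma \<sigma>) (\<lambda>x. indicator (space M - B) x * ?X x) x"
    unfolding E.AE_Q by eventually_elim simp
  with 1 2 3 show ?thesis by eventually_elim simp
qed

lemma additive_G:
  assumes B: "B \<in> sets G" and H: "H \<in> Linf M (F T)"
  shows "AE x in M. \<Phi> \<sigma> H x = \<Phi> \<sigma> (cut B H) x + \<Phi> \<sigma> (cut (space M - B) H) x"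
proof -
  have sub: "subalgebra M (pre_sigma (\<rho> n))" for n
    using pre_sigma_sub[OF rho] by (simp add: subalgebra_def space_pre_sigma)
  \<comment> \<open>A set of \<open>G\<close> need not lie in any single
    \<open>pre_sigma (\<rho> n)\<close>; almost-sure convergence of indicators is exactly what
    continuity of \<open>\<Phi> \<sigma>\<close> can use, and it passes to complements as
    well.\<close>
  obtain n D where D: "\<And>k. D k \<in> sets (pre_sigma (\<rho> (n k)))"
    and lim: "AE x in M. (\<lambda>k. indicator (D k) x :: real) \<longlonglongrightarrow> indicator B x"
    by (rule indicator_approx_AE[of "\<lambda>n. pre_sigma (\<rho> n)" B]) (use sub pre_rho_mono B in \<open>auto simp: sets_G\<close>)
  have DG: "D k \<in> sets G" for k using D pre_rho_sub_G by blast
  have cDG: "space M - D k \<in> sets G" for k using sets.compl_sets[OF DG] by (simp add: space_G)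
  have cB: "space M - B \<in> sets G" using sets.compl_sets[OF B] by (simp add: space_G)
  obtain K where K: "AE x in M. \<bar>H x\<bar> \<le> K" using H by (auto simp: Linf_def)
  have bd: "AE x in M. \<bar>indicator E x * H x\<bar> \<le> K" for E :: "'a set"
    using K by eventually_elim (auto split: split_indicator)
  have "AE x in M. (\<lambda>k. \<Phi> \<sigma> (cut (D k) H) x) \<longlonglongrightarrow> \<Phi> \<sigma> (cut B H) x"
    by (rule E.phi_convergence[OF indicator_mult_F_T[OF DG H] indicator_mult_F_T[OF B H] bd])
      (use lim in \<open>auto elim!: eventually_mono intro!: tendsto_intros\<close>)
  moreover have "AE x in M. (\<lambda>k. \<Phi> \<sigma> (cut (space M - D k) H) x)
      \<longlonglongrightarrow> \<Phi> \<sigma> (cut (space M - B) H) x"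
  proof (rule E.phi_convergence[OF indicator_mult_F_T[OF cDG H] indicator_mult_F_T[OF cB H] bd])
    show "AE x in M. (\<lambda>k. indicator (space M - D k) x * H x) \<longlonglongrightarrow> indicator (space M - B) x * H x"
      using lim AE_space
    proof eventually_elim
      case (elim x)
      have ind: "indicator (space M - E) x = 1 - (indicator E x :: real)" for E
        using elim(2) by (auto split: split_indicator)
      show ?case unfolding ind using elim(1) by (intro tendsto_intros)
    qed
  qed
  moreover have "AE x in M. \<forall>k. \<Phi> \<sigma> H x = \<Phi> \<sigma> (cut (D k) H) x
      + \<Phi> \<sigma> (cut (space M - D k) H) x"
    unfolding AE_all_countable using additive_rho[OF D H] by (rule allI)
  ultimately show ?thesis
  proof eventually_elim
    case (elim x)
    have "(\<lambda>k. \<Phi> \<sigma> (cut (D k) H) x + \<Phi> \<sigma> (cut (space M - D k) H) x)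
        \<longlonglongrightarrow> \<Phi> \<sigma> (cut B H) x + \<Phi> \<sigma> (cut (space M - B) H) x"
      using elim(1,2) by (rule tendsto_add)
    then have "(\<lambda>k::nat. \<Phi> \<sigma> H x) \<longlonglongrightarrow> \<Phi> \<sigma> (cut B H) x + \<Phi> \<sigma> (cut (space M - B) H) x"
      by (subst (asm) elim(3)[rule_format, symmetric])
    then show ?case by (simp add: LIMSEQ_const_iff)
  qed
qed

text \<open>Disjoint sets \<open>D j\<close> known at times \<open>\<rho> (k j)\<close> are served
  by one stopping time \<open>\<theta>\<close>. The integral of \<open>c\<close> over
  \<open>D j\<close> equals that of \<open>\<Phi> \<theta> H\<close>, a single bounded claim, so one
  constant bounds all averages; the gliding hump lemma does the rest.\<close>

lemma density_bounded:
  assumes c: "integrable Q c" "c \<in> borel_measurable G" and H: "H \<in> Linf M (F T)"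
    and dens: "\<And>B. B \<in> sets G \<Longrightarrow> (\<integral>x. indicator B x * c x \<partial>Q) = (\<integral>x. \<Phi> \<sigma> (cut B H) x \<partial>Q)"
  shows "\<exists>R. AE x in Q. \<bar>c x\<bar> \<le> R"
proof (rule E.Q.bounded_if_averages_bounded[of "\<lambda>n. pre_sigma (\<rho> n)"])
  show "subalgebra Q (pre_sigma (\<rho> n))" for n
    using pre_sigma_sub[OF rho] by (simp add: subalgebra_def space_pre_sigma E.spQ E.sets_Q)
  show "sets (pre_sigma (\<rho> m)) \<subseteq> sets (pre_sigma (\<rho> n))" if "m \<le> n" for m n by (rule pre_rho_mono[OF that])
  show "integrable Q c" by (rule c(1))
  show "c \<in> borel_measurable (sigma (space Q) (\<Union>n. sets (pre_sigma (\<rho> n))))"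
    using c(2) by (simp add: G_def E.spQ)
  fix D :: "nat \<Rightarrow> 'a set" and k assume dis: "disjoint_family D" and D: "\<And>j. D j \<in> sets (pre_sigma (\<rho> (k j)))"
  have DM: "D j \<subseteq> space M" for j by (rule pre_sigma_into_space[OF D])
  \<comment> \<open>Off the sets \<open>D j\<close> the value \<open>T\<close> is admissible: all
    \<open>\<rho> n\<close> are at most \<open>T\<close>, so the complement is decided by
    then.\<close>
  define \<theta> where "\<theta> x = (if \<exists>j. x \<in> D j then \<rho> (k (THE j. x \<in> D j)) x else T)" for x
  have \<theta>_D: "\<theta> x = \<rho> (k j) x" if x: "x \<in> D j" for x j
  proof -
    have "(THE j. x \<in> D j) = j"
      by (rule the_equality[of "\<lambda>j. x \<in> D j", OF x]) (use dis x in \<open>auto simp: disjoint_family_on_def\<close>)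
    then show ?thesis using x by (auto simp: \<theta>_def)
  qed
  have T_st: "(\<lambda>_. T) \<in> \<S>" using T_pos by (intro stopping_times_const) auto
  define D' where "D' j = (case j of 0 \<Rightarrow> space M - (\<Union>j. D j) | Suc j \<Rightarrow> D j)" for j
  define r where "r j = (case j of 0 \<Rightarrow> (\<lambda>_. T) | Suc j \<Rightarrow> \<rho> (k j))" for j
  have \<theta>: "\<theta> \<in> \<S>"
  proof (rule stopping_times_patch[of r D'])
    show "r j \<in> \<S>" for j using T_st rho by (simp add: r_def split: nat.split)
    show "D' j \<in> sets (pre_sigma (r j))" for j
    proof (cases j)
      case 0
      have "D j \<in> sets (pre_sigma (\<lambda>_. T))" for j
        by (rule pre_sigma_le_on[OF rho T_st D]) (use stopping_timesD(3)[OF rho] DM in auto)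
      then have "space (pre_sigma (\<lambda>_. T)) - (\<Union>j. D j) \<in> sets (pre_sigma (\<lambda>_. T))" by auto
      then show ?thesis using 0 by (simp add: D'_def r_def space_pre_sigma)
    next
      case (Suc i)
      then show ?thesis using D by (simp add: D'_def r_def)
    qed
    show "\<theta> x = r j x" if x: "x \<in> D' j" for j x
    proof (cases j)
      case 0
      then show ?thesis using x by (simp add: D'_def r_def \<theta>_def)
    next
      case (Suc i)
      then show ?thesis using x \<theta>_D[of x i] by (simp add: D'_def r_def)
    qed
    show "space M \<subseteq> (\<Union>j. D' j)"
    proof
      fix x assume "x \<in> space M"
      then have "x \<in> D' 0 \<or> (\<exists>j. x \<in> D' (Suc j))" by (auto simp: D'_def)
      then show "x \<in> (\<Union>j. D' j)" by blast
    qed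
  qed
  interpret t: conditional_evaluation M Q "pre_sigma \<theta>" "F T" "\<Phi> \<theta>" by (rule conditional_evaluation_Phi[OF \<theta>])
  have \<theta>_le: "AE x in M. \<sigma> x \<le> \<theta> x"
  proof -
    have "AE x in M. \<forall>n. \<sigma> x \<le> \<rho> n x" unfolding AE_all_countable using sigma_le_rho by (rule allI)
    then show ?thesis
      using AE_space by eventually_elim (use stopping_timesD(3)[OF sigma] in \<open>auto simp: \<theta>_def\<close>)
  qed
  have X: "\<Phi> \<theta> H \<in> Linf M (pre_sigma \<theta>)" by (rule t.phi_Linf[OF H])
  then obtain R where R: "AE x in M. \<bar>\<Phi> \<theta> H x\<bar> \<le> R" by (auto simp: Linf_def)
  have "\<bar>\<integral>x. indicator (D j) x * c x \<partial>Q\<bar> \<le> R * measure Q (D j)" for j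
  proof -
    have D\<theta>: "D j \<in> sets (pre_sigma \<theta>)"
      by (rule pre_sigma_le_on[OF rho \<theta> D]) (simp add: \<theta>_D)
    have DQ: "D j \<in> sets Q" using D pre_sigma_sub[OF rho] by (auto simp: E.sets_Q)
    \<comment> \<open>On \<open>D j\<close> the time \<open>\<theta>\<close> is
      \<open>\<rho> (k j)\<close>, so the restricted value is known there and hence is a stock
      claim, although \<open>\<theta>\<close> may pass the next jump elsewhere.\<close>
    have "(cut (D j) (\<Phi> \<theta> H)) \<in> borel_measurable (pre_sigma (\<rho> (k j)))"
      by (rule measurable_indicator_transfer[OF rho \<theta> D\<theta> \<theta>_D]) (use X in \<open>auto simp: Linf_def\<close>)
    moreover have ind_le: "AE x in M. \<bar>indicator (D j) x * \<Phi> \<theta> H x\<bar> \<le> R * indicator (D j) x"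
      using R by eventually_elim (auto split: split_indicator)
    then have "AE x in M. \<bar>indicator (D j) x * \<Phi> \<theta> H x\<bar> \<le> \<bar>R\<bar>"
      by eventually_elim (auto split: split_indicator_asm split_indicator)
    ultimately have XL: "(cut (D j) (\<Phi> \<theta> H)) \<in> Linf M (pre_sigma (\<rho> (k j)))"
      by (auto simp: Linf_def)
    note XS = Linf_pre_rho_stock[OF XL]
    have int: "integrable Q (cut (D j) (\<Phi> \<theta> H))"
      by (rule E.Linf_integrable[OF XL pre_sigma_sub[OF rho] space_pre_sigma])
    have DG: "D j \<in> sets G" using D pre_rho_sub_G by blast
    have "(\<integral>x. indicator (D j) x * c x \<partial>Q) = (\<integral>x. \<Phi> \<sigma> (cut (D j) H) x \<partial>Q)"
      by (rule dens[OF DG])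
    also have "\<dots> = (\<integral>x. real_cond_exp Q (pre_sigma \<sigma>) (cut (D j) (\<Phi> \<theta> H)) x \<partial>Q)"
    proof (rule integral_cong_AE)
      show "\<Phi> \<sigma> (cut (D j) H) \<in> borel_measurable Q"
        by (rule E.phi_measurable[OF indicator_mult_F_T[OF DG H]])
      show "AE x in Q. \<Phi> \<sigma> (cut (D j) H) x
          = real_cond_exp Q (pre_sigma \<sigma>) (cut (D j) (\<Phi> \<theta> H)) x"
        unfolding E.AE_Q by (rule Phi_indicator_eq_cond_exp[OF sigma \<theta> \<theta>_le D\<theta> H XS])
    qed simp
    also have "\<dots> = (\<integral>x. indicator (D j) x * \<Phi> \<theta> H x \<partial>Q)"
      by (rule G.QA.real_cond_exp_int(2)[OF int])
    finally have "\<bar>\<integral>x. indicator (D j) x * c x \<partial>Q\<bar> = \<bar>\<integral>x. indicator (D j) x * \<Phi> \<theta> H x \<partial>Q\<bar>" by simp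
    also have "\<dots> \<le> (\<integral>x. \<bar>indicator (D j) x * \<Phi> \<theta> H x\<bar> \<partial>Q)" by (rule integral_abs_bound)
    also have "\<dots> \<le> (\<integral>x. R * indicator (D j) x \<partial>Q)"
    proof (rule E.integral_mono_M[OF _ _ ind_le])
      show "integrable Q (\<lambda>x. \<bar>indicator (D j) x * \<Phi> \<theta> H x\<bar>)" using int by (rule integrable_abs)
      show "integrable Q (\<lambda>x. R * indicator (D j) x)"
        using DQ by (intro integrable_mult_right integrable_real_indicator) (auto simp: less_top[symmetric])
    qed
    also have "\<dots> = R * measure Q (D j)" using DQ by (simp add: Int_absorb2 sets.sets_into_space)
    finally show ?thesis .
  qed
  then show "\<exists>R. \<forall>j. \<bar>\<integral>x. indicator (D j) x * c x \<partial>Q\<bar> \<le> R * measure Q (D j)" by (intro exI allI)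
qed

end

section \<open>The market local property and the representation at the next jump\<close>

context announced_market begin

abbreviation Stock :: "'a measure" where "Stock \<equiv> stock_sigma_next_jump M T S Y \<sigma>"

lemma Stock_sub_G: "sets Stock \<subseteq> sets G"
  unfolding sets_G by (rule stock_sigma_next_jump_sub[OF sigma ann])

lemma G_sub_next: "sets G \<subseteq> sets (pre_sigma (next_jump T Y \<sigma>))"
  by (rule G_least[OF space_pre_sigma pre_sigma_mono_AE[OF rho next_jump_stopping[OF sigma] rho_le_next]])

lemma Linf_next: "H \<in> Linf M (pre_sigma (next_jump T Y \<sigma>)) \<Longrightarrow> H \<in> Linf M (F T)"
  by (rule Linf_mono[OF pre_sigma_sub_F_T[OF next_jump_stopping[OF sigma]]]) (simp_all add: space_pre_sigma space_F)

lemma market_local_Phi: "market_local M Stock (pre_sigma (next_jump T Y \<sigma>)) (\<Phi> \<sigma>)"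
  unfolding market_local_def
proof (intro ballI)
  fix E H assume "E \<in> sets Stock" "H \<in> Linf_nonneg M (pre_sigma (next_jump T Y \<sigma>))"
  then show "AE x in M. \<Phi> \<sigma> H x = \<Phi> \<sigma> (cut E H) x + \<Phi> \<sigma> (cut (space M - E) H) x"
    using Stock_sub_G by (intro additive_G Linf_next) (auto simp: Linf_nonneg_def)
qed

text \<open>Projecting the density from \<open>G\<close> to \<open>Stock\<close> under
  \<open>Q\<close> preserves its bound and its integrals over sets of \<open>Stock\<close>.\<close>

lemma bounded_stock_density:
  assumes bounded: "\<exists>R. \<forall>E\<in>sets (F T). AE x in M. \<bar>\<Phi> \<sigma> (cut E H) x\<bar> \<le> R"
    and H: "H \<in> Linf M (F T)"
  shows "\<exists>X\<in>Linf M Stock. \<forall>E\<in>sets Stock.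
    (\<integral>x. indicator E x * X x \<partial>Q) = (\<integral>x. \<Phi> \<sigma> (cut E H) x \<partial>Q)"
proof -
  obtain R where "\<forall>E\<in>sets (F T). AE x in M. \<bar>\<Phi> \<sigma> (cut E H) x\<bar> \<le> R" using bounded ..
  then have "AE x in M. \<bar>\<Phi> \<sigma> (cut E H) x\<bar> \<le> R" if "E \<in> sets G" for E
    using that G.subG by blast
  from G.density_exists[OF additive_G this H] obtain c where
    "integrable Q c \<and> c \<in> borel_measurable G \<and>
      (\<forall>E\<in>sets G. (\<integral>x. indicator E x * c x \<partial>Q) = (\<integral>x. \<Phi> \<sigma> (cut E H) x \<partial>Q))" ..
  then have c: "integrable Q c" "c \<in> borel_measurable G"
    and dens: "\<And>E. E \<in> sets G \<Longrightarrow> (\<integral>x. indicator E x * c x \<partial>Q) = (\<integral>x. \<Phi> \<sigma> (cut E H) x \<partial>Q)"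
    by simp_all
  obtain K where K: "AE x in Q. \<bar>c x\<bar> \<le> K" using density_bounded[OF c H dens] ..
  have Stock_M: "sets Stock \<subseteq> sets M" using Stock_sub_G G.subG E.subC by blast
  interpret QS: sigma_finite_subalgebra Q Stock
    by (rule E.sigma_finite_subalgebra_Q[OF Stock_M space_stock_sigma_next_jump])
  define X where "X = real_cond_exp Q Stock c"
  have "AE x in Q. X x \<le> K"
    unfolding X_def by (rule QS.real_cond_exp_le_c[OF c(1)]) (use K in \<open>auto elim!: eventually_mono\<close>)
  moreover have "AE x in Q. - K \<le> X x"
    unfolding X_def by (rule QS.real_cond_exp_ge_c[OF c(1)]) (use K in \<open>auto elim!: eventually_mono\<close>)
  ultimately have "AE x in M. \<bar>X x\<bar> \<le> K" unfolding E.AE_Q by eventually_elim auto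
  then have "X \<in> Linf M Stock" by (auto simp: Linf_def X_def)
  moreover have "(\<integral>x. indicator E x * X x \<partial>Q) = (\<integral>x. \<Phi> \<sigma> (cut E H) x \<partial>Q)" if E: "E \<in> sets Stock" for E
  proof -
    have "(\<integral>x. indicator E x * X x \<partial>Q) = (\<integral>x. indicator E x * c x \<partial>Q)"
      using QS.real_cond_exp_intA[OF c(1) E] by (simp add: X_def set_lebesgue_integral_def)
    also have "\<dots> = (\<integral>x. \<Phi> \<sigma> (cut E H) x \<partial>Q)"
      using E Stock_sub_G by (intro dens) auto
    finally show ?thesis .
  qed
  ultimately show ?thesis by (intro bexI[of _ X] ballI)
qed

lemma representation:
  assumes bounded: "\<And>H. H \<in> Linf M (F T) \<Longrightarrow>
    \<exists>R. \<forall>E\<in>sets (F T). AE x in M. \<bar>\<Phi> \<sigma> (cut E H) x\<bar> \<le> R"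
  shows "\<exists>\<Psi>. cond_evaluation M Stock (pre_sigma (next_jump T Y \<sigma>)) \<Psi> \<and>
    (\<forall>H\<in>Linf M (pre_sigma (next_jump T Y \<sigma>)). AE x in M. \<Phi> \<sigma> H x = real_cond_exp Q (pre_sigma \<sigma>) (\<Psi> H) x)"
proof -
  define P where "P H X \<longleftrightarrow> X \<in> Linf M Stock \<and> (\<forall>E\<in>sets Stock.
    (\<integral>x. indicator E x * X x \<partial>Q) = (\<integral>x. \<Phi> \<sigma> (cut E H) x \<partial>Q))" for H X
  \<comment> \<open>Densities are unique only almost surely; any choice works, as all axioms of an
    evaluation are required almost surely.\<close>
  define \<Psi> where "\<Psi> H = (SOME X. P H X)" for H
  have P: "P H (\<Psi> H)" if "H \<in> Linf M (F T)" for H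
  proof -
    have "\<exists>X. P H X" using bounded_stock_density[OF bounded[OF that] that] unfolding P_def by (simp only: Bex_def)
    then show ?thesis unfolding \<Psi>_def by (rule someI_ex)
  qed
  interpret St: market_evaluation M Q "pre_sigma \<sigma>" "F T" "\<Phi> \<sigma>" Stock
  proof (rule market_evaluation_Phi[OF sigma _ space_stock_sigma_next_jump pre_sigma_sub_stock_sigma_next_jump])
    show "sets Stock \<subseteq> sets (stock_at \<sigma>)"
      using Stock_sub_G G_least[OF space_join_sigma pre_rho_sub_stock] by (rule order_trans)
  qed
  interpret D: market_density M Q "pre_sigma \<sigma>" "F T" "\<Phi> \<sigma>" Stock \<Psi>
    by unfold_locales (use P in \<open>simp_all add: P_def\<close>)
  have "cond_evaluation M Stock (pre_sigma (next_jump T Y \<sigma>)) \<Psi>"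
  proof (rule D.cond_evaluation_Psi)
    show "sets Stock \<subseteq> sets (pre_sigma (next_jump T Y \<sigma>))" using Stock_sub_G G_sub_next by (rule order_trans)
    show "sets (pre_sigma (next_jump T Y \<sigma>)) \<subseteq> sets (F T)" by (rule pre_sigma_sub_F_T[OF next_jump_stopping[OF sigma]])
  qed (rule space_pre_sigma)
  moreover have "AE x in M. \<Phi> \<sigma> H x = real_cond_exp Q (pre_sigma \<sigma>) (\<Psi> H) x"
    if "H \<in> Linf M (pre_sigma (next_jump T Y \<sigma>))" for H
    by (rule D.cond_exp_Psi_space[OF Linf_next[OF that]])
  ultimately show ?thesis by (intro exI[of _ \<Psi>] conjI ballI)
qed

end

theorem theorem4p3:
  fixes M :: "'a measure" and T :: real
    and S :: "real \<Rightarrow> 'a \<Rightarrow> real ^ 'n" and Y :: "real \<Rightarrow> 'a \<Rightarrow> real"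
    and F :: "real \<Rightarrow> 'a measure" and QS Q :: "'a measure"
    and \<Phi> :: "('a \<Rightarrow> real) \<Rightarrow> ('a \<Rightarrow> real) \<Rightarrow> 'a \<Rightarrow> real"
  assumes "prob_space M" and "complete_measure M" and "0 < T"
    and "\<And>t. t \<in> {0..T} \<Longrightarrow> S t \<in> borel_measurable M"
    and "\<And>t. t \<in> {0..T} \<Longrightarrow> Y t \<in> borel_measurable M"
    and F: "F = full_filtration M T S Y"
    and "unique_martingale_measure M T S QS"
    and Q: "Q = extended_measure M T S QS"
    and "AE \<omega> in M. continuous_on {0..T} (\<lambda>t. S t \<omega>)"
    and "AE \<omega> in M. cadlag_on T (\<lambda>t. Y t \<omega>)"
    and "finitely_many_predictable_jumps M T F Y"
    and "no_randomness_between_jumps M T Y"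
    and "dynamic_evaluation M T F \<Phi>"
    and "market_consistent M T F (gen_filtration M T S T) Q \<Phi>"
    and "\<forall>\<sigma>\<in>stopping_times M T F. continuous_eval M (F T) (\<Phi> \<sigma>)"
  shows "(\<forall>\<sigma>\<in>stopping_times M T F.
            market_local M (stock_sigma_next_jump M T S Y \<sigma>) (sigma_at M F (next_jump T Y \<sigma>)) (\<Phi> \<sigma>))
       \<and> ((\<forall>\<sigma>\<in>stopping_times M T F. monotone_eval M (F T) (\<Phi> \<sigma>)) \<or>
          (\<forall>\<sigma>\<in>stopping_times M T F. p_norm_bounded_eval M (sigma_at M F \<sigma>) (F T) (\<Phi> \<sigma>)) \<or>
          (\<forall>\<sigma>\<in>stopping_times M T F. pos_homogeneous_eval M (sigma_at M F \<sigma>) (F T) (\<Phi> \<sigma>)) \<longrightarrow>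
          (\<forall>\<sigma>\<in>stopping_times M T F. \<exists>\<Psi>.
             cond_evaluation M (stock_sigma_next_jump M T S Y \<sigma>) (sigma_at M F (next_jump T Y \<sigma>)) \<Psi> \<and>
             (\<forall>H\<in>Linf M (sigma_at M F (next_jump T Y \<sigma>)).
                AE \<omega> in M. \<Phi> \<sigma> H \<omega> = real_cond_exp Q (sigma_at M F \<sigma>) (\<Psi> H) \<omega>)))"
proof -
  interpret complete_filtration M F T
    unfolding F by (rule full_filtration_complete[OF assms(1-5)])
  have emm: "equivalent_martingale_measure M T S QS"
    using assms(7) by (simp add: unique_martingale_measure_def)
  note Q_facts = extended_measure_equivalent[OF assms(1) sets_gen_filtration_subset[OF assms(4)]
      space_gen_filtration emm, folded Q]
  interpret Q: prob_space Q by (rule Q_facts(1))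
  interpret evaluated_market M F T S Y Q \<Phi>
  proof unfold_locales
    show "continuous_eval M (F T) (\<Phi> \<sigma>)" if "\<sigma> \<in> stopping_times M T F" for \<sigma>
      using assms(15) that by blast
  qed (rule Q_facts assms; assumption?)+
  \<comment> \<open>The announcing sequence depends on \<open>\<sigma>\<close>, so the locale is
    entered separately for every stopping time.\<close>
  have ann: "\<exists>\<rho>. announced_market M F T S Y Q \<Phi> \<sigma> \<rho>" if s: "\<sigma> \<in> stopping_times M T F" for \<sigma>
  proof -
    obtain \<rho> where "announces \<rho> \<sigma>" by (rule announcing_sequence[OF s])
    then have "announced_market M F T S Y Q \<Phi> \<sigma> \<rho>" by unfold_locales (use s in auto)
    then show ?thesis by (rule exI[of _ \<rho>])
  qed
  show ?thesis
  proof (intro conjI ballI impI)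
    fix \<sigma> assume "\<sigma> \<in> stopping_times M T F"
    then obtain \<rho> where "announced_market M F T S Y Q \<Phi> \<sigma> \<rho>" using ann by blast
    then interpret announced_market M F T S Y Q \<Phi> \<sigma> \<rho> .
    show "market_local M (stock_sigma_next_jump M T S Y \<sigma>) (sigma_at M F (next_jump T Y \<sigma>)) (\<Phi> \<sigma>)"
      by (rule market_local_Phi)
  next
    fix \<sigma> assume cases: "(\<forall>\<sigma>\<in>stopping_times M T F. monotone_eval M (F T) (\<Phi> \<sigma>)) \<or>
        (\<forall>\<sigma>\<in>stopping_times M T F. p_norm_bounded_eval M (sigma_at M F \<sigma>) (F T) (\<Phi> \<sigma>)) \<or>
        (\<forall>\<sigma>\<in>stopping_times M T F. pos_homogeneous_eval M (sigma_at M F \<sigma>) (F T) (\<Phi> \<sigma>))"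
      and s: "\<sigma> \<in> stopping_times M T F"
    obtain \<rho> where "announced_market M F T S Y Q \<Phi> \<sigma> \<rho>" using ann s by blast
    then interpret announced_market M F T S Y Q \<Phi> \<sigma> \<rho> .
    \<comment> \<open>Each of the three alternatives is needed only for this bound, and only at the
      given \<open>\<sigma>\<close>.\<close>
    have "\<exists>R. \<forall>E\<in>sets (F T). AE x in M. \<bar>\<Phi> \<sigma> (cut E H) x\<bar> \<le> R" if H: "H \<in> Linf M (F T)" for H
      using cases
    proof (elim disjE)
      assume "\<forall>\<sigma>\<in>stopping_times M T F. monotone_eval M (F T) (\<Phi> \<sigma>)"
      from E.uniformly_bounded_monotone[OF bspec[OF this s] H] show ?thesis .
    next
      assume "\<forall>\<sigma>\<in>stopping_times M T F. p_norm_bounded_eval M (sigma_at M F \<sigma>) (F T) (\<Phi> \<sigma>)"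
      from E.uniformly_bounded_p_norm[OF bspec[OF this s] H] show ?thesis .
    next
      assume "\<forall>\<sigma>\<in>stopping_times M T F. pos_homogeneous_eval M (sigma_at M F \<sigma>) (F T) (\<Phi> \<sigma>)"
      from E.uniformly_bounded_pos_homogeneous[OF bspec[OF this s] H] show ?thesis .
    qed
    then show "\<exists>\<Psi>. cond_evaluation M (stock_sigma_next_jump M T S Y \<sigma>) (sigma_at M F (next_jump T Y \<sigma>)) \<Psi> \<and>
       (\<forall>H\<in>Linf M (sigma_at M F (next_jump T Y \<sigma>)).
          AE \<omega> in M. \<Phi> \<sigma> H \<omega> = real_cond_exp Q (sigma_at M F \<sigma>) (\<Psi> H) \<omega>)"
      by (rule representation)
  qed
qed

end
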